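(* Let $n>1$. If the pure, co-spherically contractive Hilbert module $\mathcal{H}$ over $\mathbb{C}[z_1,\dots,z_n]$ possesses a finite inner resolution, then $\mathcal{H}$ is isometrically isomorphic to $H^2_n\otimes\mathcal{F}$ for some Hilbert space $\mathcal{F}$.
   Context: All Hilbert spaces are complex and separable. A Hilbert module over $\mathbb{C}[z_1,\dots,z_n]$ is a Hilbert space with a commuting tuple $(M_1,\dots,M_n)$ of bounded operators. It is co-spherically contractive if $\sum_{i=1}^nM_iM_i^*\le I$; it is pure if in addition $P^l(I)\to0$ strongly as $l\to\infty$, where $P(X)=\sum_{i=1}^nM_iXM_i^*$. Isometrically isomorphic means there is a unitary module map between the modules. $H^2_n$ is the Drury–Arveson module on the open unit ball $\mathbb{B}^n$: the reproducing kernel Hilbert space with kernel $(1-\langle\boldsymbol{z},\boldsymbol{w}\rangle)^{-1}$ and coordinate multiplication operators. $H^2_n\otimes\mathcal{E}$ carries the operators $M_{z_i}\otimes I_{\mathcal{E}}$. $\mathcal{M}_{\mathcal{B}(\mathcal{E},\mathcal{E}_* )}(H^2_n)$ is the set of holomorphic $\varphi:\mathbb{B}^n\to\mathcal{B}(\mathcal{E},\mathcal{E}_* )$ such that $M_\varphi f=\varphi f$ is a bounded operator $H^2_n\otimes\mathcal{E}\to H^2_n\otimes\mathcal{E}_*$; $\varphi$ is an inner multiplier if $M_\varphi$ is a partial isometry. A finite inner resolution (of length $N<\infty$, $N\ge1$) of a pure co-spherically contractive Hilbert module $\mathcal{H}$ consists of Hilbert spaces $\{\mathcal{E}_k\}_{k=0}^N$,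 inner multipliers $\varphi_k\in\mathcal{M}_{\mathcal{B}(\mathcal{E}_k,\mathcal{E}_{k-1})}(H^2_n)$ for $k=1,\dots,N$ with $X_k=M_{\varphi_k}$, and a co-isometric module map $X_0:H^2_n\otimes\mathcal{E}_0\to\mathcal{H}$ such that the sequence $$0\to H^2_n\otimes\mathcal{E}_N\xrightarrow{X_N}H^2_n\otimes\mathcal{E}_{N-1}\to\cdots\to H^2_n\otimes\mathcal{E}_1\xrightarrow{X_1}H^2_n\otimes\mathcal{E}_0\xrightarrow{X_0}\mathcal{H}\to0$$ is exact. *)

theory Defs
  imports "HOL-Analysis.Analysis" "HOL-Library.Function_Algebras"
begin

class complex_vector = ab_group_add +
  fixes scaleC :: "complex \<Rightarrow> 'a \<Rightarrow> 'a"  (infixr "*\<^sub>C" 75)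
  assumes scaleC_add_right: "a *\<^sub>C (x + y) = a *\<^sub>C x + a *\<^sub>C y"
    and scaleC_add_left: "(a + b) *\<^sub>C x = a *\<^sub>C x + b *\<^sub>C x"
    and scaleC_scaleC: "a *\<^sub>C (b *\<^sub>C x) = (a * b) *\<^sub>C x"
    and scaleC_one: "1 *\<^sub>C x = x"

global_interpretation complex_vector:
  vector_space "scaleC :: complex \<Rightarrow> 'a \<Rightarrow> 'a::complex_vector"
  by unfold_locales
    (simp_all add: scaleC_add_right scaleC_add_left scaleC_scaleC scaleC_one)

instantiation complex :: complex_vector
begin
definition scaleC_complex :: "complex \<Rightarrow> complex \<Rightarrow> complex" where
  "scaleC_complex a x = a * x"
instance
  by standard (simp_all add: scaleC_complex_def algebra_simps)
end

instantiation "fun" :: (type, complex_vector) complex_vector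
begin
definition scaleC_fun :: "complex \<Rightarrow> ('a \<Rightarrow> 'b) \<Rightarrow> 'a \<Rightarrow> 'b" where
  "scaleC_fun a f = (\<lambda>x. a *\<^sub>C f x)"
instance
  by standard
    (simp_all add: scaleC_fun_def fun_eq_iff scaleC_add_right scaleC_add_left
      scaleC_scaleC scaleC_one)
end


section \<open>Hilbert spaces and bounded operators\<close>

text \<open>
  A Hilbert space is a linear subspace of some complex vector space type together with an
  inner product (linear in the first argument) of its own; nothing is assumed about the inner
  product outside the carrier. Carriers are used because a resolution involves a family of
  Hilbert spaces indexed by a number, and because the coefficient space in the conclusion is
  existentially quantified.
\<close>

record 'a hilb =
  hcarrier :: "'a set"
  hinner :: "'a \<Rightarrow> 'a \<Rightarrow> complex"

definition hnorm :: "'a hilb \<Rightarrow> 'a \<Rightarrow> real" where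
  "hnorm H x = sqrt (Re (hinner H x x))"

locale hilbert_space =
  fixes H :: "'a::complex_vector hilb"
  assumes subspace_carrier: "complex_vector.subspace (hcarrier H)"
    and inner_add_left:
      "\<lbrakk>x \<in> hcarrier H; y \<in> hcarrier H; z \<in> hcarrier H\<rbrakk>
        \<Longrightarrow> hinner H (x + y) z = hinner H x z + hinner H y z"
    and inner_scaleC_left:
      "\<lbrakk>x \<in> hcarrier H; y \<in> hcarrier H\<rbrakk> \<Longrightarrow> hinner H (a *\<^sub>C x) y = a * hinner H x y"
    and inner_commute:
      "\<lbrakk>x \<in> hcarrier H; y \<in> hcarrier H\<rbrakk> \<Longrightarrow> hinner H y x = cnj (hinner H x y)"
    and inner_positive: "\<lbrakk>x \<in> hcarrier H; x \<noteq> 0\<rbrakk> \<Longrightarrow> 0 < Re (hinner H x x)"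
    and complete:
      "\<lbrakk>\<And>k. s k \<in> hcarrier H;
        \<And>e. e > 0 \<Longrightarrow> \<exists>m0. \<forall>j\<ge>m0. \<forall>k\<ge>m0. hnorm H (s j - s k) < e\<rbrakk>
        \<Longrightarrow> \<exists>x\<in>hcarrier H. (\<lambda>k. hnorm H (s k - x)) \<longlonglongrightarrow> 0"
    and separable:
      "\<exists>S. countable S \<and> S \<subseteq> hcarrier H \<and>
        (\<forall>x\<in>hcarrier H. \<forall>e>0. \<exists>d\<in>S. hnorm H (x - d) < e)"

definition bounded_op ::
  "'a::complex_vector hilb \<Rightarrow> 'b::complex_vector hilb \<Rightarrow> ('a \<Rightarrow> 'b) \<Rightarrow> bool" where
  "bounded_op H K T \<longleftrightarrow>
    T \<in> hcarrier H \<rightarrow> hcarrier K \<and>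
    (\<forall>x\<in>hcarrier H. \<forall>y\<in>hcarrier H. T (x + y) = T x + T y) \<and>
    (\<forall>a. \<forall>x\<in>hcarrier H. T (a *\<^sub>C x) = a *\<^sub>C T x) \<and>
    (\<exists>C. \<forall>x\<in>hcarrier H. hnorm K (T x) \<le> C * hnorm H x)"

text \<open>By the Riesz theorem this is well defined on the carrier of K for bounded T.\<close>

definition hadjoint :: "'a hilb \<Rightarrow> 'b hilb \<Rightarrow> ('a \<Rightarrow> 'b) \<Rightarrow> 'b \<Rightarrow> 'a" where
  "hadjoint H K T y =
    (THE x. x \<in> hcarrier H \<and> (\<forall>u\<in>hcarrier H. hinner K (T u) y = hinner H u x))"

definition hkernel :: "'a hilb \<Rightarrow> ('a \<Rightarrow> 'b::complex_vector) \<Rightarrow> 'a set" where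
  "hkernel H T = {x \<in> hcarrier H. T x = 0}"

definition partial_isometry ::
  "'a::complex_vector hilb \<Rightarrow> 'b::complex_vector hilb \<Rightarrow> ('a \<Rightarrow> 'b) \<Rightarrow> bool" where
  "partial_isometry H K T \<longleftrightarrow> bounded_op H K T \<and>
    (\<forall>x\<in>hcarrier H. (\<forall>y\<in>hkernel H T. hinner H x y = 0) \<longrightarrow> hnorm K (T x) = hnorm H x)"

definition co_isometry ::
  "'a::complex_vector hilb \<Rightarrow> 'b::complex_vector hilb \<Rightarrow> ('a \<Rightarrow> 'b) \<Rightarrow> bool" where
  "co_isometry H K T \<longleftrightarrow> bounded_op H K T \<and>
    (\<forall>y\<in>hcarrier K. T (hadjoint H K T y) = y)"

definition unitary_op ::
  "'a::complex_vector hilb \<Rightarrow> 'b::complex_vector hilb \<Rightarrow> ('a \<Rightarrow> 'b) \<Rightarrow> bool" where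
  "unitary_op H K T \<longleftrightarrow> bounded_op H K T \<and> T ` hcarrier H = hcarrier K \<and>
    (\<forall>x\<in>hcarrier H. \<forall>y\<in>hcarrier H. hinner K (T x) (T y) = hinner H x y)"


section \<open>Hilbert modules\<close>

text \<open>
  The number n of variables is the cardinality of the finite index type \<open>'n\<close>.
\<close>

definition hilbert_module ::
  "'a::complex_vector hilb \<Rightarrow> ('n::finite \<Rightarrow> 'a \<Rightarrow> 'a) \<Rightarrow> bool" where
  "hilbert_module H M \<longleftrightarrow> hilbert_space H \<and> (\<forall>i. bounded_op H H (M i)) \<and>
    (\<forall>i j. \<forall>x\<in>hcarrier H. M i (M j x) = M j (M i x))"

definition module_cp_map ::
  "'a::complex_vector hilb \<Rightarrow> ('n::finite \<Rightarrow> 'a \<Rightarrow> 'a) \<Rightarrow> ('a \<Rightarrow> 'a) \<Rightarrow> 'a \<Rightarrow> 'a" where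
  "module_cp_map H M X = (\<lambda>x. \<Sum>i\<in>UNIV. M i (X (hadjoint H H (M i) x)))"

definition co_spherically_contractive ::
  "'a::complex_vector hilb \<Rightarrow> ('n::finite \<Rightarrow> 'a \<Rightarrow> 'a) \<Rightarrow> bool" where
  "co_spherically_contractive H M \<longleftrightarrow> hilbert_module H M \<and>
    (\<forall>x\<in>hcarrier H. Re (hinner H (module_cp_map H M id x) x) \<le> Re (hinner H x x))"

definition pure_module ::
  "'a::complex_vector hilb \<Rightarrow> ('n::finite \<Rightarrow> 'a \<Rightarrow> 'a) \<Rightarrow> bool" where
  "pure_module H M \<longleftrightarrow> co_spherically_contractive H M \<and>
    (\<forall>x\<in>hcarrier H. (\<lambda>l. hnorm H ((module_cp_map H M ^^ l) id x)) \<longlonglongrightarrow> 0)"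

definition intertwines ::
  "'a hilb \<Rightarrow> ('n \<Rightarrow> 'a \<Rightarrow> 'a) \<Rightarrow> ('n \<Rightarrow> 'b \<Rightarrow> 'b) \<Rightarrow> ('a \<Rightarrow> 'b) \<Rightarrow> bool" where
  "intertwines H M L T \<longleftrightarrow> (\<forall>i. \<forall>x\<in>hcarrier H. T (M i x) = L i (T x))"

definition isometrically_isomorphic ::
  "'a::complex_vector hilb \<Rightarrow> ('n::finite \<Rightarrow> 'a \<Rightarrow> 'a) \<Rightarrow>
   'b::complex_vector hilb \<Rightarrow> ('n \<Rightarrow> 'b \<Rightarrow> 'b) \<Rightarrow> bool" where
  "isometrically_isomorphic H M K L \<longleftrightarrow> (\<exists>U. unitary_op H K U \<and> intertwines H M L U)"


section \<open>The Drury-Arveson module\<close>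

text \<open>
  Functions on a set \<open>\<Omega>\<close> are represented by total functions vanishing off \<open>\<Omega>\<close>.
\<close>

definition is_rkhs :: "'z set \<Rightarrow> ('z \<Rightarrow> 'z \<Rightarrow> complex) \<Rightarrow> ('z \<Rightarrow> complex) hilb \<Rightarrow> bool" where
  "is_rkhs \<Omega> k A \<longleftrightarrow> hilbert_space A \<and>
    (\<forall>f\<in>hcarrier A. \<forall>z. z \<notin> \<Omega> \<longrightarrow> f z = 0) \<and>
    (\<forall>w\<in>\<Omega>. let k\<^sub>w = (\<lambda>z. if z \<in> \<Omega> then k z w else 0)
      in k\<^sub>w \<in> hcarrier A \<and> (\<forall>f\<in>hcarrier A. hinner A f k\<^sub>w = f w))"

definition elem_tensor :: "('z \<Rightarrow> complex) \<Rightarrow> 'e::complex_vector \<Rightarrow> 'z \<Rightarrow> 'e" where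
  "elem_tensor f \<eta> = (\<lambda>z. f z *\<^sub>C \<eta>)"

text \<open>
  The Hilbert space tensor product of a space A of scalar functions with E, realised as a space
  D of E-valued functions: elementary tensors are the functions \<open>z \<mapsto> f z \<eta>\<close>, they have
  the inner products of a tensor product, their span is dense, and point evaluations are
  bounded. The last condition makes limits in D pointwise limits, so that D is unique.
\<close>

definition is_function_tensor ::
  "'z set \<Rightarrow> ('z \<Rightarrow> complex) hilb \<Rightarrow> 'e::complex_vector hilb \<Rightarrow> ('z \<Rightarrow> 'e) hilb \<Rightarrow> bool" where
  "is_function_tensor \<Omega> A E D \<longleftrightarrow> hilbert_space D \<and>
    (\<forall>f\<in>hcarrier D. \<forall>z. (z \<in> \<Omega> \<longrightarrow> f z \<in> hcarrier E) \<and> (z \<notin> \<Omega> \<longrightarrow> f z = 0)) \<and>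
    (\<forall>f\<in>hcarrier A. \<forall>\<eta>\<in>hcarrier E. elem_tensor f \<eta> \<in> hcarrier D) \<and>
    (\<forall>f\<in>hcarrier A. \<forall>g\<in>hcarrier A. \<forall>\<eta>\<in>hcarrier E. \<forall>\<zeta>\<in>hcarrier E.
      hinner D (elem_tensor f \<eta>) (elem_tensor g \<zeta>) = hinner A f g * hinner E \<eta> \<zeta>) \<and>
    (\<forall>f\<in>hcarrier D. \<forall>e>0.
      \<exists>g\<in>complex_vector.span {elem_tensor h \<eta> | h \<eta>. h \<in> hcarrier A \<and> \<eta> \<in> hcarrier E}.
        hnorm D (f - g) < e) \<and>
    (\<forall>z\<in>\<Omega>. \<exists>C. \<forall>f\<in>hcarrier D. hnorm E (f z) \<le> C * hnorm D f)"

abbreviation unit_ball :: "(complex ^ 'n::finite) set" where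
  "unit_ball \<equiv> ball 0 1"

definition da_kernel :: "complex ^ 'n::finite \<Rightarrow> complex ^ 'n \<Rightarrow> complex" where
  "da_kernel z w = inverse (1 - (\<Sum>i\<in>UNIV. z $ i * cnj (w $ i)))"

text \<open>
  In the next two definitions the choice is unique except for the irrelevant values of the
  inner product outside the carrier.
\<close>

definition drury_arveson :: "(complex ^ 'n::finite \<Rightarrow> complex) hilb" where
  "drury_arveson = (SOME A. is_rkhs unit_ball da_kernel A)"

definition da_tensor :: "'e::complex_vector hilb \<Rightarrow> (complex ^ 'n::finite \<Rightarrow> 'e) hilb" where
  "da_tensor E = (SOME D. is_function_tensor unit_ball drury_arveson E D)"

definition coord_mult :: "'n::finite \<Rightarrow> (complex ^ 'n \<Rightarrow> 'e::complex_vector) \<Rightarrow> complex ^ 'n \<Rightarrow> 'e"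
  where "coord_mult i f = (\<lambda>z. (z $ i) *\<^sub>C f z)"


section \<open>Inner multipliers and inner resolutions\<close>

text \<open>Holomorphy is complex Frechet differentiability with respect to the operator norm.\<close>

definition holomorphic_op ::
  "(complex ^ 'n::finite) set \<Rightarrow> 'a::complex_vector hilb \<Rightarrow> 'b::complex_vector hilb \<Rightarrow>
   (complex ^ 'n \<Rightarrow> 'a \<Rightarrow> 'b) \<Rightarrow> bool" where
  "holomorphic_op \<Omega> E F \<phi> \<longleftrightarrow> (\<forall>z\<in>\<Omega>. bounded_op E F (\<phi> z)) \<and>
    (\<forall>z\<in>\<Omega>. \<exists>D. (\<forall>i. bounded_op E F (D i)) \<and>
      (\<forall>e>0. \<exists>d>0. \<forall>w\<in>\<Omega>. norm (w - z) < d \<longrightarrow>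
        (\<forall>x\<in>hcarrier E.
          hnorm F (\<phi> w x - \<phi> z x - (\<Sum>i\<in>UNIV. (w $ i - z $ i) *\<^sub>C D i x))
            \<le> e * norm (w - z) * hnorm E x)))"

definition mult_op ::
  "(complex ^ 'n::finite \<Rightarrow> 'a \<Rightarrow> 'b::complex_vector) \<Rightarrow>
   (complex ^ 'n \<Rightarrow> 'a) \<Rightarrow> complex ^ 'n \<Rightarrow> 'b" where
  "mult_op \<phi> f = (\<lambda>z. if z \<in> unit_ball then \<phi> z (f z) else 0)"

definition multiplier ::
  "'a::complex_vector hilb \<Rightarrow> 'b::complex_vector hilb \<Rightarrow>
   (complex ^ 'n::finite \<Rightarrow> 'a \<Rightarrow> 'b) \<Rightarrow> bool" where
  "multiplier E F \<phi> \<longleftrightarrow> holomorphic_op unit_ball E F \<phi> \<and>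
    bounded_op (da_tensor E) (da_tensor F) (mult_op \<phi>)"

definition inner_multiplier ::
  "'a::complex_vector hilb \<Rightarrow> 'b::complex_vector hilb \<Rightarrow>
   (complex ^ 'n::finite \<Rightarrow> 'a \<Rightarrow> 'b) \<Rightarrow> bool" where
  "inner_multiplier E F \<phi> \<longleftrightarrow> multiplier E F \<phi> \<and>
    partial_isometry (da_tensor E) (da_tensor F) (mult_op \<phi>)"

definition finite_inner_resolution ::
  "'h::complex_vector hilb \<Rightarrow> ('n::finite \<Rightarrow> 'h \<Rightarrow> 'h) \<Rightarrow> nat \<Rightarrow>
   (nat \<Rightarrow> 'e::complex_vector hilb) \<Rightarrow> (nat \<Rightarrow> complex ^ 'n \<Rightarrow> 'e \<Rightarrow> 'e) \<Rightarrow>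
   ((complex ^ 'n \<Rightarrow> 'e) \<Rightarrow> 'h) \<Rightarrow> bool" where
  "finite_inner_resolution H M N E \<phi> X\<^sub>0 \<longleftrightarrow>
    1 \<le> N \<and>
    (\<forall>k\<le>N. hilbert_space (E k)) \<and>
    (\<forall>k\<in>{1..N}. inner_multiplier (E k) (E (k - 1)) (\<phi> k)) \<and>
    co_isometry (da_tensor (E 0)) H X\<^sub>0 \<and>
    intertwines (da_tensor (E 0)) coord_mult M X\<^sub>0 \<and>
    hkernel (da_tensor (E N)) (mult_op (\<phi> N)) = {0} \<and>
    (\<forall>k\<in>{1..<N}. mult_op (\<phi> (k + 1)) ` hcarrier (da_tensor (E (k + 1)))
      = hkernel (da_tensor (E k)) (mult_op (\<phi> k))) \<and>
    mult_op (\<phi> 1) ` hcarrier (da_tensor (E 1)) = hkernel (da_tensor (E 0)) X\<^sub>0 \<and>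
    X\<^sub>0 ` hcarrier (da_tensor (E 0)) = hcarrier H"

end

theory Submission
  imports Defs
begin

text \<open>
  Let \<open>X\<close> be a partially isometric multiplier whose kernel consists of the functions with
  values in a closed subspace \<open>V\<close> of the coefficient space. For \<open>\<eta>\<close> orthogonal to \<open>V\<close> both \<open>1 \<otimes> \<eta>\<close>
  and \<open>z\<^sub>i \<otimes> \<eta>\<close> are orthogonal to the kernel, so \<open>f = X (1 \<otimes> \<eta>)\<close> satisfies
  \<open>\<parallel>z\<^sub>i f\<parallel> = \<parallel>f\<parallel>\<close> for every \<open>i\<close>. If there are at least two variables this forces \<open>f\<close> to be
  constant, because the coordinate multiplications form a row contraction. Hence the multiplier is
  constant on the complement of \<open>V\<close>, and its range again consists of the functions with values
  in a closed subspace. Starting from the injective left end of the resolution, this passes by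
  exactness to the kernel of \<open>X\<^sub>0\<close>, so that \<open>\<H>\<close> is isomorphic to the functions with
  values in the complement of a closed subspace of \<open>\<E>\<^sub>0\<close>.

  Everything is derived from the kernel vectors \<open>k\<^sub>w \<eta>\<close>: isometries are constructed
  by comparing Gram matrices of total families of such vectors.
\<close>

section \<open>Geometry of Hilbert spaces with a carrier\<close>

text \<open>In one variable multiplication by \<open>z\<close> is itself isometric, so an isometric
  image of a constant need not be constant: every non-constant scalar inner function gives a
  resolution of length one whose quotient is not of the form asserted. With a second variable, one
  backward shift already recovers the whole norm of \<open>z_i f\<close>, and the row contraction
  leaves nothing for the others.

  The functions \<open>z_i \<otimes> \<eta>\<close> are not combinations of kernel vectors. They are
  reached as limits of difference quotients, and both their norm and their orthogonality to the
  kernel come from letting the increment tend to zero. In the same way boundedness of the coordinate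
  multiplications is read off from their adjoints, which act diagonally on kernel vectors.

  The function spaces are introduced by a choice operator, so a model has to be produced before any
  property of them can be used; it comes from square-summable families indexed by words in the
  variables. The coefficient space of the conclusion has to consist of elements of the type of
  \<open>H\<close>, which is why a subspace of the coefficients is copied into \<open>H\<close>
  itself.\<close>

definition hconv :: "'a::complex_vector hilb \<Rightarrow> (nat \<Rightarrow> 'a) \<Rightarrow> 'a \<Rightarrow> bool" where
  "hconv H s x \<longleftrightarrow> (\<lambda>k. hnorm H (s k - x)) \<longlonglongrightarrow> 0"

definition hclosed :: "'a::complex_vector hilb \<Rightarrow> 'a set \<Rightarrow> bool" where
  "hclosed H S \<longleftrightarrow> complex_vector.subspace S \<and> S \<subseteq> hcarrier H \<and>
    (\<forall>s x. (\<forall>k. s k \<in> S) \<longrightarrow> x \<in> hcarrier H \<longrightarrow> hconv H s x \<longrightarrow> x \<in> S)"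

definition hcompl :: "'a::complex_vector hilb \<Rightarrow> 'a set \<Rightarrow> 'a set" where
  "hcompl H S = {x \<in> hcarrier H. \<forall>y\<in>S. hinner H x y = 0}"

text \<open>Totality is expressed by a trivial orthogonal complement because for kernel vectors this
  is immediate from the reproducing property. Density of the linear span is recovered in
  \<open>htotal_dense\<close>.\<close>

definition htotal :: "'a::complex_vector hilb \<Rightarrow> 'a set \<Rightarrow> bool" where
  "htotal H S \<longleftrightarrow> S \<subseteq> hcarrier H \<and> hcompl H S \<subseteq> {0}"

definition subhilb :: "'a hilb \<Rightarrow> 'a set \<Rightarrow> 'a hilb" where
  "subhilb H S = \<lparr>hcarrier = S, hinner = hinner H\<rparr>"

lemma subhilb_simps [simp]:
  "hcarrier (subhilb H S) = S" "hinner (subhilb H S) = hinner H" "hnorm (subhilb H S) = hnorm H"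
  by (simp_all add: subhilb_def hnorm_def fun_eq_iff)

lemma scaleC_fun_apply: "(a *\<^sub>C f) x = a *\<^sub>C f x"
  by (simp add: scaleC_fun_def)

lemma htotal_mono:
  assumes "htotal H S" "S \<subseteq> T" "T \<subseteq> hcarrier H"
  shows "htotal H T"
proof -
  have "hcompl H T \<subseteq> hcompl H S" using assms(2) by (auto simp: hcompl_def)
  then show ?thesis using assms by (auto simp: htotal_def)
qed

context hilbert_space
begin

section \<open>Algebra of the inner product and the basic inequalities\<close>

lemma zero_mem [simp]: "0 \<in> hcarrier H"
  using subspace_carrier by (rule complex_vector.subspace_0)

lemma add_mem [simp]: "x \<in> hcarrier H \<Longrightarrow> y \<in> hcarrier H \<Longrightarrow> x + y \<in> hcarrier H"
  using subspace_carrier by (rule complex_vector.subspace_add)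

lemma diff_mem [simp]: "x \<in> hcarrier H \<Longrightarrow> y \<in> hcarrier H \<Longrightarrow> x - y \<in> hcarrier H"
  using subspace_carrier by (rule complex_vector.subspace_diff)

lemma uminus_mem [simp]: "x \<in> hcarrier H \<Longrightarrow> - x \<in> hcarrier H"
  using subspace_carrier by (rule complex_vector.subspace_neg)

lemma scaleC_mem [simp]: "x \<in> hcarrier H \<Longrightarrow> a *\<^sub>C x \<in> hcarrier H"
  using subspace_carrier by (rule complex_vector.subspace_scale)

lemma inner_zero_left [simp]: "y \<in> hcarrier H \<Longrightarrow> hinner H 0 y = 0"
  using inner_scaleC_left[of 0 y 0] by simp

lemma inner_uminus_left [simp]:
  "x \<in> hcarrier H \<Longrightarrow> y \<in> hcarrier H \<Longrightarrow> hinner H (- x) y = - hinner H x y"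
  using inner_scaleC_left[of x y "-1"] by (simp add: scaleC_one)

lemma inner_diff_left:
  "x \<in> hcarrier H \<Longrightarrow> y \<in> hcarrier H \<Longrightarrow> z \<in> hcarrier H
    \<Longrightarrow> hinner H (x - y) z = hinner H x z - hinner H y z"
  using inner_add_left[of x "-y" z] by simp

lemma inner_zero_right [simp]: "y \<in> hcarrier H \<Longrightarrow> hinner H y 0 = 0"
  using inner_commute[of 0 y] by simp

lemma inner_add_right:
  "x \<in> hcarrier H \<Longrightarrow> y \<in> hcarrier H \<Longrightarrow> z \<in> hcarrier H
    \<Longrightarrow> hinner H z (x + y) = hinner H z x + hinner H z y"
  by (metis add_mem complex_cnj_add inner_add_left inner_commute)

lemma inner_diff_right:
  "x \<in> hcarrier H \<Longrightarrow> y \<in> hcarrier H \<Longrightarrow> z \<in> hcarrier H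
    \<Longrightarrow> hinner H z (x - y) = hinner H z x - hinner H z y"
  by (metis diff_mem complex_cnj_diff inner_diff_left inner_commute)

lemma inner_scaleC_right:
  "x \<in> hcarrier H \<Longrightarrow> y \<in> hcarrier H \<Longrightarrow> hinner H y (a *\<^sub>C x) = cnj a * hinner H y x"
  by (metis scaleC_mem complex_cnj_mult inner_scaleC_left inner_commute)

lemmas inner_simps = inner_add_left inner_add_right inner_diff_left inner_diff_right
  inner_scaleC_left inner_scaleC_right

lemma inner_self_nonneg: "x \<in> hcarrier H \<Longrightarrow> 0 \<le> Re (hinner H x x)"
  using inner_positive[of x] by (cases "x = 0") auto

lemma hnorm_sq: "x \<in> hcarrier H \<Longrightarrow> (hnorm H x)\<^sup>2 = Re (hinner H x x)"
  by (simp add: hnorm_def inner_self_nonneg)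

lemma inner_self: "x \<in> hcarrier H \<Longrightarrow> hinner H x x = of_real ((hnorm H x)\<^sup>2)"
  using inner_commute[of x x] by (auto simp: hnorm_sq complex_eq_iff)

lemma hnorm_nonneg [simp]: "x \<in> hcarrier H \<Longrightarrow> 0 \<le> hnorm H x"
  by (simp add: hnorm_def inner_self_nonneg)

lemma hnorm_zero [simp]: "hnorm H 0 = 0"
  by (simp add: hnorm_def)

lemma hnorm_eq_0 [simp]: "x \<in> hcarrier H \<Longrightarrow> hnorm H x = 0 \<longleftrightarrow> x = 0"
  using inner_positive[of x] by (cases "x = 0") (auto simp: hnorm_def)

lemma hnorm_scaleC: "x \<in> hcarrier H \<Longrightarrow> hnorm H (a *\<^sub>C x) = cmod a * hnorm H x"
proof -
  assume x: "x \<in> hcarrier H"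
  have "hinner H (a *\<^sub>C x) (a *\<^sub>C x) = (a * cnj a) * hinner H x x"
    using x by (simp add: inner_simps)
  also have "\<dots> = of_real ((cmod a)\<^sup>2 * (hnorm H x)\<^sup>2)"
    using x by (simp add: inner_self complex_norm_square[symmetric])
  finally have "(hnorm H (a *\<^sub>C x))\<^sup>2 = (cmod a * hnorm H x)\<^sup>2"
    using x by (simp only: hnorm_sq scaleC_mem Re_complex_of_real power_mult_distrib)
  thus ?thesis
    using x by (subst (asm) power2_eq_iff_nonneg) auto
qed

lemma hnorm_minus_commute:
  "x \<in> hcarrier H \<Longrightarrow> y \<in> hcarrier H \<Longrightarrow> hnorm H (x - y) = hnorm H (y - x)"
  using hnorm_scaleC[of "x - y" "-1"] by (simp add: scaleC_one)

lemma orthogonal_commute: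
  "x \<in> hcarrier H \<Longrightarrow> y \<in> hcarrier H \<Longrightarrow> hinner H x y = 0 \<longleftrightarrow> hinner H y x = 0"
  using inner_commute[of x y] by simp

lemma pythagoras:
  assumes "x \<in> hcarrier H" "y \<in> hcarrier H" "hinner H x y = 0"
  shows "(hnorm H (x + y))\<^sup>2 = (hnorm H x)\<^sup>2 + (hnorm H y)\<^sup>2"
  using assms by (simp add: hnorm_sq inner_simps inner_commute[of x y])

lemma Cauchy_Schwarz:
  assumes x: "x \<in> hcarrier H" and y: "y \<in> hcarrier H"
  shows "cmod (hinner H x y) \<le> hnorm H x * hnorm H y"
proof (cases "y = 0")
  case False
  then have pos: "hnorm H y > 0"
    using y hnorm_eq_0[of y] hnorm_nonneg[of y] by linarith
  \<comment> \<open>With this coefficient \<open>a *\<^sub>C y\<close> is the orthogonal projection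
    of \<open>x\<close> on the line through \<open>y\<close>, and a projection is no longer than
    \<open>x\<close>.\<close>
  define a where "a = hinner H x y / hinner H y y"
  have "hinner H (x - a *\<^sub>C y) (a *\<^sub>C y) = 0"
    using x y pos by (simp add: inner_simps a_def inner_self)
  then have "(hnorm H x)\<^sup>2 = (hnorm H (x - a *\<^sub>C y))\<^sup>2 + (hnorm H (a *\<^sub>C y))\<^sup>2"
    using pythagoras[of "x - a *\<^sub>C y" "a *\<^sub>C y"] x y by simp
  then have "(hnorm H (a *\<^sub>C y))\<^sup>2 \<le> (hnorm H x)\<^sup>2" by simp
  then have "hnorm H (a *\<^sub>C y) \<le> hnorm H x"
    by (rule power2_le_imp_le) (use x y in simp_all)
  moreover have "hnorm H (a *\<^sub>C y) = cmod (hinner H x y) / hnorm H y"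
    using y pos by (simp add: hnorm_scaleC a_def inner_self norm_divide power2_eq_square norm_mult)
  ultimately show ?thesis
    using pos by (simp add: field_simps)
qed (use x in auto)

lemma hnorm_triangle:
  assumes x: "x \<in> hcarrier H" and y: "y \<in> hcarrier H"
  shows "hnorm H (x + y) \<le> hnorm H x + hnorm H y"
proof -
  have "(hnorm H (x + y))\<^sup>2 = (hnorm H x)\<^sup>2 + (hnorm H y)\<^sup>2 + 2 * Re (hinner H x y)"
    using x y inner_commute[of x y] by (simp add: hnorm_sq inner_simps)
  also have "\<dots> \<le> (hnorm H x + hnorm H y)\<^sup>2"
    using Cauchy_Schwarz[OF x y] complex_Re_le_cmod[of "hinner H x y"]
    by (simp add: power2_sum)
  finally show ?thesis
    by (rule power2_le_imp_le) (use x y in simp_all)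
qed

lemma hnorm_triangle_diff:
  assumes "x \<in> hcarrier H" "y \<in> hcarrier H" "z \<in> hcarrier H"
  shows "hnorm H (x - z) \<le> hnorm H (x - y) + hnorm H (y - z)"
  using hnorm_triangle[of "x - y" "y - z"] assms by simp

lemma hnorm_triangle_minus:
  assumes "x \<in> hcarrier H" "y \<in> hcarrier H"
  shows "hnorm H x \<le> hnorm H y + hnorm H (x - y)"
  using hnorm_triangle[of y "x - y"] assms by simp

lemma parallelogram:
  assumes "x \<in> hcarrier H" "y \<in> hcarrier H"
  shows "(hnorm H (x + y))\<^sup>2 + (hnorm H (x - y))\<^sup>2 = 2 * (hnorm H x)\<^sup>2 + 2 * (hnorm H y)\<^sup>2"
  using assms by (simp add: hnorm_sq inner_simps)

section \<open>Sequential convergence in the norm of a carrier\<close>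

lemma complete_hconv:
  assumes "\<And>k. s k \<in> hcarrier H"
    and "\<And>e. e > 0 \<Longrightarrow> \<exists>m. \<forall>j\<ge>m. \<forall>k\<ge>m. hnorm H (s j - s k) < e"
  obtains x where "x \<in> hcarrier H" "hconv H s x"
  using complete[of s] assms unfolding hconv_def by blast

lemma hconv_inner_left:
  assumes s: "\<And>k. s k \<in> hcarrier H" and x: "x \<in> hcarrier H" and y: "y \<in> hcarrier H"
    and lim: "hconv H s x"
  shows "(\<lambda>k. hinner H (s k) y) \<longlonglongrightarrow> hinner H x y"
proof (rule LIM_zero_cancel, rule Lim_null_comparison)
  show "\<forall>\<^sub>F k in sequentially. norm (hinner H (s k) y - hinner H x y) \<le> hnorm H (s k - x) * hnorm H y"
    using Cauchy_Schwarz[of "s k - x" y for k] s x y by (simp add: inner_simps)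
  show "(\<lambda>k. hnorm H (s k - x) * hnorm H y) \<longlonglongrightarrow> 0"
    using lim tendsto_mult_left_zero by (auto simp: hconv_def)
qed

lemma hconv_hnorm:
  assumes s: "\<And>k. s k \<in> hcarrier H" and x: "x \<in> hcarrier H"
    and lim: "hconv H s x"
  shows "(\<lambda>k. hnorm H (s k)) \<longlonglongrightarrow> hnorm H x"
proof (rule LIM_zero_cancel, rule Lim_null_comparison)
  have "\<bar>hnorm H (s k) - hnorm H x\<bar> \<le> hnorm H (s k - x)" for k
    using hnorm_triangle_minus[of "s k" x] hnorm_triangle_minus[of x "s k"]
      hnorm_minus_commute[of x "s k"] s[of k] x by linarith
  then show "\<forall>\<^sub>F k in sequentially. norm (hnorm H (s k) - hnorm H x) \<le> hnorm H (s k - x)"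
    by simp
  show "(\<lambda>k. hnorm H (s k - x)) \<longlonglongrightarrow> 0"
    using lim by (auto simp: hconv_def)
qed

lemma hconv_unique:
  assumes s: "\<And>k. s k \<in> hcarrier H" and x: "x \<in> hcarrier H" and y: "y \<in> hcarrier H"
    and "hconv H s x" "hconv H s y"
  shows "x = y"
proof -
  have lim: "(\<lambda>k. hnorm H (s k - x) + hnorm H (s k - y)) \<longlonglongrightarrow> 0 + 0"
    using assms(4,5) unfolding hconv_def by (rule tendsto_add)
  have "hnorm H (x - y) \<le> hnorm H (s k - x) + hnorm H (s k - y)" for k
    using hnorm_triangle_diff[of x "s k" y] hnorm_minus_commute[of x "s k"] s x y by simp
  then have "hnorm H (x - y) \<le> 0 + 0"
    by (intro LIMSEQ_le_const[OF lim]) blast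
  with x y show ?thesis
    using hnorm_nonneg[of "x - y"] hnorm_eq_0[of "x - y"] by (simp del: hnorm_nonneg hnorm_eq_0)
qed

lemma hconv_add:
  assumes s: "\<And>k. s k \<in> hcarrier H" and t: "\<And>k. t k \<in> hcarrier H"
    and x: "x \<in> hcarrier H" and y: "y \<in> hcarrier H"
    and "hconv H s x" "hconv H t y"
  shows "hconv H (\<lambda>k. s k + t k) (x + y)"
  unfolding hconv_def
proof (rule Lim_null_comparison)
  have "hnorm H (s k + t k - (x + y)) \<le> hnorm H (s k - x) + hnorm H (t k - y)" for k
    using hnorm_triangle[of "s k - x" "t k - y"] s t x y by (simp add: algebra_simps)
  then show "\<forall>\<^sub>F k in sequentially.
      norm (hnorm H (s k + t k - (x + y))) \<le> hnorm H (s k - x) + hnorm H (t k - y)"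
    using s t x y by simp
  show "(\<lambda>k. hnorm H (s k - x) + hnorm H (t k - y)) \<longlonglongrightarrow> 0"
    using tendsto_add[of _ 0 _ _ 0] assms(5,6) unfolding hconv_def by auto
qed

lemma hconv_scaleC:
  assumes s: "\<And>k. s k \<in> hcarrier H" and x: "x \<in> hcarrier H" and "hconv H s x"
  shows "hconv H (\<lambda>k. a *\<^sub>C s k) (a *\<^sub>C x)"
proof -
  have "hnorm H (a *\<^sub>C s k - a *\<^sub>C x) = cmod a * hnorm H (s k - x)" for k
    using hnorm_scaleC[of "s k - x" a] s x by (simp add: complex_vector.scale_right_diff_distrib)
  then show ?thesis
    using assms(3) by (simp add: hconv_def tendsto_mult_right_zero)
qed

lemma hconv_Cauchy:
  assumes s: "\<And>k. s k \<in> hcarrier H" and x: "x \<in> hcarrier H" and "hconv H s x" and e: "e > 0"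
  shows "\<exists>m. \<forall>j\<ge>m. \<forall>k\<ge>m. hnorm H (s j - s k) < e"
proof -
  obtain m where m: "\<And>k. k \<ge> m \<Longrightarrow> hnorm H (s k - x) < e / 2"
    using order_tendstoD(2)[OF assms(3)[unfolded hconv_def], of "e / 2"] e
    by (auto simp: eventually_sequentially)
  have "hnorm H (s j - s k) < e" if "j \<ge> m" "k \<ge> m" for j k
    using hnorm_triangle_diff[of "s j" x "s k"] hnorm_minus_commute[of x "s k"]
      m[OF that(1)] m[OF that(2)] s[of j] s[of k] x by linarith
  then show ?thesis by blast
qed

lemma hconv_inner:
  assumes s: "\<And>k. s k \<in> hcarrier H" and t: "\<And>k. t k \<in> hcarrier H"
    and x: "x \<in> hcarrier H" and y: "y \<in> hcarrier H"
    and lims: "hconv H s x" and limt: "hconv H t y"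
  shows "(\<lambda>k. hinner H (s k) (t k)) \<longlonglongrightarrow> hinner H x y"
proof (rule LIM_zero_cancel, rule Lim_null_comparison)
  have "cmod (hinner H (s k) (t k) - hinner H x y)
      \<le> hnorm H (s k) * hnorm H (t k - y) + hnorm H (s k - x) * hnorm H y" for k
  proof -
    have "hinner H (s k) (t k) - hinner H x y = hinner H (s k) (t k - y) + hinner H (s k - x) y"
      using s t x y by (simp add: inner_simps)
    also have "cmod \<dots> \<le> cmod (hinner H (s k) (t k - y)) + cmod (hinner H (s k - x) y)"
      by (rule norm_triangle_ineq)
    finally show ?thesis
      using Cauchy_Schwarz[of "s k" "t k - y"] Cauchy_Schwarz[of "s k - x" y] s t x y
      by fastforce
  qed
  then show "\<forall>\<^sub>F k in sequentially. norm (hinner H (s k) (t k) - hinner H x y)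
      \<le> hnorm H (s k) * hnorm H (t k - y) + hnorm H (s k - x) * hnorm H y"
    by simp
  have "(\<lambda>k. hnorm H (s k) * hnorm H (t k - y) + hnorm H (s k - x) * hnorm H y)
      \<longlonglongrightarrow> hnorm H x * 0 + 0 * hnorm H y"
    using hconv_hnorm[OF s x lims] lims limt unfolding hconv_def by (intro tendsto_intros)
  then show "(\<lambda>k. hnorm H (s k) * hnorm H (t k - y) + hnorm H (s k - x) * hnorm H y) \<longlonglongrightarrow> 0"
    by simp
qed

section \<open>Closed subspaces and orthogonal projection\<close>

lemma hclosed_hcompl: 
  assumes "S \<subseteq> hcarrier H"
  shows "hclosed H (hcompl H S)"
  unfolding hclosed_def
proof (intro conjI allI impI)
  show "complex_vector.subspace (hcompl H S)"
    using assms by (auto simp: hcompl_def inner_simps subset_iff intro!: complex_vector.subspaceI)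
  show "hcompl H S \<subseteq> hcarrier H" by (auto simp: hcompl_def)
  fix s x assume s: "\<forall>k. s k \<in> hcompl H S" and x: "x \<in> hcarrier H" "hconv H s x"
  have "hinner H x y = 0" if "y \<in> S" for y
    using hconv_inner_left[of s x y] s x that assms
    by (auto simp: hcompl_def LIMSEQ_const_iff)
  with x show "x \<in> hcompl H S" by (auto simp: hcompl_def)
qed

text \<open>A minimising sequence is Cauchy: midpoints of its members stay in \<open>S\<close>, so
  the parallelogram law bounds their mutual distance by the excess over the infimum. The infimum is
  taken over squared distances because these enter the parallelogram law.\<close>

lemma best_approximation:
  assumes S: "hclosed H S" and x: "x \<in> hcarrier H"
  shows "\<exists>p\<in>S. \<forall>s\<in>S. hnorm H (x - p) \<le> hnorm H (x - s)"
proof -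
  have sub: "complex_vector.subspace S" and SH: "S \<subseteq> hcarrier H"
    using S by (auto simp: hclosed_def)
  define A where "A = (\<lambda>s. (hnorm H (x - s))\<^sup>2) ` S"
  define \<delta> where "\<delta> = Inf A"
  have bdd: "bdd_below A" and ne: "A \<noteq> {}"
    using complex_vector.subspace_0[OF sub] by (auto simp: A_def intro!: bdd_belowI[of _ 0])
  have low: "\<delta> \<le> (hnorm H (x - s))\<^sup>2" if "s \<in> S" for s
    unfolding \<delta>_def using that bdd by (intro cInf_lower) (auto simp: A_def)
  have "\<exists>s\<in>S. (hnorm H (x - s))\<^sup>2 < \<delta> + inverse (real (Suc k))" for k
    using cInf_lessD[OF ne, of "\<delta> + inverse (real (Suc k))"] by (auto simp: \<delta>_def A_def)
  then obtain s where s: "\<And>k. s k \<in> S"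
    and near: "\<And>k. (hnorm H (x - s k))\<^sup>2 < \<delta> + inverse (real (Suc k))" by metis
  have sH: "s k \<in> hcarrier H" for k using s SH by auto
  have gap: "(hnorm H (s j - s k))\<^sup>2 \<le> 2 * inverse (real (Suc j)) + 2 * inverse (real (Suc k))" for j k
  proof -
    define m where "m = (1/2) *\<^sub>C (s j + s k)"
    have m: "m \<in> S" unfolding m_def
      using s by (intro complex_vector.subspace_scale[OF sub] complex_vector.subspace_add[OF sub])
    have "2 *\<^sub>C (x - m) = (x + x) - (s j + s k)"
      using scaleC_add_left[of 1 1 x]
      by (simp add: m_def complex_vector.scale_right_diff_distrib scaleC_scaleC scaleC_one)
    also have "\<dots> = (x - s k) + (x - s j)" by simp
    finally have "hnorm H ((x - s k) + (x - s j)) = 2 * hnorm H (x - m)"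
      using hnorm_scaleC[of "x - m" 2] x m SH by (metis diff_mem norm_numeral subsetD)
    moreover have "(hnorm H ((x - s k) + (x - s j)))\<^sup>2 + (hnorm H (s j - s k))\<^sup>2
        = 2 * (hnorm H (x - s k))\<^sup>2 + 2 * (hnorm H (x - s j))\<^sup>2"
      using parallelogram[of "x - s k" "x - s j"] x sH by simp
    ultimately show ?thesis
      using near[of j] near[of k] low[OF m] by (simp add: power_mult_distrib)
  qed
  have "\<exists>m. \<forall>j\<ge>m. \<forall>k\<ge>m. hnorm H (s j - s k) < e" if "e > 0" for e
  proof -
    obtain m where m: "inverse (real (Suc m)) < e\<^sup>2 / 4"
      using reals_Archimedean[of "e\<^sup>2 / 4"] \<open>e > 0\<close> by auto
    have "hnorm H (s j - s k) < e" if "j \<ge> m" "k \<ge> m" for j k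
    proof -
      have "inverse (real (Suc j)) \<le> inverse (real (Suc m))"
        "inverse (real (Suc k)) \<le> inverse (real (Suc m))"
        using that by (auto intro!: le_imp_inverse_le)
      then have "(hnorm H (s j - s k))\<^sup>2 < e\<^sup>2" using gap[of j k] m by linarith
      then show ?thesis by (rule power2_less_imp_less) (use \<open>e > 0\<close> in simp)
    qed
    then show ?thesis by blast
  qed
  then obtain p where p: "p \<in> hcarrier H" "hconv H s p"
    using complete_hconv[of s] sH by metis
  have pS: "p \<in> S" using S s p by (auto simp: hclosed_def)
  have "(\<lambda>k. hnorm H (x - s k)) \<longlonglongrightarrow> hnorm H (x - p)"
  proof (rule hconv_hnorm)
    have "x - s k - (x - p) = p - s k" for k by simp
    then show "hconv H (\<lambda>k. x - s k) (x - p)"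
      using p sH hnorm_minus_commute by (simp add: hconv_def)
  qed (use x p sH in auto)
  then have 1: "(\<lambda>k. (hnorm H (x - s k))\<^sup>2) \<longlonglongrightarrow> (hnorm H (x - p))\<^sup>2"
    by (rule tendsto_power)
  have 2: "(\<lambda>k. \<delta> + inverse (real (Suc k))) \<longlonglongrightarrow> \<delta> + 0"
    by (intro tendsto_intros LIMSEQ_inverse_real_of_nat)
  have le: "(hnorm H (x - p))\<^sup>2 \<le> \<delta>"
    using LIMSEQ_le[OF 1 2] near by (auto intro: less_imp_le)
  have "hnorm H (x - p) \<le> hnorm H (x - t)" if "t \<in> S" for t
    by (rule power2_le_imp_le) (use le low[OF that] x that SH in auto)
  then show ?thesis using pS by blast
qed

text \<open>The nearest point works: if \<open>x - p\<close> had a nonzero component along some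
  \<open>s\<close> in \<open>S\<close>, adding that component to \<open>p\<close> would come
  strictly closer to \<open>x\<close>.\<close>

lemma orthogonal_projection:
  assumes S: "hclosed H S" and x: "x \<in> hcarrier H"
  obtains p where "p \<in> S" "x - p \<in> hcompl H S"
proof -
  have sub: "complex_vector.subspace S" and SH: "S \<subseteq> hcarrier H"
    using S by (auto simp: hclosed_def)
  obtain p where p: "p \<in> S" and best: "\<And>s. s \<in> S \<Longrightarrow> hnorm H (x - p) \<le> hnorm H (x - s)"
    using best_approximation[OF S x] by blast
  have pH: "p \<in> hcarrier H" using p SH by auto
  have "hinner H (x - p) s = 0" if s: "s \<in> S" for s
  proof (cases "s = 0")
    case False
    have sH: "s \<in> hcarrier H" using s SH by auto
    then have pos: "hnorm H s > 0"
      using False hnorm_eq_0[of s] hnorm_nonneg[of s] by linarith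
    define a where "a = hinner H (x - p) s / hinner H s s"
    have as: "a *\<^sub>C s \<in> S" using s sub complex_vector.subspace_scale by blast
    have "hinner H (x - p - a *\<^sub>C s) (a *\<^sub>C s) = 0"
      using x pH sH pos by (simp add: inner_simps a_def inner_self)
    then have "(hnorm H (x - p))\<^sup>2 = (hnorm H (x - (p + a *\<^sub>C s)))\<^sup>2 + (hnorm H (a *\<^sub>C s))\<^sup>2"
      using pythagoras[of "x - p - a *\<^sub>C s" "a *\<^sub>C s"] x pH sH by (simp add: diff_diff_add)
    moreover have "(hnorm H (x - p))\<^sup>2 \<le> (hnorm H (x - (p + a *\<^sub>C s)))\<^sup>2"
      using best[of "p + a *\<^sub>C s"] complex_vector.subspace_add[OF sub p as] x pH
      by (intro power_mono) auto
    ultimately have "(hnorm H (a *\<^sub>C s))\<^sup>2 \<le> 0" by linarith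
    then have "a = 0" using sH pos False by (simp add: hnorm_scaleC)
    then show ?thesis using pos sH False by (simp add: a_def inner_self)
  qed (use x pH in auto)
  with that p x pH show thesis by (auto simp: hcompl_def)
qed

lemma hcompl_hcompl_subset: "S \<subseteq> hcarrier H \<Longrightarrow> S \<subseteq> hcompl H (hcompl H S)"
  by (auto simp: hcompl_def orthogonal_commute subset_iff)

lemma hcompl_inter: "x \<in> S \<Longrightarrow> x \<in> hcompl H S \<Longrightarrow> x = 0"
  using inner_positive[of x] by (force simp: hcompl_def)

text \<open>A vector of \<open>T\<close> minus its projection on \<open>S\<close> lies both in
  \<open>T\<close> and in the complement of \<open>S\<close>. Closedness is asked of the smaller set
  alone, so \<open>T\<close> may be a subspace for which it has not been established.\<close>

lemma hclosed_eqI: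
  assumes S: "hclosed H S" and T: "complex_vector.subspace T" and "S \<subseteq> T" "T \<subseteq> hcarrier H" "T \<inter> hcompl H S \<subseteq> {0}"
  shows "S = T"
proof
  show "T \<subseteq> S"
  proof
    fix x assume x: "x \<in> T"
    then obtain p where p: "p \<in> S" "x - p \<in> hcompl H S"
      using orthogonal_projection[OF S, of x] assms(4) by blast
    then have "x - p \<in> T" using x T assms(3) by (auto intro: complex_vector.subspace_diff)
    then have "x - p = 0" using p assms(5) by blast
    then show "x \<in> S" using p by simp
  qed
qed fact

lemma hcompl_hcompl:
  assumes "hclosed H S"
  shows "hcompl H (hcompl H S) = S"
proof (rule hclosed_eqI[OF assms, symmetric])
  have SH: "S \<subseteq> hcarrier H" using assms by (simp add: hclosed_def)
  have "hclosed H (hcompl H (hcompl H S))"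
    by (rule hclosed_hcompl) (auto simp: hcompl_def)
  then show "complex_vector.subspace (hcompl H (hcompl H S))" by (simp add: hclosed_def)
  show "S \<subseteq> hcompl H (hcompl H S)" using SH by (rule hcompl_hcompl_subset)
  show "hcompl H (hcompl H S) \<subseteq> hcarrier H" by (auto simp: hcompl_def)
  show "hcompl H (hcompl H S) \<inter> hcompl H S \<subseteq> {0}" using hcompl_inter by blast
qed

section \<open>Total sets, density, and closed subspaces as Hilbert spaces\<close>

lemma htotal_ext:
  assumes "htotal H S" "a \<in> hcarrier H" "b \<in> hcarrier H" "\<And>s. s \<in> S \<Longrightarrow> hinner H a s = hinner H b s"
  shows "a = b"
proof -
  have "a - b \<in> hcompl H S"
    using assms by (auto simp: hcompl_def htotal_def inner_diff_left subset_iff)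
  then show ?thesis using assms(1) by (auto simp: htotal_def)
qed

lemma hclosure_hclosed:
  assumes S: "complex_vector.subspace S" and SH: "S \<subseteq> hcarrier H"
  shows "hclosed H {x \<in> hcarrier H. \<forall>e>0. \<exists>y\<in>S. hnorm H (x - y) < e}" (is "hclosed H ?C")
  unfolding hclosed_def
proof (intro conjI allI impI)
  show "complex_vector.subspace ?C"
  proof (rule complex_vector.subspaceI)
    show "0 \<in> ?C" using complex_vector.subspace_0[OF S] by force
  next
    fix x y assume xy: "x \<in> ?C" "y \<in> ?C"
    have "\<exists>u\<in>S. hnorm H (x + y - u) < e" if "e > 0" for e
    proof -
      from xy \<open>e > 0\<close> half_gt_zero[OF \<open>e > 0\<close>] obtain a b where ab: "a \<in> S" "b \<in> S"
        "hnorm H (x - a) < e / 2" "hnorm H (y - b) < e / 2" by blast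
      have "x + y - (a + b) = (x - a) + (y - b)" by simp
      then have "hnorm H (x + y - (a + b)) < e"
        using hnorm_triangle[of "x - a" "y - b"] ab xy SH
        by (smt (verit) diff_mem field_sum_of_halves mem_Collect_eq subsetD)
      then show ?thesis using complex_vector.subspace_add[OF S ab(1,2)] by blast
    qed
    then show "x + y \<in> ?C" using xy by simp
  next
    fix c x assume x: "x \<in> ?C"
    have "\<exists>u\<in>S. hnorm H (c *\<^sub>C x - u) < e" if "e > 0" for e
    proof (cases "c = 0")
      case True
      then show ?thesis using that complex_vector.subspace_0[OF S] by force
    next
      case False
      then have "e / cmod c > 0" using that by simp
      then obtain a where a: "a \<in> S" "hnorm H (x - a) < e / cmod c" using x by blast
      have "hnorm H (c *\<^sub>C x - c *\<^sub>C a) = cmod c * hnorm H (x - a)"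
        using hnorm_scaleC[of "x - a" c] x a SH
        by (auto simp: complex_vector.scale_right_diff_distrib)
      also have "\<dots> < e" using a False by (simp add: field_simps)
      finally show ?thesis using complex_vector.subspace_scale[OF S a(1)] by blast
    qed
    then show "c *\<^sub>C x \<in> ?C" using x by simp
  qed
  fix s x assume s: "\<forall>k. s k \<in> ?C" and x: "x \<in> hcarrier H" "hconv H s x"
  have "\<exists>y\<in>S. hnorm H (x - y) < e" if "e > 0" for e
  proof -
    have "e / 2 > 0" using that by simp
    obtain k where k: "hnorm H (s k - x) < e / 2"
      using order_tendstoD(2)[OF x(2)[unfolded hconv_def] \<open>e / 2 > 0\<close>]
      by (auto simp: eventually_sequentially)
    obtain y where y: "y \<in> S" "hnorm H (s k - y) < e / 2" using s \<open>e / 2 > 0\<close> by blast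
    have "hnorm H (x - y) < e"
      using hnorm_triangle_diff[of x "s k" y] hnorm_minus_commute[of x "s k"] s x y k SH
      by (smt (verit) field_sum_of_halves mem_Collect_eq subsetD)
    then show ?thesis using y by blast
  qed
  then show "x \<in> ?C" using x by simp
qed auto

lemma span_mem: "S \<subseteq> hcarrier H \<Longrightarrow> x \<in> complex_vector.span S \<Longrightarrow> x \<in> hcarrier H"
  using complex_vector.span_minimal subspace_carrier by blast

text \<open>The closure of the span is a closed subspace containing \<open>S\<close>, so its
  complement is trivial and \<open>hclosed_eqI\<close> makes it the whole carrier.\<close>

lemma htotal_dense:
  assumes S: "htotal H S" and x: "x \<in> hcarrier H" and e: "e > 0"
  shows "\<exists>y\<in>complex_vector.span S. hnorm H (x - y) < e"
proof -
  have SH: "complex_vector.span S \<subseteq> hcarrier H"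
    using S span_mem by (auto simp: htotal_def)
  define C where "C = {x \<in> hcarrier H. \<forall>e>0. \<exists>y\<in>complex_vector.span S. hnorm H (x - y) < e}"
  have C: "hclosed H C"
    unfolding C_def by (rule hclosure_hclosed[OF _ SH]) simp
  have "S \<subseteq> C"
    using SH complex_vector.span_superset[of S] by (force simp: C_def)
  then have "hcompl H C \<subseteq> hcompl H S" by (auto simp: hcompl_def)
  then have "C = hcarrier H"
    using S by (intro hclosed_eqI[OF C subspace_carrier]) (auto simp: htotal_def C_def)
  then show ?thesis using x e by (auto simp: C_def)
qed

lemma htotal_hconv:
  assumes S: "htotal H S" and x: "x \<in> hcarrier H"
  obtains s where "\<And>k. s k \<in> complex_vector.span S" "hconv H s x"
proof -
  have "\<exists>y\<in>complex_vector.span S. hnorm H (x - y) < inverse (real (Suc k))" for k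
    by (rule htotal_dense[OF S x]) simp
  then obtain s where s: "\<And>k. s k \<in> complex_vector.span S"
    "\<And>k. hnorm H (x - s k) < inverse (real (Suc k))" by metis
  have sH: "s k \<in> hcarrier H" for k
    using S s span_mem by (auto simp: htotal_def)
  have "hconv H s x"
    unfolding hconv_def
  proof (rule Lim_null_comparison[OF _ LIMSEQ_inverse_real_of_nat])
    show "\<forall>\<^sub>F k in sequentially. norm (hnorm H (s k - x)) \<le> inverse (real (Suc k))"
      using s(2) hnorm_minus_commute[OF x sH] sH x by (auto intro!: always_eventually less_imp_le)
  qed
  with s that show thesis by blast
qed

text \<open>Separability is the point: a countable dense set of \<open>H\<close> may miss
  \<open>S\<close> altogether. Its projections onto \<open>S\<close> are dense in \<open>S\<close>,
  since projecting does not increase the distance to points of \<open>S\<close>.\<close>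

lemma hilbert_space_subhilb:
  assumes S: "hclosed H S"
  shows "hilbert_space (subhilb H S)"
proof -
  have sub: "complex_vector.subspace S" and SH: "S \<subseteq> hcarrier H"
    using S by (auto simp: hclosed_def)
  show ?thesis
  proof (unfold_locales, goal_cases)
    case (6 s)
    then have sH: "\<And>k. s k \<in> hcarrier H" using SH by auto
    obtain x where "x \<in> hcarrier H" "hconv H s x"
      using complete_hconv[of s] sH 6(2) by (metis subhilb_simps(3))
    then show ?case using S 6(1) unfolding hclosed_def by (metis hconv_def subhilb_simps(1,3))
  next
    case 7
    obtain D where D: "countable D" "D \<subseteq> hcarrier H"
      "\<forall>x\<in>hcarrier H. \<forall>e>0. \<exists>d\<in>D. hnorm H (x - d) < e"
      using separable by (elim exE conjE)
    have "\<exists>p\<in>S. d - p \<in> hcompl H S" if "d \<in> D" for d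
      using orthogonal_projection[OF S, of d] that D(2) by (metis subsetD)
    then obtain P where P: "\<And>d. d \<in> D \<Longrightarrow> P d \<in> S" "\<And>d. d \<in> D \<Longrightarrow> d - P d \<in> hcompl H S"
      by metis
    have le: "hnorm H (x - P d) \<le> hnorm H (x - d)" if "x \<in> S" "d \<in> D" for x d
    proof -
      have "hinner H (d - P d) (x - P d) = 0"
        using P[OF that(2)] that complex_vector.subspace_diff[OF sub, of x "P d"]
        by (auto simp: hcompl_def)
      moreover have mem: "d - P d \<in> hcarrier H" "x - P d \<in> hcarrier H"
        using subsetD[OF SH that(1)] subsetD[OF D(2) that(2)] subsetD[OF SH P(1)[OF that(2)]] by auto
      ultimately have "P d - d \<in> hcarrier H" "hinner H (P d - d) (x - P d) = 0"
        using uminus_mem[of "d - P d"] inner_uminus_left[of "d - P d" "x - P d"] by simp_all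
      then have "(hnorm H (x - d))\<^sup>2 = (hnorm H (x - P d))\<^sup>2 + (hnorm H (P d - d))\<^sup>2"
        using pythagoras[of "x - P d" "P d - d"] orthogonal_commute[of "x - P d" "P d - d"] mem by simp
      then have "(hnorm H (x - P d))\<^sup>2 \<le> (hnorm H (x - d))\<^sup>2" by simp
      then show ?thesis
        by (rule power2_le_imp_le) (use that D(2) SH in \<open>auto intro!: hnorm_nonneg diff_mem\<close>)
    qed
    have "\<exists>d\<in>P ` D. hnorm H (x - d) < e" if x: "x \<in> S" and e: "e > 0" for x e
    proof -
      obtain d where "d \<in> D" "hnorm H (x - d) < e" using D(3) x e SH by blast
      then show ?thesis using le[OF x] by (meson imageI order.strict_trans1)
    qed
    moreover have "countable (P ` D)" "P ` D \<subseteq> S" using D(1) P(1) by auto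
    ultimately show ?case by auto
  qed (use sub SH in \<open>auto simp: inner_simps subset_iff intro: inner_commute inner_positive\<close>)
qed

text \<open>The null space of the functional is closed. A vector \<open>u\<close> orthogonal to it
  and outside it represents \<open>f\<close> up to a scalar, because every \<open>v\<close> differs
  from a multiple of \<open>u\<close> by an element of the null space.\<close>

lemma Riesz:
  assumes add: "\<And>x y. x \<in> hcarrier H \<Longrightarrow> y \<in> hcarrier H \<Longrightarrow> f (x + y) = f x + f y"
    and scale: "\<And>a x. x \<in> hcarrier H \<Longrightarrow> f (a *\<^sub>C x) = a * f x"
    and bound: "\<And>x. x \<in> hcarrier H \<Longrightarrow> cmod (f x) \<le> C * hnorm H x"
  shows "\<exists>y\<in>hcarrier H. \<forall>x\<in>hcarrier H. f x = hinner H x y"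
proof -
  define S where "S = {x \<in> hcarrier H. f x = 0}"
  have diff: "f (x - y) = f x - f y" if "x \<in> hcarrier H" "y \<in> hcarrier H" for x y
    using add[of x "- y"] scale[of y "-1"] that by (simp add: scaleC_one)
  have S: "hclosed H S"
    unfolding hclosed_def
  proof (intro conjI allI impI)
    show "complex_vector.subspace S"
      using scale[of 0 0] by (auto simp: S_def add scale intro!: complex_vector.subspaceI)
    fix s x assume s: "\<forall>k. s k \<in> S" and x: "x \<in> hcarrier H" "hconv H s x"
    have "cmod (f x) \<le> C * hnorm H (s k - x)" for k
      using bound[of "s k - x"] s x by (auto simp: S_def diff)
    moreover have "(\<lambda>k. C * hnorm H (s k - x)) \<longlonglongrightarrow> C * 0"
      using x unfolding hconv_def by (intro tendsto_intros)
    ultimately have "cmod (f x) \<le> C * 0" by (meson LIMSEQ_le_const)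
    then show "x \<in> S" using x by (auto simp: S_def)
  qed (auto simp: S_def)
  show ?thesis
  proof (cases "hcarrier H \<subseteq> S")
    case True
    then show ?thesis by (intro bexI[of _ 0]) (auto simp: S_def)
  next
    case False
    then obtain x where x: "x \<in> hcarrier H" "x \<notin> S" by blast
    obtain p where p: "p \<in> S" "x - p \<in> hcompl H S"
      using orthogonal_projection[OF S x(1)] by metis
    define u where "u = x - p"
    have u: "u \<in> hcarrier H" "f u \<noteq> 0"
      using x p by (auto simp: u_def S_def diff)
    then have "u \<noteq> 0" using scale[of 0 0] by auto
    then have pos: "hnorm H u > 0" using u hnorm_eq_0[of u] hnorm_nonneg[of u] by linarith
    define y where "y = cnj (f u / hinner H u u) *\<^sub>C u"
    have "f v = hinner H v y" if v: "v \<in> hcarrier H" for v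
    proof -
      have "v - (f v / f u) *\<^sub>C u \<in> S"
        using v u by (simp add: S_def diff scale)
      then have "hinner H u (v - (f v / f u) *\<^sub>C u) = 0"
        using p by (auto simp: hcompl_def u_def)
      then have "hinner H (v - (f v / f u) *\<^sub>C u) u = 0"
        using v u by (simp add: orthogonal_commute)
      then have "hinner H v u = (f v / f u) * hinner H u u"
        using v u by (simp add: inner_simps)
      moreover have "hinner H u u \<noteq> 0" using u pos \<open>u \<noteq> 0\<close> by (simp add: inner_self)
      moreover have "hinner H v y = f u / hinner H u u * hinner H v u"
        using u v by (simp add: y_def inner_scaleC_right)
      ultimately show ?thesis using u by simp
    qed
    moreover have "y \<in> hcarrier H" using u by (simp add: y_def)
    ultimately show ?thesis by blast
  qed
qed

lemma inner_ext:
  assumes "x \<in> hcarrier H" "y \<in> hcarrier H" "\<And>u. u \<in> hcarrier H \<Longrightarrow> hinner H u x = hinner H u y"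
  shows "x = y"
proof -
  have "hinner H (x - y) (x - y) = 0"
    using assms(3)[of "x - y"] assms(1,2) by (subst inner_diff_right) auto
  then show ?thesis
    using assms(1,2) inner_positive[of "x - y"] by (cases "x - y = 0") auto
qed

lemma inner_ext_left:
  assumes "x \<in> hcarrier H" "y \<in> hcarrier H" "\<And>u. u \<in> hcarrier H \<Longrightarrow> hinner H x u = hinner H y u"
  shows "x = y"
proof -
  have "hinner H (x - y) (x - y) = 0"
    using assms(3)[of "x - y"] assms(1,2) by (subst inner_diff_left) auto
  then show ?thesis
    using assms(1,2) inner_positive[of "x - y"] by (cases "x - y = 0") auto
qed

end

section \<open>Bounded operators and their adjoints\<close>

lemma bounded_op_add:
  "bounded_op H K T \<Longrightarrow> x \<in> hcarrier H \<Longrightarrow> y \<in> hcarrier H \<Longrightarrow> T (x + y) = T x + T y"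
  by (simp add: bounded_op_def)

lemma bounded_op_scaleC:
  "bounded_op H K T \<Longrightarrow> x \<in> hcarrier H \<Longrightarrow> T (a *\<^sub>C x) = a *\<^sub>C T x"
  by (simp add: bounded_op_def)

lemma bounded_op_mem: "bounded_op H K T \<Longrightarrow> x \<in> hcarrier H \<Longrightarrow> T x \<in> hcarrier K"
  by (auto simp: bounded_op_def)

locale hilbert_space_pair = H: hilbert_space H + K: hilbert_space K
  for H :: "'a::complex_vector hilb" and K :: "'b::complex_vector hilb"
begin

lemma bounded_op_zero: "bounded_op H K T \<Longrightarrow> T 0 = 0"
  using bounded_op_scaleC[of H K T 0 0] by simp

lemma bounded_op_diff:
  assumes "bounded_op H K T" "x \<in> hcarrier H" "y \<in> hcarrier H"
  shows "T (x - y) = T x - T y"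
  using bounded_op_add[OF assms(1), of "x - y" y] assms by simp

lemma bounded_op_hconv:
  assumes T: "bounded_op H K T" and s: "\<And>k. s k \<in> hcarrier H" and x: "x \<in> hcarrier H"
    and lim: "hconv H s x"
  shows "hconv K (\<lambda>k. T (s k)) (T x)"
proof -
  obtain C where C: "\<And>x. x \<in> hcarrier H \<Longrightarrow> hnorm K (T x) \<le> C * hnorm H x"
    using T unfolding bounded_op_def by blast
  show ?thesis
    unfolding hconv_def
  proof (rule Lim_null_comparison)
    have "hnorm K (T (s k) - T x) \<le> C * hnorm H (s k - x)" for k
      using C[of "s k - x"] s x T by (simp add: bounded_op_diff)
    then show "\<forall>\<^sub>F k in sequentially. norm (hnorm K (T (s k) - T x)) \<le> C * hnorm H (s k - x)"
      using s x T by (simp add: bounded_op_mem)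
    show "(\<lambda>k. C * hnorm H (s k - x)) \<longlonglongrightarrow> 0"
      using lim by (simp add: hconv_def tendsto_mult_right_zero)
  qed
qed

lemma hclosed_hkernel:
  assumes T: "bounded_op H K T"
  shows "hclosed H (hkernel H T)"
  unfolding hclosed_def
proof (intro conjI allI impI)
  show "complex_vector.subspace (hkernel H T)"
    using T by (auto simp: hkernel_def bounded_op_zero bounded_op_add bounded_op_scaleC
        intro!: complex_vector.subspaceI)
  show "hkernel H T \<subseteq> hcarrier H" by (auto simp: hkernel_def)
  fix s x assume s: "\<forall>k. s k \<in> hkernel H T" and x: "x \<in> hcarrier H" "hconv H s x"
  have sH: "\<And>k. s k \<in> hcarrier H" "\<And>k. T (s k) = 0" using s by (auto simp: hkernel_def)
  have "hconv K (\<lambda>k. T (s k)) (T x)"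
    using bounded_op_hconv[OF T] sH x by blast
  moreover have "hconv K (\<lambda>k. T (s k)) 0" using sH by (simp add: hconv_def)
  ultimately have "T x = 0"
    by (rule K.hconv_unique[rotated 3]) (use T x sH in \<open>auto simp: bounded_op_mem\<close>)
  then show "x \<in> hkernel H T" using x by (simp add: hkernel_def)
qed

lemma hadjoint_ex1:
  assumes T: "bounded_op H K T" and y: "y \<in> hcarrier K"
  shows "\<exists>!x. x \<in> hcarrier H \<and> (\<forall>u\<in>hcarrier H. hinner K (T u) y = hinner H u x)"
proof (rule ex_ex1I)
  obtain C where C: "\<And>x. x \<in> hcarrier H \<Longrightarrow> hnorm K (T x) \<le> C * hnorm H x"
    using T unfolding bounded_op_def by blast
  have "\<exists>x\<in>hcarrier H. \<forall>u\<in>hcarrier H. hinner K (T u) y = hinner H u x"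
  proof (rule H.Riesz)
    fix x assume x: "x \<in> hcarrier H"
    have "cmod (hinner K (T x) y) \<le> hnorm K (T x) * hnorm K y"
      using K.Cauchy_Schwarz T x y by (simp add: bounded_op_mem)
    also have "\<dots> \<le> C * hnorm H x * hnorm K y"
      using C[OF x] y by (simp add: mult_right_mono)
    finally show "cmod (hinner K (T x) y) \<le> (C * hnorm K y) * hnorm H x"
      by (simp add: mult_ac)
  qed (use T y in \<open>auto simp: bounded_op_add bounded_op_scaleC bounded_op_mem K.inner_simps\<close>)
  then show "\<exists>x. x \<in> hcarrier H \<and> (\<forall>u\<in>hcarrier H. hinner K (T u) y = hinner H u x)"
    by blast
qed (auto intro: H.inner_ext)

lemma
  assumes T: "bounded_op H K T" and y: "y \<in> hcarrier K"
  shows hadjoint_mem: "hadjoint H K T y \<in> hcarrier H"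
    and hadjoint_right: "u \<in> hcarrier H \<Longrightarrow> hinner H u (hadjoint H K T y) = hinner K (T u) y"
  using theI'[OF hadjoint_ex1[OF T y]] by (auto simp: hadjoint_def)

lemma hadjoint_left:
  assumes T: "bounded_op H K T" and y: "y \<in> hcarrier K" and u: "u \<in> hcarrier H"
  shows "hinner H (hadjoint H K T y) u = hinner K y (T u)"
  using hadjoint_right[OF assms] H.inner_commute[OF u hadjoint_mem[OF T y]]
    K.inner_commute[OF bounded_op_mem[OF T u] y] by simp

lemma hadjoint_eqI:
  assumes T: "bounded_op H K T" and y: "y \<in> hcarrier K" and x: "x \<in> hcarrier H"
    and eq: "\<And>u. u \<in> hcarrier H \<Longrightarrow> hinner H x u = hinner K y (T u)"
  shows "hadjoint H K T y = x"
  using hadjoint_left[OF T y] hadjoint_mem[OF T y] x eq by (intro H.inner_ext_left) auto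

text \<open>For \<open>y\<close> orthogonal to the kernel, \<open>T* T y = y\<close>: the difference
  is killed by \<open>T\<close> because \<open>T T*\<close> is the identity, and it is orthogonal to
  the kernel because both terms are. The vector \<open>x\<close> remains arbitrary.\<close>

lemma co_isometry_inner:
  assumes T: "co_isometry H K T" and x: "x \<in> hcarrier H" and y: "y \<in> hcompl H (hkernel H T)"
  shows "hinner K (T x) (T y) = hinner H x y"
proof -
  have b: "bounded_op H K T" and co: "\<And>y. y \<in> hcarrier K \<Longrightarrow> T (hadjoint H K T y) = y"
    using T by (auto simp: co_isometry_def)
  have yH: "y \<in> hcarrier H" using y by (simp add: hcompl_def)
  define k where "k = hadjoint H K T (T y) - y"
  have adj: "hadjoint H K T (T y) \<in> hcarrier H"
    using b yH by (simp add: hadjoint_mem bounded_op_mem)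
  have k: "k \<in> hkernel H T"
    using b yH adj co by (simp add: k_def hkernel_def bounded_op_diff bounded_op_mem)
  have "k \<in> hcompl H (hkernel H T)"
    using b yH adj y
    by (auto simp: k_def hcompl_def hkernel_def H.inner_diff_left hadjoint_left bounded_op_mem)
  with k have "k = 0" using H.hcompl_inter by blast
  then have "hadjoint H K T (T y) = y" by (simp add: k_def)
  then show ?thesis
    using hadjoint_right[OF b _ x, of "T y"] b yH by (simp add: bounded_op_mem)
qed

end

section \<open>Square-summable families\<close>

text \<open>The Hilbert sum of copies of \<open>E\<close>. It serves twice: indexed by words in the
  variables it is the space in which the Drury-Arveson kernel is factorised, and indexed by
  \<open>'n option\<close> it receives a constant part together with one component for each
  variable.\<close>

definition ell2 :: "'e::complex_vector hilb \<Rightarrow> ('i \<Rightarrow> 'e) hilb" where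
  "ell2 E = \<lparr>hcarrier = {c. (\<forall>i. c i \<in> hcarrier E) \<and> (\<lambda>i. (hnorm E (c i))\<^sup>2) summable_on UNIV},
    hinner = (\<lambda>c d. \<Sum>\<^sub>\<infinity>i. hinner E (c i) (d i))\<rparr>"

context hilbert_space
begin

lemma ell2_app: "c \<in> hcarrier (ell2 H) \<Longrightarrow> c i \<in> hcarrier H"
  by (simp add: ell2_def)

lemma ell2_summable: "c \<in> hcarrier (ell2 H) \<Longrightarrow> (\<lambda>i. (hnorm H (c i))\<^sup>2) summable_on UNIV"
  by (simp add: ell2_def)

lemma ell2_inner_summable:
  assumes c: "c \<in> hcarrier (ell2 H)" and d: "d \<in> hcarrier (ell2 H)"
  shows "(\<lambda>i. hinner H (c i) (d i)) summable_on UNIV"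
proof (rule Infinite_Sum.abs_summable_summable, rule Infinite_Sum.abs_summable_on_comparison_test')
  show "(\<lambda>i. (hnorm H (c i))\<^sup>2 + (hnorm H (d i))\<^sup>2) summable_on UNIV"
    by (intro summable_on_add ell2_summable c d)
  fix i
  have "cmod (hinner H (c i) (d i)) \<le> hnorm H (c i) * hnorm H (d i)"
    using c d by (intro Cauchy_Schwarz) (auto intro: ell2_app)
  also have "\<dots> \<le> 2 * (hnorm H (c i) * hnorm H (d i))"
    using c d by (simp add: ell2_app)
  also have "\<dots> \<le> (hnorm H (c i))\<^sup>2 + (hnorm H (d i))\<^sup>2"
    using sum_squares_bound[of "hnorm H (c i)" "hnorm H (d i)"] by (simp add: mult.assoc)
  finally show "norm (hinner H (c i) (d i)) \<le> (hnorm H (c i))\<^sup>2 + (hnorm H (d i))\<^sup>2" .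
qed

lemma hinner_ell2: "hinner (ell2 H) c d = (\<Sum>\<^sub>\<infinity>i. hinner H (c i) (d i))"
  by (simp add: ell2_def)

lemma hinner_ell2_self:
  assumes c: "c \<in> hcarrier (ell2 H)"
  shows "hinner (ell2 H) c c = of_real (\<Sum>\<^sub>\<infinity>i. (hnorm H (c i))\<^sup>2)"
proof -
  have "((\<lambda>i. complex_of_real ((hnorm H (c i))\<^sup>2)) has_sum of_real (\<Sum>\<^sub>\<infinity>i. (hnorm H (c i))\<^sup>2)) UNIV"
    using ell2_summable[OF c] by (intro has_sum_of_real) simp
  then show ?thesis
    using c ell2_app[OF c] unfolding hinner_ell2 by (simp add: inner_self infsumI)
qed

lemma hnorm_ell2_has_sum:
  assumes c: "c \<in> hcarrier (ell2 H)"
  shows "((\<lambda>i. (hnorm H (c i))\<^sup>2) has_sum (hnorm (ell2 H) c)\<^sup>2) UNIV"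
proof -
  have "(hnorm (ell2 H) c)\<^sup>2 = (\<Sum>\<^sub>\<infinity>i. (hnorm H (c i))\<^sup>2)"
    using c by (simp add: hnorm_def[of "ell2 H"] hinner_ell2_self infsum_nonneg)
  then show ?thesis using ell2_summable[OF c] by simp
qed

lemma hnorm_ell2_app_le:
  assumes c: "c \<in> hcarrier (ell2 H)"
  shows "hnorm H (c i) \<le> hnorm (ell2 H) c"
proof (rule power2_le_imp_le)
  show "(hnorm H (c i))\<^sup>2 \<le> (hnorm (ell2 H) c)\<^sup>2"
    using finite_sum_le_has_sum[OF hnorm_ell2_has_sum[OF c], of "{i}"] by simp
  show "0 \<le> hnorm (ell2 H) c" by (simp add: hnorm_def c hinner_ell2_self infsum_nonneg)
qed

lemma ell2_memI:
  assumes c: "\<And>i. c i \<in> hcarrier H" and B: "\<And>F. finite F \<Longrightarrow> (\<Sum>i\<in>F. (hnorm H (c i))\<^sup>2) \<le> B"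
  shows "c \<in> hcarrier (ell2 H)" "(hnorm (ell2 H) c)\<^sup>2 \<le> B"
proof -
  have "(\<lambda>i. (hnorm H (c i))\<^sup>2) summable_on UNIV"
    using B by (intro nonneg_bdd_above_summable_on bdd_aboveI2[of _ _ B]) auto
  then show 1: "c \<in> hcarrier (ell2 H)" using c by (simp add: ell2_def)
  show "(hnorm (ell2 H) c)\<^sup>2 \<le> B"
    using has_sum_le_finite_sums[OF hnorm_ell2_has_sum[OF 1]] B by blast
qed

lemma ell2_add:
  assumes c: "c \<in> hcarrier (ell2 H)" and d: "d \<in> hcarrier (ell2 H)"
  shows "c + d \<in> hcarrier (ell2 H)"
proof -
  have "(\<lambda>i. 2 * ((hnorm H (c i))\<^sup>2 + (hnorm H (d i))\<^sup>2)) summable_on UNIV"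
    by (intro summable_on_cmult_right summable_on_add ell2_summable c d)
  then have "(\<lambda>i. (hnorm H (c i + d i))\<^sup>2) summable_on UNIV"
  proof (rule summable_on_comparison_test)
    fix i
    show "(hnorm H (c i + d i))\<^sup>2 \<le> 2 * ((hnorm H (c i))\<^sup>2 + (hnorm H (d i))\<^sup>2)"
      using parallelogram[OF ell2_app[OF c, of i] ell2_app[OF d, of i]]
        zero_le_power2[of "hnorm H (c i - d i)"] unfolding distrib_left by linarith
  qed auto
  then show ?thesis using c d by (simp add: ell2_def)
qed

lemma ell2_scaleC:
  assumes c: "c \<in> hcarrier (ell2 H)"
  shows "a *\<^sub>C c \<in> hcarrier (ell2 H)"
proof -
  have "(\<lambda>i. (cmod a)\<^sup>2 * (hnorm H (c i))\<^sup>2) summable_on UNIV"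
    by (intro summable_on_cmult_right ell2_summable c)
  then show ?thesis
    using c by (simp add: ell2_def scaleC_fun_def hnorm_scaleC power_mult_distrib)
qed

lemma ell2_diff:
  assumes "c \<in> hcarrier (ell2 H)" "d \<in> hcarrier (ell2 H)"
  shows "c - d \<in> hcarrier (ell2 H)"
  using ell2_add[OF assms(1) ell2_scaleC[OF assms(2), of "-1"]]
  by (simp add: scaleC_one)

text \<open>The limit is taken in each component. It is a limit in norm because, for fixed
  \<open>j\<close>, a bound on the finite partial sums of \<open>s j - s k\<close> survives when
  \<open>k\<close> tends to infinity.\<close>

lemma ell2_complete:
  assumes s: "\<And>k::nat. s k \<in> hcarrier (ell2 H)"
    and Cauchy: "\<And>e. e > 0 \<Longrightarrow> \<exists>m. \<forall>j\<ge>m. \<forall>k\<ge>m. hnorm (ell2 H) (s j - s k) < e"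
  shows "\<exists>x\<in>hcarrier (ell2 H). hconv (ell2 H) s x"
proof -
  have diff: "s j - s k \<in> hcarrier (ell2 H)" for j k using s by (simp add: ell2_diff)
  have nn: "0 \<le> hnorm (ell2 H) c" if "c \<in> hcarrier (ell2 H)" for c :: "'b \<Rightarrow> 'a"
    using hnorm_ell2_app_le[OF that, of undefined] hnorm_nonneg[OF ell2_app[OF that]] by (rule order_trans[rotated])
  have "\<exists>y\<in>hcarrier H. hconv H (\<lambda>k. s k i) y" for i
  proof -
    have "\<exists>m. \<forall>j\<ge>m. \<forall>k\<ge>m. hnorm H (s j i - s k i) < e" if "e > 0" for e
    proof -
      obtain m where m: "\<forall>j\<ge>m. \<forall>k\<ge>m. hnorm (ell2 H) (s j - s k) < e" using Cauchy[OF \<open>e > 0\<close>] ..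
      have "hnorm H (s j i - s k i) \<le> hnorm (ell2 H) (s j - s k)" for j k
        using hnorm_ell2_app_le[OF diff[of j k], of i] by simp
      then show ?thesis using m by (meson order.strict_trans1)
    qed
    then show ?thesis
      using complete_hconv[of "\<lambda>k. s k i"] ell2_app[OF s] by metis
  qed
  then obtain x where x: "\<And>i. x i \<in> hcarrier H" "\<And>i. hconv H (\<lambda>k. s k i) (x i)"
    by metis
  have tail: "s j - x \<in> hcarrier (ell2 H) \<and> (hnorm (ell2 H) (s j - x))\<^sup>2 \<le> e\<^sup>2"
    if j: "\<forall>k\<ge>m. hnorm (ell2 H) (s j - s k) < e" for e j m
  proof -
    have "(\<Sum>i\<in>F. (hnorm H ((s j - x) i))\<^sup>2) \<le> e\<^sup>2" if "finite F" for F
    proof (rule LIMSEQ_le_const2)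
      have "hconv H (\<lambda>k. s j i - s k i) (s j i - x i)" for i
        unfolding hconv_def
      proof (rule Lim_transform_eventually)
        show "(\<lambda>k. hnorm H (s k i - x i)) \<longlonglongrightarrow> 0" using x by (simp add: hconv_def)
        show "\<forall>\<^sub>F k in sequentially. hnorm H (s k i - x i) = hnorm H (s j i - s k i - (s j i - x i))"
          using hnorm_minus_commute[OF ell2_app[OF s] x(1)] by simp
      qed
      then show "(\<lambda>k. \<Sum>i\<in>F. (hnorm H (s j i - s k i))\<^sup>2) \<longlonglongrightarrow> (\<Sum>i\<in>F. (hnorm H ((s j - x) i))\<^sup>2)"
        using ell2_app[OF s] x by (intro tendsto_sum tendsto_power) (simp add: hconv_hnorm)
      have "(\<Sum>i\<in>F. (hnorm H (s j i - s k i))\<^sup>2) \<le> e\<^sup>2" if k: "k \<ge> m" for k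
      proof -
        have "(\<Sum>i\<in>F. (hnorm H (s j i - s k i))\<^sup>2) \<le> (hnorm (ell2 H) (s j - s k))\<^sup>2"
          using finite_sum_le_has_sum[OF hnorm_ell2_has_sum[OF diff[of j k]], of F] \<open>finite F\<close> by simp
        also have "\<dots> \<le> e\<^sup>2" using j k nn[OF diff] by (intro power_mono) (auto intro: less_imp_le)
        finally show ?thesis .
      qed
      then show "\<exists>m. \<forall>k\<ge>m. (\<Sum>i\<in>F. (hnorm H (s j i - s k i))\<^sup>2) \<le> e\<^sup>2" by blast
    qed
    then show ?thesis
      using ell2_memI[of "s j - x" "e\<^sup>2"] ell2_app[OF s] x by simp
  qed
  obtain m where "\<forall>j\<ge>m. \<forall>k\<ge>m. hnorm (ell2 H) (s j - s k) < 1" using Cauchy[of 1] by auto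
  then have "s m - x \<in> hcarrier (ell2 H)" using tail by blast
  then have "s m - (s m - x) \<in> hcarrier (ell2 H)" using s by (rule ell2_diff[rotated])
  moreover have "s m - (s m - x) = x" by (simp add: fun_eq_iff)
  ultimately have xmem: "x \<in> hcarrier (ell2 H)" by (simp only:)
  have "hconv (ell2 H) s x"
    unfolding hconv_def LIMSEQ_def
  proof (intro allI impI)
    fix e :: real assume "e > 0"
    then obtain m where m: "\<forall>j\<ge>m. \<forall>k\<ge>m. hnorm (ell2 H) (s j - s k) < e / 2"
      using Cauchy[of "e / 2"] by auto
    have "dist (hnorm (ell2 H) (s j - x)) 0 < e" if "j \<ge> m" for j
    proof -
      have "(hnorm (ell2 H) (s j - x))\<^sup>2 \<le> (e / 2)\<^sup>2" using tail m that by blast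
      then have "hnorm (ell2 H) (s j - x) \<le> e / 2"
        by (rule power2_le_imp_le) (use \<open>e > 0\<close> in simp)
      then show ?thesis using nn[of "s j - x"] s xmem \<open>e > 0\<close> by (simp add: ell2_diff)
    qed
    then show "\<exists>no. \<forall>n\<ge>no. dist (hnorm (ell2 H) (s n - x)) 0 < e" by blast
  qed
  then show ?thesis using xmem by blast
qed

lemma ell2_separable:
  "\<exists>S :: ('i::countable \<Rightarrow> 'a) set. countable S \<and> S \<subseteq> hcarrier (ell2 H) \<and>
    (\<forall>x\<in>hcarrier (ell2 H). \<forall>e>0. \<exists>d\<in>S. hnorm (ell2 H) (x - d) < e)"
proof -
  obtain D where D: "countable D" "D \<subseteq> hcarrier H"
      "\<forall>x\<in>hcarrier H. \<forall>e>0. \<exists>d\<in>D. hnorm H (x - d) < e"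
    using separable by (elim exE conjE)
  \<comment> \<open>An association list codes a finitely supported family, with 0 at all unlisted
    indices; lists over a countable set are countable.\<close>
  define fam :: "('i \<times> 'a) list \<Rightarrow> 'i \<Rightarrow> 'a" where
    "fam xs i = (case map_of xs i of None \<Rightarrow> 0 | Some d \<Rightarrow> d)" for xs i
  define S where "S = fam ` lists (UNIV \<times> D)"
  have "countable S" unfolding S_def using D(1) by simp
  moreover have "S \<subseteq> hcarrier (ell2 H)"
  proof
    fix c assume "c \<in> S"
    then obtain xs where xs: "xs \<in> lists (UNIV \<times> D)" "c = fam xs" by (auto simp: S_def)
    have "c i \<in> hcarrier H" for i
      using xs D(2) by (auto simp: fam_def split: option.split dest!: map_of_SomeD)
    moreover have "(\<Sum>i\<in>F. (hnorm H (c i))\<^sup>2) \<le> (\<Sum>i\<in>fst ` set xs. (hnorm H (c i))\<^sup>2)" if "finite F" for F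
    proof -
      have "(\<Sum>i\<in>F. (hnorm H (c i))\<^sup>2) = (\<Sum>i\<in>F \<inter> fst ` set xs. (hnorm H (c i))\<^sup>2)"
        using that by (intro sum.mono_neutral_right)
          (auto simp: xs(2) fam_def split: option.split dest!: map_of_SomeD, force)
      also have "\<dots> \<le> (\<Sum>i\<in>fst ` set xs. (hnorm H (c i))\<^sup>2)"
        by (intro sum_mono2) auto
      finally show ?thesis .
    qed
    ultimately show "c \<in> hcarrier (ell2 H)" by (rule ell2_memI)
  qed
  moreover have "\<exists>d\<in>S. hnorm (ell2 H) (x - d) < e" if x: "x \<in> hcarrier (ell2 H)" and e: "e > 0" for x e
  proof -
    \<comment> \<open>Two squared errors occur, the tail outside \<open>F\<close> and the
      approximation on \<open>F\<close>. Each will be at most \<open>q\<close>, and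
      \<open>2 * q\<close> is below \<open>e\<^sup>2\<close>.\<close>
    define q where "q = e\<^sup>2 / 4"
    have q: "q > 0" using e by (simp add: q_def)
    obtain F where F: "finite F"
      "dist (\<Sum>i\<in>F. (hnorm H (x i))\<^sup>2) (\<Sum>\<^sub>\<infinity>i. (hnorm H (x i))\<^sup>2) \<le> q"
      using infsum_finite_approximation[OF ell2_summable[OF x] q] by auto
    have tail: "(\<Sum>i\<in>G. (hnorm H (x i))\<^sup>2) \<le> q" if G: "finite G" "G \<inter> F = {}" for G
    proof -
      have "(\<Sum>i\<in>G \<union> F. (hnorm H (x i))\<^sup>2) \<le> (\<Sum>\<^sub>\<infinity>i. (hnorm H (x i))\<^sup>2)"
        using F G ell2_summable[OF x] by (intro finite_sum_le_infsum) auto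
      then show ?thesis using F G by (simp add: sum.union_disjoint dist_real_def)
    qed
    \<comment> \<open>The errors on \<open>F\<close> add up to at most \<open>card F\<close> times
      \<open>r\<^sup>2\<close>, hence to at most \<open>q\<close>. The summand 1 keeps the
      denominator positive when \<open>F\<close> is empty.\<close>
    define r where "r = sqrt (q / (1 + card F))"
    have r: "r > 0" using q by (simp add: r_def)
    have "\<exists>d\<in>D. hnorm H (x i - d) < r" for i using D(3) r ell2_app[OF x] by blast
    then obtain d where d: "\<And>i. d i \<in> D" "\<And>i. hnorm H (x i - d i) < r" by metis
    obtain ks where ks: "set ks = F" using finite_list[OF F(1)] by blast
    define c where "c = fam (map (\<lambda>i. (i, d i)) ks)"
    have c: "c i = (if i \<in> F then d i else 0)" for i
      using ks by (auto simp: c_def fam_def map_of_map_restrict restrict_map_def)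
    have cS: "c \<in> S" unfolding c_def S_def using d by (intro imageI) auto
    have xi: "x i \<in> hcarrier H" "d i \<in> hcarrier H" for i using ell2_app[OF x] d(1) D(2) by auto
    have "(\<Sum>i\<in>G. (hnorm H ((x - c) i))\<^sup>2) \<le> 2 * q" if G: "finite G" for G
    proof -
      have "(\<Sum>i\<in>G. (hnorm H ((x - c) i))\<^sup>2)
          = (\<Sum>i\<in>G \<inter> F. (hnorm H (x i - d i))\<^sup>2) + (\<Sum>i\<in>G - F. (hnorm H (x i))\<^sup>2)"
        using G by (subst sum.Int_Diff[of G _ F]) (auto simp: c intro!: arg_cong2[of _ _ _ _ "(+)"] sum.cong)
      also have "(\<Sum>i\<in>G \<inter> F. (hnorm H (x i - d i))\<^sup>2) \<le> (\<Sum>i\<in>G \<inter> F. r\<^sup>2)"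
        using d(2) xi by (intro sum_mono power_mono) (auto intro: less_imp_le)
      also have "\<dots> \<le> (\<Sum>i\<in>F. r\<^sup>2)" using F by (intro sum_mono2) auto
      also have "\<dots> = q * (card F / (1 + card F))" using q by (simp add: r_def)
      also have "\<dots> \<le> q * 1" using q by (intro mult_left_mono) auto
      also have "(\<Sum>i\<in>G - F. (hnorm H (x i))\<^sup>2) \<le> q" using G by (intro tail) auto
      finally show ?thesis by simp
    qed
    then have "(hnorm (ell2 H) (x - c))\<^sup>2 \<le> 2 * q"
      using xi by (intro ell2_memI) (auto simp: c)
    also have "\<dots> < e\<^sup>2" using e by (simp add: q_def)
    finally have "hnorm (ell2 H) (x - c) < e"
      by (rule power2_less_imp_less) (use e in simp)
    then show ?thesis using cS by blast
  qed
  ultimately show ?thesis by blast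
qed

lemma hilbert_space_ell2: "hilbert_space (ell2 H :: ('i::countable \<Rightarrow> 'a) hilb)"
proof (unfold_locales, goal_cases)
  case 1
  have "0 \<in> hcarrier (ell2 H)" by (simp add: ell2_def)
  then show ?case by (intro complex_vector.subspaceI ell2_add ell2_scaleC)
next
  case (2 x y z)
  show ?case
    using infsum_add[OF ell2_inner_summable[OF 2(1,3)] ell2_inner_summable[OF 2(2,3)]] 2
    by (simp add: hinner_ell2 inner_add_left ell2_app)
next
  case (3 x y a)
  then show ?case
    by (simp add: hinner_ell2 scaleC_fun_def inner_scaleC_left ell2_app infsum_cmult_right')
next
  case (4 x y)
  then show ?case
    by (simp add: hinner_ell2 inner_commute[of "x i" "y i" for i] ell2_app flip: infsum_cnj)
next
  case (5 x)
  then obtain i where i: "x i \<noteq> 0" by (auto simp: fun_eq_iff)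
  then have "0 < (hnorm H (x i))\<^sup>2" using ell2_app[OF 5(1), of i] by simp
  also have "\<dots> \<le> (\<Sum>\<^sub>\<infinity>i. (hnorm H (x i))\<^sup>2)"
    using finite_sum_le_infsum[OF ell2_summable[OF 5(1)], of "{i}"] by simp
  finally show ?case using 5 by (simp add: hinner_ell2_self)
next
  case (6 s)
  then show ?case using ell2_complete[of s] by (auto simp: hconv_def)
next
  case 7
  show ?case by (rule ell2_separable)
qed

end

section \<open>Isometries from Gram matrices\<close>

text \<open>Pairs carry the graph of the operator built in \<open>gram_isometry\<close>; norms are
  taken in each component separately.\<close>

instantiation prod :: (complex_vector, complex_vector) complex_vector
begin
definition scaleC_prod :: "complex \<Rightarrow> 'a \<times> 'b \<Rightarrow> 'a \<times> 'b" where
  "scaleC_prod a p = (a *\<^sub>C fst p, a *\<^sub>C snd p)"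
instance
  by standard (simp_all add: scaleC_prod_def prod_eq_iff scaleC_add_right scaleC_add_left
      scaleC_scaleC scaleC_one)
end

context hilbert_space_pair
begin

lemma isometric_image_hclosed:
  assumes T: "bounded_op H K T" and S: "hclosed H S"
    and iso: "\<And>x. x \<in> S \<Longrightarrow> hnorm K (T x) = hnorm H x"
  shows "hclosed K (T ` S)"
  unfolding hclosed_def
proof (intro conjI allI impI)
  have sub: "complex_vector.subspace S" and SH: "S \<subseteq> hcarrier H"
    using S by (auto simp: hclosed_def)
  note SH' = subsetD[OF SH]
  show "complex_vector.subspace (T ` S)"
  proof (rule complex_vector.subspaceI)
    show "0 \<in> T ` S"
      using bounded_op_zero[OF T] complex_vector.subspace_0[OF sub] by force
    show "x + y \<in> T ` S" if "x \<in> T ` S" "y \<in> T ` S" for x y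
      using that complex_vector.subspace_add[OF sub] bounded_op_add[OF T SH' SH']
      by (auto simp flip: bounded_op_add[OF T SH' SH'])
    show "a *\<^sub>C x \<in> T ` S" if "x \<in> T ` S" for a x
      using that complex_vector.subspace_scale[OF sub]
      by (auto simp flip: bounded_op_scaleC[OF T SH'])
  qed
  show "T ` S \<subseteq> hcarrier K" using bounded_op_mem[OF T] SH by auto
  fix s y assume s: "\<forall>k. s k \<in> T ` S" and y: "y \<in> hcarrier K" "hconv K s y"
  then have "\<forall>k. \<exists>u. u \<in> S \<and> s k = T u" by blast
  then obtain t where t: "\<And>k. t k \<in> S" "\<And>k. s k = T (t k)" by metis
  have tH: "t k \<in> hcarrier H" for k using t SH by auto
  have norm: "hnorm K (s j - s k) = hnorm H (t j - t k)" for j k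
    using iso[of "t j - t k"] t tH complex_vector.subspace_diff[OF sub]
    by (simp add: bounded_op_diff[OF T])
  have sK: "\<And>k. s k \<in> hcarrier K" using t tH T by (simp add: bounded_op_mem)
  obtain x where x: "x \<in> hcarrier H" "hconv H t x"
    using H.complete_hconv[of t] tH K.hconv_Cauchy[OF sK y] by (metis norm)
  have "x \<in> S" using S t(1) x unfolding hclosed_def by blast
  moreover have "hconv K s (T x)"
    using bounded_op_hconv[OF T tH x] t(2) by (simp add: hconv_def)
  then have "T x = y"
    using K.hconv_unique[OF sK _ y(1) _ y(2)] x bounded_op_mem[OF T] by blast
  ultimately show "y \<in> T ` S" by blast
qed

text \<open>Equal Gram matrices, up to the factor \<open>c\<close>, make the norm of a combination
  of the \<open>y i\<close> a function of the same combination of the \<open>x i\<close>. So the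
  closed span of the pairs \<open>(x i, y i)\<close> is a graph, and it is defined everywhere
  because the \<open>x i\<close> are total. The factor is 1 when inner products are to be preserved;
  for the map sending \<open>f\<close> to \<open>f \<otimes> \<eta>\<close> it is the squared norm
  of \<open>\<eta>\<close>.\<close>

lemma gram_isometry:
  fixes c :: real
  assumes x: "htotal H (x ` I)" and y: "y ` I \<subseteq> hcarrier K" and c: "0 \<le> c"
    and gram: "\<And>i j. i \<in> I \<Longrightarrow> j \<in> I \<Longrightarrow> hinner K (y i) (y j) = of_real c * hinner H (x i) (x j)"
  obtains U where "bounded_op H K U" "\<And>i. i \<in> I \<Longrightarrow> U (x i) = y i"
    "\<And>f g. f \<in> hcarrier H \<Longrightarrow> g \<in> hcarrier H \<Longrightarrow> hinner K (U f) (U g) = of_real c * hinner H f g"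
proof -
  define G where "G = complex_vector.span ((\<lambda>i. (x i, y i)) ` I)"
  have xH: "x i \<in> hcarrier H" "y i \<in> hcarrier K" if "i \<in> I" for i
    using x y that by (auto simp: htotal_def)
  have subG: "complex_vector.subspace G" by (simp add: G_def)
  have Gind: "p \<in> G \<Longrightarrow> complex_vector.subspace {p. P p} \<Longrightarrow> (\<And>i. i \<in> I \<Longrightarrow> P (x i, y i)) \<Longrightarrow> P p" for p P
    using complex_vector.span_induct[of p "(\<lambda>i. (x i, y i)) ` I" P] by (auto simp: G_def)
  have GH: "fst p \<in> hcarrier H \<and> snd p \<in> hcarrier K" if "p \<in> G" for p
    using that by (rule Gind) (auto simp: xH scaleC_prod_def intro!: complex_vector.subspaceI)
  have Ggram1: "hinner K (snd p) (y j) = of_real c * hinner H (fst p) (x j)" if "p \<in> G" and j: "j \<in> I" for p j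
  proof -
    have "p \<in> G \<and> hinner K (snd p) (y j) = of_real c * hinner H (fst p) (x j)"
      using that(1)
    proof (rule Gind)
      show "complex_vector.subspace {p. p \<in> G \<and> hinner K (snd p) (y j) = of_real c * hinner H (fst p) (x j)}"
        using xH[OF j] GH complex_vector.subspace_0[OF subG] complex_vector.subspace_add[OF subG]
          complex_vector.subspace_scale[OF subG]
        by (intro complex_vector.subspaceI)
          (auto simp: H.inner_simps K.inner_simps scaleC_prod_def algebra_simps)
    qed (use gram j in \<open>auto simp: G_def intro: complex_vector.span_base\<close>)
    then show ?thesis ..
  qed
  have Ggram: "hinner K (snd p) (snd q) = of_real c * hinner H (fst p) (fst q)" if "p \<in> G" "q \<in> G" for p q
  proof -
    have "q \<in> G \<and> hinner K (snd p) (snd q) = of_real c * hinner H (fst p) (fst q)"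
      using that(2)
    proof (rule Gind)
      show "complex_vector.subspace {q. q \<in> G \<and> hinner K (snd p) (snd q) = of_real c * hinner H (fst p) (fst q)}"
        using GH[OF that(1)] GH complex_vector.subspace_0[OF subG] complex_vector.subspace_add[OF subG]
          complex_vector.subspace_scale[OF subG]
        by (intro complex_vector.subspaceI)
          (auto simp: H.inner_simps K.inner_simps scaleC_prod_def algebra_simps)
    qed (use Ggram1 that in \<open>auto simp: G_def intro: complex_vector.span_base\<close>)
    then show ?thesis ..
  qed
  have Gnorm: "hnorm K (snd p) = sqrt c * hnorm H (fst p)" if "p \<in> G" for p
    using Ggram[OF that that] c by (simp add: hnorm_def real_sqrt_mult)
  \<comment> \<open>The closure of the linear graph \<open>G\<close>. The Gram identity passes to
    limits and makes this relation single-valued; density of the span and completeness of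
    \<open>K\<close> make it total.\<close>
  define R where "R h d \<longleftrightarrow> h \<in> hcarrier H \<and> d \<in> hcarrier K \<and>
    (\<exists>p. (\<forall>k. p k \<in> G) \<and> hconv H (\<lambda>k. fst (p k)) h \<and> hconv K (\<lambda>k. snd (p k)) d)" for h d
  have Rgram: "hinner K d d' = of_real c * hinner H h h'" if hd: "R h d" and hd': "R h' d'" for h d h' d'
  proof -
    obtain p q where p: "\<forall>k. p k \<in> G" "hconv H (\<lambda>k. fst (p k)) h" "hconv K (\<lambda>k. snd (p k)) d"
      and q: "\<forall>k. q k \<in> G" "hconv H (\<lambda>k. fst (q k)) h'" "hconv K (\<lambda>k. snd (q k)) d'"
      using hd hd' unfolding R_def by blast
    have "(\<lambda>k. hinner K (snd (p k)) (snd (q k))) \<longlonglongrightarrow> hinner K d d'"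
      using p q hd hd' GH by (intro K.hconv_inner) (auto simp: R_def)
    moreover have "(\<lambda>k. of_real c * hinner H (fst (p k)) (fst (q k))) \<longlonglongrightarrow> of_real c * hinner H h h'"
      using p q hd hd' GH by (intro tendsto_intros H.hconv_inner) (auto simp: R_def)
    ultimately show ?thesis using p q Ggram by (simp add: LIMSEQ_unique)
  qed
  have Rex: "\<exists>d. R h d" if h: "h \<in> hcarrier H" for h
  proof -
    obtain s where s: "\<And>k. s k \<in> complex_vector.span (x ` I)" "hconv H s h"
      using H.htotal_hconv[OF x h] by blast
    have "\<exists>p\<in>G. fst p = u" if "u \<in> complex_vector.span (x ` I)" for u
      using that
    proof (rule complex_vector.span_induct)
      show "complex_vector.subspace {u. \<exists>p\<in>G. fst p = u}"
      proof (rule complex_vector.subspaceI)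
        show "0 \<in> {u. \<exists>p\<in>G. fst p = u}" using complex_vector.subspace_0[OF subG] by force
        show "u + v \<in> {u. \<exists>p\<in>G. fst p = u}" if "u \<in> {u. \<exists>p\<in>G. fst p = u}" "v \<in> {u. \<exists>p\<in>G. fst p = u}" for u v
          using that complex_vector.subspace_add[OF subG] fst_add by blast
        show "a *\<^sub>C u \<in> {u. \<exists>p\<in>G. fst p = u}" if u: "u \<in> {u. \<exists>p\<in>G. fst p = u}" for a u
        proof -
          obtain p where "p \<in> G" "fst p = u" using u by blast
          then show ?thesis using complex_vector.subspace_scale[OF subG, of p a]
            by (force simp: scaleC_prod_def)
        qed
      qed
    next
      fix u assume "u \<in> x ` I"
      then obtain i where "i \<in> I" "u = x i" by blast
      then show "\<exists>p\<in>G. fst p = u" unfolding G_def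
        by (intro bexI[of _ "(x i, y i)"] complex_vector.span_base) auto
    qed
    then have "\<forall>k. \<exists>p. p \<in> G \<and> fst p = s k" using s(1) by blast
    then obtain p where p: "\<And>k. p k \<in> G" "\<And>k. fst (p k) = s k" by metis
    have sH: "s k \<in> hcarrier H" for k using p GH by metis
    have pK: "snd (p k) \<in> hcarrier K" for k using p GH by metis
    have "\<exists>m. \<forall>j\<ge>m. \<forall>k\<ge>m. hnorm K (snd (p j) - snd (p k)) < e" if "e > 0" for e
    proof -
      \<comment> \<open>The summand 1 covers the case \<open>c = 0\<close>, in which the images all
        vanish.\<close>
      have "e / (1 + sqrt c) > 0" using that c by (simp add: add_pos_nonneg)
      then obtain m where m: "\<forall>j\<ge>m. \<forall>k\<ge>m. hnorm H (s j - s k) < e / (1 + sqrt c)"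
        using H.hconv_Cauchy[OF sH h s(2)] by blast
      have "hnorm K (snd (p j) - snd (p k)) < e" if jk: "j \<ge> m" "k \<ge> m" for j k
      proof -
        have "hnorm K (snd (p j) - snd (p k)) = sqrt c * hnorm H (s j - s k)"
          using Gnorm[OF complex_vector.subspace_diff[OF subG p(1)[of j] p(1)[of k]]] by (simp add: p(2))
        also have "\<dots> \<le> (1 + sqrt c) * hnorm H (s j - s k)"
          using sH by (intro mult_right_mono) auto
        also have "\<dots> < e"
          using m jk c by (simp add: pos_less_divide_eq add_pos_nonneg mult.commute)
        finally show ?thesis .
      qed
      then show ?thesis by blast
    qed
    then obtain d where "d \<in> hcarrier K" "hconv K (\<lambda>k. snd (p k)) d"
      using K.complete_hconv[of "\<lambda>k. snd (p k)"] pK by metis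
    then have "R h d" unfolding R_def using h p s(2) by (intro conjI exI[of _ p]) auto
    then show ?thesis ..
  qed
  have Radd: "R (h + h') (d + d')" if hd: "R h d" and hd': "R h' d'" for h d h' d'
  proof -
    obtain p q where p: "\<forall>k. p k \<in> G" "hconv H (\<lambda>k. fst (p k)) h" "hconv K (\<lambda>k. snd (p k)) d"
      and q: "\<forall>k. q k \<in> G" "hconv H (\<lambda>k. fst (q k)) h'" "hconv K (\<lambda>k. snd (q k)) d'"
      using hd hd' unfolding R_def by blast
    have "hconv H (\<lambda>k. fst (p k + q k)) (h + h')" "hconv K (\<lambda>k. snd (p k + q k)) (d + d')"
      using H.hconv_add[OF _ _ _ _ p(2) q(2)] K.hconv_add[OF _ _ _ _ p(3) q(3)] p(1) q(1) GH hd hd'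
      by (simp_all add: R_def)
    then show ?thesis
      using p(1) q(1) hd hd' complex_vector.subspace_add[OF subG] unfolding R_def
      by (intro conjI exI[of _ "\<lambda>k. p k + q k"]) auto
  qed
  have Rscale: "R (a *\<^sub>C h) (a *\<^sub>C d)" if hd: "R h d" for h d a
  proof -
    obtain p where p: "\<forall>k. p k \<in> G" "hconv H (\<lambda>k. fst (p k)) h" "hconv K (\<lambda>k. snd (p k)) d"
      using hd unfolding R_def by blast
    have "hconv H (\<lambda>k. fst (a *\<^sub>C p k)) (a *\<^sub>C h)" "hconv K (\<lambda>k. snd (a *\<^sub>C p k)) (a *\<^sub>C d)"
      using H.hconv_scaleC[OF _ _ p(2), of a] K.hconv_scaleC[OF _ _ p(3), of a] p(1) GH hd
      by (simp_all add: R_def scaleC_prod_def)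
    then show ?thesis
      using p(1) hd complex_vector.subspace_scale[OF subG] unfolding R_def
      by (intro conjI exI[of _ "\<lambda>k. a *\<^sub>C p k"]) auto
  qed
  have Runique: "d = d'" if "R h d" "R h d'" for h d d'
  proof -
    have K: "d \<in> hcarrier K" "d' \<in> hcarrier K" "h \<in> hcarrier H" using that by (auto simp: R_def)
    have "hinner K (d - d') (d - d') = 0"
      using that K by (simp add: K.inner_simps Rgram[of h _ h])
    then show ?thesis using K K.inner_positive[of "d - d'"] by (cases "d - d' = 0") auto
  qed
  define U where "U h = (SOME d. R h d)" for h
  have U: "R h (U h)" if "h \<in> hcarrier H" for h
    unfolding U_def using Rex[OF that] by (rule someI_ex)
  show thesis
  proof (rule that[of U])
    show gramU: "hinner K (U f) (U g) = of_real c * hinner H f g"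
      if "f \<in> hcarrier H" "g \<in> hcarrier H" for f g
      using Rgram U that by blast
    show "bounded_op H K U"
      unfolding bounded_op_def
    proof (intro conjI ballI allI exI)
      show "U \<in> hcarrier H \<rightarrow> hcarrier K" using U by (auto simp: R_def)
      show "U (f + g) = U f + U g" if "f \<in> hcarrier H" "g \<in> hcarrier H" for f g
        using Runique[OF U Radd[OF U U]] that by simp
      show "U (a *\<^sub>C f) = a *\<^sub>C U f" if "f \<in> hcarrier H" for f a
        using Runique[OF U Rscale[OF U]] that by simp
      show "hnorm K (U f) \<le> sqrt c * hnorm H f" if "f \<in> hcarrier H" for f
        using gramU[OF that that] c by (simp add: hnorm_def real_sqrt_mult)
    qed
    show "U (x i) = y i" if "i \<in> I" for i
    proof (rule Runique[OF U])
      have "(x i, y i) \<in> G" using that by (auto simp: G_def intro: complex_vector.span_base)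
      then show "R (x i) (y i)"
        unfolding R_def using xH[OF that]
        by (intro conjI exI[of _ "\<lambda>_. (x i, y i)"]) (auto simp: hconv_def)
    qed (use xH that in blast)
  qed
qed

text \<open>An isometric image of the whole space is closed. Since it contains the total family
  \<open>y\<close>, its complement is trivial, and so the isometry is onto.\<close>

lemma gram_unitary:
  assumes x: "htotal H (x ` I)" and y: "htotal K (y ` I)"
    and gram: "\<And>i j. i \<in> I \<Longrightarrow> j \<in> I \<Longrightarrow> hinner K (y i) (y j) = hinner H (x i) (x j)"
  obtains U where "unitary_op H K U" "\<And>i. i \<in> I \<Longrightarrow> U (x i) = y i"
proof -
  obtain U where U: "bounded_op H K U" "\<And>i. i \<in> I \<Longrightarrow> U (x i) = y i"
    "\<And>f g. f \<in> hcarrier H \<Longrightarrow> g \<in> hcarrier H \<Longrightarrow> hinner K (U f) (U g) = hinner H f g"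
    using gram_isometry[OF x, of y 1] y gram by (auto simp: htotal_def)
  have whole: "hclosed H (hcarrier H)" using H.subspace_carrier by (simp add: hclosed_def)
  have "hclosed K (U ` hcarrier H)"
    by (rule isometric_image_hclosed[OF U(1) whole]) (simp add: hnorm_def U(3))
  moreover have "hcompl K (U ` hcarrier H) \<subseteq> {0}"
  proof -
    have "y ` I \<subseteq> U ` hcarrier H" using U(2) x by (force simp: htotal_def)
    then have "hcompl K (U ` hcarrier H) \<subseteq> hcompl K (y ` I)" by (auto simp: hcompl_def)
    then show ?thesis using y by (auto simp: htotal_def)
  qed
  ultimately have "U ` hcarrier H = hcarrier K"
    using K.subspace_carrier U(1) by (intro K.hclosed_eqI) (auto intro: bounded_op_mem)
  then show thesis using U by (intro that[of U]) (auto simp: unitary_op_def)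
qed

end

section \<open>Vector-valued Drury--Arveson spaces\<close>

definition da_vec :: "complex ^ 'n::finite \<Rightarrow> 'e::complex_vector \<Rightarrow> complex ^ 'n \<Rightarrow> 'e" where
  "da_vec w \<eta> = (\<lambda>z. if z \<in> unit_ball then da_kernel z w *\<^sub>C \<eta> else 0)"

text \<open>The tensor product with coefficient space \<open>E\<close>, described by kernel vectors
  and the reproducing property instead of elementary tensors. The two descriptions are shown to
  agree below, and afterwards all arguments rest on the properties listed here.\<close>

locale da_space = E: hilbert_space E + D: hilbert_space D
  for E :: "'e::complex_vector hilb" and D :: "(complex ^ 'n::finite \<Rightarrow> 'e) hilb" +
  assumes app_mem: "\<lbrakk>f \<in> hcarrier D; z \<in> unit_ball\<rbrakk> \<Longrightarrow> f z \<in> hcarrier E"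
    and app_off: "\<lbrakk>f \<in> hcarrier D; z \<notin> unit_ball\<rbrakk> \<Longrightarrow> f z = 0"
    and da_vec_mem: "\<lbrakk>w \<in> unit_ball; \<eta> \<in> hcarrier E\<rbrakk> \<Longrightarrow> da_vec w \<eta> \<in> hcarrier D"
    and reproducing: "\<lbrakk>f \<in> hcarrier D; w \<in> unit_ball; \<eta> \<in> hcarrier E\<rbrakk>
      \<Longrightarrow> hinner D f (da_vec w \<eta>) = hinner E (f w) \<eta>"

text \<open>Cauchy-Schwarz is applied to the moduli of the coordinates. A bound on the sum of
  absolute values, rather than on the inner product, is what absolute summability over words
  requires.\<close>

lemma unit_ball_abs_sum:
  fixes z w :: "complex ^ 'n::finite"
  assumes "z \<in> unit_ball" "w \<in> unit_ball"
  shows "(\<Sum>i\<in>UNIV. cmod (z $ i * cnj (w $ i))) < 1"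
proof -
  have "(\<Sum>i\<in>UNIV. cmod (z $ i * cnj (w $ i))) = (\<Sum>i\<in>UNIV. \<bar>cmod (z $ i)\<bar> * \<bar>cmod (w $ i)\<bar>)"
    by (simp add: norm_mult)
  also have "\<dots> \<le> norm z * norm w"
    unfolding norm_vec_def by (rule L2_set_mult_ineq)
  also have "\<dots> < 1"
  proof -
    have "norm z * norm w \<le> norm z * 1" using assms by (intro mult_left_mono) auto
    then show ?thesis using assms by simp
  qed
  finally show ?thesis .
qed

lemma da_kernel_denominator:
  fixes z w :: "complex ^ 'n::finite"
  assumes "z \<in> unit_ball" "w \<in> unit_ball"
  shows "1 - (\<Sum>i\<in>UNIV. z $ i * cnj (w $ i)) \<noteq> 0"
proof
  assume "1 - (\<Sum>i\<in>UNIV. z $ i * cnj (w $ i)) = 0"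
  then have "1 = cmod (\<Sum>i\<in>UNIV. z $ i * cnj (w $ i))" by simp
  also have "\<dots> \<le> (\<Sum>i\<in>UNIV. cmod (z $ i * cnj (w $ i)))" by (rule norm_sum)
  finally show False using unit_ball_abs_sum[OF assms] by simp
qed

lemma da_kernel_zero [simp]: "da_kernel z 0 = 1"
  by (simp add: da_kernel_def)

lemma da_kernel_eq:
  fixes z w :: "complex ^ 'n::finite"
  assumes "z \<in> unit_ball" "w \<in> unit_ball"
  shows "da_kernel z w = 1 + (\<Sum>i\<in>UNIV. z $ i * cnj (w $ i)) * da_kernel z w"
  using da_kernel_denominator[OF assms] by (simp add: da_kernel_def field_simps)

lemma zero_unit_ball [simp]: "0 \<in> unit_ball"
  by simp

context da_space
begin

lemma da_ext:
  assumes "f \<in> hcarrier D" "g \<in> hcarrier D"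
    and "\<And>w \<eta>. w \<in> unit_ball \<Longrightarrow> \<eta> \<in> hcarrier E \<Longrightarrow> hinner E (f w) \<eta> = hinner E (g w) \<eta>"
  shows "f = g"
proof
  fix w
  show "f w = g w"
  proof (cases "w \<in> unit_ball")
    case True
    then show ?thesis using assms app_mem by (intro E.inner_ext_left) auto
  qed (simp add: app_off[OF assms(1)] app_off[OF assms(2)] del: mem_ball_0)
qed

lemma da_vec_total: "htotal D ((\<lambda>(w, \<eta>). da_vec w \<eta>) ` (unit_ball \<times> hcarrier E))"
  unfolding htotal_def
proof (intro conjI subsetI)
  fix f assume f: "f \<in> hcompl D ((\<lambda>(w, \<eta>). da_vec w \<eta>) ` (unit_ball \<times> hcarrier E))"
  then have fD: "f \<in> hcarrier D" by (simp add: hcompl_def)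
  have "f = 0"
  proof (rule da_ext)
    fix w :: "complex ^ 'n" and \<eta> assume *: "w \<in> unit_ball" "\<eta> \<in> hcarrier E"
    then have "hinner D f (da_vec w \<eta>) = 0" using f by (auto simp: hcompl_def)
    then show "hinner E (f w) \<eta> = hinner E (0 w) \<eta>" using * fD by (simp add: reproducing)
  qed (use fD in auto)
  then show "f \<in> {0}" by simp
qed (auto intro: da_vec_mem simp del: mem_ball_0)

lemma da_vec_gram:
  assumes "w \<in> unit_ball" "u \<in> unit_ball" "\<eta> \<in> hcarrier E" "\<zeta> \<in> hcarrier E"
  shows "hinner D (da_vec w \<eta>) (da_vec u \<zeta>) = da_kernel u w * hinner E \<eta> \<zeta>"
proof -
  have "hinner D (da_vec w \<eta>) (da_vec u \<zeta>) = hinner E (da_vec w \<eta> u) \<zeta>"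
    using assms by (intro reproducing da_vec_mem)
  then show ?thesis using assms by (simp add: da_vec_def E.inner_scaleC_left)
qed

text \<open>Pairing \<open>f\<close> with the kernel vector at \<open>z\<close> in the direction
  \<open>f z\<close> yields the squared norm of \<open>f z\<close>; Cauchy-Schwarz and one
  cancellation remain. The constant is the norm of the scalar kernel function at
  \<open>z\<close>.\<close>

lemma eval_bounded:
  assumes z: "z \<in> unit_ball"
  shows "\<exists>C. \<forall>f\<in>hcarrier D. hnorm E (f z) \<le> C * hnorm D f"
proof (intro exI ballI)
  fix f assume f: "f \<in> hcarrier D"
  define C where "C = sqrt (cmod (da_kernel z z))"
  have fz: "f z \<in> hcarrier E" using app_mem f z by blast
  note mem = da_vec_mem[OF z fz]
  have "(hnorm D (da_vec z (f z)))\<^sup>2 = Re (da_kernel z z * of_real ((hnorm E (f z))\<^sup>2))"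
    using mem z fz by (simp only: D.hnorm_sq da_vec_gram E.inner_self)
  also have "\<dots> \<le> cmod (da_kernel z z * of_real ((hnorm E (f z))\<^sup>2))" by (rule complex_Re_le_cmod)
  also have "\<dots> = (C * hnorm E (f z))\<^sup>2" by (simp add: C_def norm_mult power_mult_distrib norm_power)
  finally have 1: "hnorm D (da_vec z (f z)) \<le> C * hnorm E (f z)"
    by (rule power2_le_imp_le) (use fz in \<open>simp add: C_def\<close>)
  have "(hnorm E (f z))\<^sup>2 = cmod (hinner D f (da_vec z (f z)))"
    using f z fz by (simp add: reproducing E.inner_self norm_power)
  also have "\<dots> \<le> hnorm D f * hnorm D (da_vec z (f z))"
    using f mem by (rule D.Cauchy_Schwarz)
  also have "\<dots> \<le> hnorm D f * (C * hnorm E (f z))"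
    using 1 f by (intro mult_left_mono) auto
  finally have *: "hnorm E (f z) * hnorm E (f z) \<le> (C * hnorm D f) * hnorm E (f z)"
    by (simp add: power2_eq_square mult_ac)
  show "hnorm E (f z) \<le> sqrt (cmod (da_kernel z z)) * hnorm D f"
  proof (cases "hnorm E (f z) = 0")
    case False
    then have "0 < hnorm E (f z)" using E.hnorm_nonneg[OF fz] by linarith
    with * show ?thesis unfolding C_def by (rule mult_right_le_imp_le)
  qed (use f in \<open>simp add: C_def\<close>)
qed

end

text \<open>A geometric series in which the words of length \<open>m\<close> contribute the
  \<open>m\<close>-th power of the sum of the \<open>v i\<close>. Summing over words instead of
  multi-indices removes the multinomial coefficients and leaves a recursion on the first
  letter.\<close>

lemma has_sum_words:
  fixes v :: "'n::finite \<Rightarrow> complex"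
  assumes v: "(\<Sum>i\<in>UNIV. cmod (v i)) < 1"
  shows "((\<lambda>u. prod_list (map v u)) has_sum inverse (1 - (\<Sum>i\<in>UNIV. v i))) UNIV"
proof -
  define r where "r = (\<Sum>i\<in>UNIV. cmod (v i))"
  have r: "0 \<le> r" "r < 1" using v by (auto simp: r_def intro: sum_nonneg)
  define p where "p u = prod_list (map v u)" for u
  have finite: "finite {u :: 'n list. length u < m}" for m
    using finite_lists_length_le[of UNIV m] by (rule finite_subset[rotated]) auto
  \<comment> \<open>The bound is the fixed point of \<open>b = 1 + r * b\<close>, the recursion
    obtained by splitting off the first letter.\<close>
  have bound: "(\<Sum>u | length u < m. cmod (p u)) \<le> 1 / (1 - r)" for m
  proof (induction m)
    case 0
    then show ?case using r by simp
  next
    case (Suc m)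
    have eq: "{u :: 'n list. length u < Suc m} = insert [] ((\<lambda>(i, u). i # u) ` (UNIV \<times> {u. length u < m}))"
    proof (rule set_eqI)
      fix u :: "'n list"
      show "u \<in> {u. length u < Suc m} \<longleftrightarrow> u \<in> insert [] ((\<lambda>(i, u). i # u) ` (UNIV \<times> {u. length u < m}))"
        by (cases u) auto
    qed
    have "(\<Sum>u | length u < Suc m. cmod (p u))
        = 1 + (\<Sum>u\<in>(\<lambda>(i, u). i # u) ` (UNIV \<times> {u :: 'n list. length u < m}). cmod (p u))"
      unfolding eq using finite by (subst sum.insert) (auto simp: p_def)
    also have "(\<Sum>u\<in>(\<lambda>(i, u). i # u) ` (UNIV \<times> {u :: 'n list. length u < m}). cmod (p u))
        = (\<Sum>(i, u)\<in>UNIV \<times> {u. length u < m}. cmod (v i) * cmod (p u))"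
      by (subst sum.reindex) (auto simp: inj_on_def p_def norm_mult case_prod_unfold)
    also have "\<dots> = r * (\<Sum>u | length u < m. cmod (p u))"
      by (simp add: r_def sum_product flip: sum.cartesian_product)
    also have "1 + \<dots> \<le> 1 + r * (1 / (1 - r))" using Suc r by (intro add_left_mono mult_left_mono)
    also have "\<dots> = 1 / (1 - r)" using r by (simp add: field_simps)
    finally show ?case .
  qed
  have "(\<lambda>u. norm (p u)) summable_on UNIV"
  proof (rule nonneg_bdd_above_summable_on)
    show "bdd_above (sum (\<lambda>u. norm (p u)) ` {F. F \<subseteq> UNIV \<and> finite F})"
    proof (rule bdd_aboveI2)
      fix F :: "'n list set" assume "F \<in> {F. F \<subseteq> UNIV \<and> finite F}"
      then have F: "finite F" by simp
      define m where "m = Suc (\<Sum>u\<in>F. length u)"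
      have "F \<subseteq> {u. length u < m}"
        using F by (auto simp: m_def less_Suc_eq_le intro: member_le_sum)
      then have "(\<Sum>u\<in>F. norm (p u)) \<le> (\<Sum>u | length u < m. norm (p u))"
        using finite by (intro sum_mono2) auto
      then show "(\<Sum>u\<in>F. norm (p u)) \<le> 1 / (1 - r)" using bound[of m] by linarith
    qed
  qed auto
  then have "p summable_on UNIV" by (rule Infinite_Sum.abs_summable_summable)
  then have summable: "p summable_on A" for A by (rule summable_on_subset_banach) simp
  define S where "S = infsum p UNIV"
  \<comment> \<open>A word is empty or begins with a unique letter, so the total \<open>S\<close>
    satisfies \<open>S = 1 + (\<Sum>i. v i) * S\<close>, which determines it.\<close>
  have UNIV_eq: "(UNIV :: 'n list set) = insert [] (\<Union>i. range (Cons i))"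
    by (auto simp: set_eq_iff image_iff) (metis list.exhaust)
  have "S = infsum p (insert [] (\<Union>i. range (Cons i)))"
    unfolding S_def using UNIV_eq by simp
  also have "\<dots> = p [] + infsum p (\<Union>i. range (Cons i))"
    using summable by (intro infsum_insert) auto
  also have "infsum p (\<Union>i. range (Cons i)) = (\<Sum>i\<in>UNIV. infsum p (range (Cons i)))"
    using summable by (intro sum_infsum[symmetric]) auto
  also have "\<dots> = (\<Sum>i\<in>UNIV. v i * S)"
  proof (rule sum.cong)
    fix i
    have "infsum p (range (Cons i)) = (\<Sum>\<^sub>\<infinity>u. v i * p u)"
      by (subst infsum_reindex) (auto simp: o_def p_def)
    then show "infsum p (range (Cons i)) = v i * S"
      by (simp add: S_def infsum_cmult_right')
  qed simp
  finally have "S * (1 - (\<Sum>i\<in>UNIV. v i)) = 1"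
    by (simp add: p_def algebra_simps sum_distrib_left)
  then have "S = inverse (1 - (\<Sum>i\<in>UNIV. v i))"
    by (metis inverse_unique mult.commute)
  then have "(p has_sum inverse (1 - (\<Sum>i\<in>UNIV. v i))) UNIV"
    using summable[of UNIV] by (simp add: S_def has_sum_iff)
  then show ?thesis unfolding p_def[abs_def] .
qed

lemma hilbert_space_image:
  assumes L: "hilbert_space L" and inj: "inj_on T (hcarrier L)"
    and add: "\<And>x y. x \<in> hcarrier L \<Longrightarrow> y \<in> hcarrier L \<Longrightarrow> T (x + y) = T x + T y"
    and scale: "\<And>a x. x \<in> hcarrier L \<Longrightarrow> T (a *\<^sub>C x) = a *\<^sub>C T x"
    and H: "hcarrier H = T ` hcarrier L"
    and inner: "\<And>x y. x \<in> hcarrier L \<Longrightarrow> y \<in> hcarrier L \<Longrightarrow> hinner H (T x) (T y) = hinner L x y"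
  shows "hilbert_space H"
proof -
  interpret L: hilbert_space L by fact
  have zero: "T 0 = 0" using scale[of 0 0] by simp
  have diff: "T (x - y) = T x - T y" if "x \<in> hcarrier L" "y \<in> hcarrier L" for x y
    using add[of "x - y" y] that by simp
  have norm: "hnorm H (T x) = hnorm L x" if "x \<in> hcarrier L" for x
    using that by (simp add: hnorm_def inner)
  show ?thesis
  proof (unfold_locales, goal_cases)
    case 1
    show ?case
    proof (rule complex_vector.subspaceI)
      show "0 \<in> hcarrier H" using zero L.zero_mem unfolding H by (metis imageI)
      show "x + y \<in> hcarrier H" if "x \<in> hcarrier H" "y \<in> hcarrier H" for x y
        using that L.add_mem add unfolding H by (smt (verit) image_iff)
      show "a *\<^sub>C x \<in> hcarrier H" if "x \<in> hcarrier H" for a x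
        using that L.scaleC_mem scale unfolding H by (smt (verit) image_iff)
    qed
  next
    case (2 x y z)
    then show ?case by (auto simp: H inner L.inner_simps simp flip: add)
  next
    case (3 x y a)
    then show ?case by (auto simp: H inner L.inner_simps simp flip: scale)
  next
    case (4 x y)
    then show ?case by (auto simp: H inner intro: L.inner_commute)
  next
    case (5 x)
    then show ?case using zero by (auto simp: H inner intro!: L.inner_positive)
  next
    case (6 s)
    then have "\<forall>k. \<exists>u. u \<in> hcarrier L \<and> s k = T u" unfolding H by blast
    then obtain t where t: "\<And>k. t k \<in> hcarrier L" "\<And>k. s k = T (t k)" by metis
    have "hnorm H (s j - s k) = hnorm L (t j - t k)" for j k
      using norm[of "t j - t k"] t by (simp add: diff)
    then obtain x where x: "x \<in> hcarrier L" "hconv L t x"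
      using L.complete_hconv[of t] t(1) 6(2) by (simp add: t(2)) metis
    show ?case
      using x t norm[of "t k - x" for k] by (intro bexI[of _ "T x"]) (auto simp: H diff hconv_def)
  next
    case 7
    obtain S where S: "countable S" "S \<subseteq> hcarrier L"
      "\<forall>x\<in>hcarrier L. \<forall>e>0. \<exists>d\<in>S. hnorm L (x - d) < e"
      using L.separable by (elim exE conjE)
    have "\<exists>d\<in>T ` S. hnorm H (T x - d) < e" if xe: "x \<in> hcarrier L" "e > 0" for x e
    proof -
      obtain d where d: "d \<in> S" "hnorm L (x - d) < e" using S(3) xe by blast
      then have "hnorm H (T x - T d) < e"
        using norm[of "x - d"] diff[of x d] xe S(2) by auto
      then show ?thesis using d by blast
    qed
    then show ?case using S by (intro exI[of _ "T ` S"]) (auto simp: H)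
  qed
qed

text \<open>A family of operators \<open>R z\<close> from \<open>E\<close> to some Hilbert space factorises the kernel; the space
  is realised as the functions \<open>z \<mapsto> R z\<^sup>* c\<close>, with \<open>c\<close> orthogonal to the kernel of this map.\<close>

lemma (in hilbert_space_pair) da_space_ex_of_features:
  fixes R :: "complex ^ 'n::finite \<Rightarrow> 'a \<Rightarrow> 'b"
  assumes R: "\<And>z. z \<in> unit_ball \<Longrightarrow> bounded_op H K (R z)"
    and gram: "\<And>z w \<eta> \<zeta>. \<lbrakk>z \<in> unit_ball; w \<in> unit_ball; \<eta> \<in> hcarrier H; \<zeta> \<in> hcarrier H\<rbrakk>
      \<Longrightarrow> hinner K (R w \<eta>) (R z \<zeta>) = da_kernel z w * hinner H \<eta> \<zeta>"
  shows "\<exists>D :: (complex ^ 'n \<Rightarrow> 'a) hilb. da_space H D"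
proof -
  define S where "S = {R z \<eta> | z \<eta>. z \<in> unit_ball \<and> \<eta> \<in> hcarrier H}"
  have SK: "S \<subseteq> hcarrier K" using bounded_op_mem[OF R] by (auto simp: S_def simp del: mem_ball_0)
  \<comment> \<open>The closed span of the features. A vector orthogonal to \<open>S\<close> is sent
    by \<open>T\<close> to the zero function, so restricting to \<open>C\<close> is what makes
    \<open>T\<close> injective.\<close>
  define C where "C = hcompl K (hcompl K S)"
  have CK: "C \<subseteq> hcarrier K" by (auto simp: C_def hcompl_def)
  have C: "hclosed K C" unfolding C_def by (rule K.hclosed_hcompl) (auto simp: hcompl_def)
  have SC: "S \<subseteq> C" unfolding C_def using SK by (rule K.hcompl_hcompl_subset)
  have subC: "complex_vector.subspace C" using C by (simp add: hclosed_def)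
  define T where "T c = (\<lambda>z. if z \<in> unit_ball then hadjoint H K (R z) c else 0)" for c
  have adj_mem: "hadjoint H K (R z) c \<in> hcarrier H" if "c \<in> hcarrier K" "z \<in> unit_ball" for c z
    using hadjoint_mem[OF R] that by blast
  have adj: "hinner H (hadjoint H K (R z) c) \<eta> = hinner K c (R z \<eta>)"
    if "c \<in> hcarrier K" "z \<in> unit_ball" "\<eta> \<in> hcarrier H" for c z \<eta>
    using hadjoint_left[OF R] that by blast
  have RK: "R z \<eta> \<in> hcarrier K" if "z \<in> unit_ball" "\<eta> \<in> hcarrier H" for z \<eta>
    using bounded_op_mem[OF R] that by blast
  have add: "T (c + d) = T c + T d" if cd: "c \<in> hcarrier K" "d \<in> hcarrier K" for c d
  proof
    fix z show "T (c + d) z = (T c + T d) z"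
    proof (cases "z \<in> unit_ball")
      case True
      have "hadjoint H K (R z) (c + d) = hadjoint H K (R z) c + hadjoint H K (R z) d"
        by (rule hadjoint_eqI[OF R[OF True]])
          (use cd True in \<open>simp_all add: adj_mem adj RK H.inner_add_left K.inner_add_left del: mem_ball_0\<close>)
      then show ?thesis using True by (simp add: T_def)
    qed (simp add: T_def)
  qed
  have scale: "T (a *\<^sub>C c) = a *\<^sub>C T c" if c: "c \<in> hcarrier K" for a c
  proof
    fix z show "T (a *\<^sub>C c) z = (a *\<^sub>C T c) z"
    proof (cases "z \<in> unit_ball")
      case True
      have "hadjoint H K (R z) (a *\<^sub>C c) = a *\<^sub>C hadjoint H K (R z) c"
        by (rule hadjoint_eqI[OF R[OF True]])
          (use c True in \<open>simp_all add: adj_mem adj RK H.inner_scaleC_left K.inner_scaleC_left del: mem_ball_0\<close>)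
      then show ?thesis using True by (simp add: T_def scaleC_fun_def)
    qed (simp add: T_def scaleC_fun_def)
  qed
  \<comment> \<open>By the Gram identity the adjoint of \<open>R z\<close> sends the feature
    \<open>R w \<eta>\<close> to \<open>da_kernel z w *\<^sub>C \<eta>\<close>: features become
    kernel vectors.\<close>
  have T_vec: "T (R w \<eta>) = da_vec w \<eta>" if w: "w \<in> unit_ball" "\<eta> \<in> hcarrier H" for w \<eta>
  proof
    fix z show "T (R w \<eta>) z = da_vec w \<eta> z"
    proof (cases "z \<in> unit_ball")
      case True
      have "hadjoint H K (R z) (R w \<eta>) = da_kernel z w *\<^sub>C \<eta>"
        by (rule hadjoint_eqI[OF R[OF True]])
          (use w True in \<open>simp_all add: RK gram H.inner_scaleC_left del: mem_ball_0\<close>)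
      then show ?thesis using True by (simp add: T_def da_vec_def)
    qed (simp add: T_def da_vec_def)
  qed
  have inj: "inj_on T C"
  proof (rule inj_onI)
    fix c d assume cd: "c \<in> C" "d \<in> C" "T c = T d"
    have mem: "c \<in> hcarrier K" "d \<in> hcarrier K" using cd CK by auto
    have "hinner K (c - d) (R z \<eta>) = 0" if z: "z \<in> unit_ball" "\<eta> \<in> hcarrier H" for z \<eta>
    proof -
      have "hadjoint H K (R z) c = hadjoint H K (R z) d"
        using fun_cong[OF cd(3), of z] z by (simp add: T_def)
      then have "hinner K c (R z \<eta>) = hinner K d (R z \<eta>)"
        using adj[OF mem(1) z] adj[OF mem(2) z] by simp
      then show ?thesis using mem RK[OF z] by (simp add: K.inner_diff_left)
    qed
    then have "c - d \<in> hcompl K S" using mem by (auto simp: hcompl_def S_def)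
    moreover have "c - d \<in> hcompl K (hcompl K S)"
      using complex_vector.subspace_diff[OF subC cd(1,2)] by (simp add: C_def)
    ultimately have "c - d = 0" by (rule K.hcompl_inter)
    then show "c = d" by simp
  qed
  define D where "D = \<lparr>hcarrier = T ` C, hinner = (\<lambda>f g. hinner K (inv_into C T f) (inv_into C T g))\<rparr>"
  have inner: "hinner D (T c) (T d) = hinner K c d" if "c \<in> C" "d \<in> C" for c d
    using that inj by (simp add: D_def)
  have HD: "hilbert_space D"
    by (rule hilbert_space_image[OF K.hilbert_space_subhilb[OF C], of T])
      (use inj add scale CK inner in \<open>auto simp: D_def subset_iff\<close>)
  interpret D: hilbert_space D by fact
  have "da_space H D"
  proof (unfold_locales, goal_cases)
    case (1 f z)
    then show ?case using CK by (auto simp: D_def T_def intro!: adj_mem)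
  next
    case (2 f z)
    then show ?case by (auto simp: D_def T_def)
  next
    case (3 w \<eta>)
    then have "R w \<eta> \<in> C" using SC by (auto simp: S_def)
    then show ?case using T_vec[OF 3] by (auto simp: D_def intro: rev_image_eqI)
  next
    case (4 f w \<eta>)
    then obtain c where c: "c \<in> C" "f = T c" by (auto simp: D_def)
    have RC: "R w \<eta> \<in> C" using 4 SC by (auto simp: S_def)
    have "hinner D f (da_vec w \<eta>) = hinner K c (R w \<eta>)"
      using inner[OF c(1) RC] T_vec[OF 4(2,3)] c(2) by simp
    also have "\<dots> = hinner H (f w) \<eta>"
      using adj[of c w \<eta>] 4 c CK by (auto simp: T_def)
    finally show ?case .
  qed
  then show ?thesis by blast
qed

text \<open>The feature of \<open>z\<close> lists all noncommutative monomials in its coordinates,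
  and \<open>has_sum_words\<close> evaluates the Gram matrix to the kernel. Words over a finite
  alphabet are countable, which keeps the space of families separable.\<close>

lemma (in hilbert_space) da_space_ex:
  "\<exists>D :: (complex ^ 'n::finite \<Rightarrow> 'a) hilb. da_space H D"
proof -
  let ?L = "ell2 H :: ('n list \<Rightarrow> 'a) hilb"
  interpret L: hilbert_space ?L by (rule hilbert_space_ell2)
  interpret HL: hilbert_space_pair H ?L by unfold_locales
  define p :: "complex ^ 'n \<Rightarrow> 'n list \<Rightarrow> complex" where "p z u = prod_list (map (($) z) u)" for z u
  have pp: "p z u * cnj (p w u) = prod_list (map (\<lambda>i. z $ i * cnj (w $ i)) u)" for z w u
    by (induction u) (simp_all add: p_def)
  have psum: "((\<lambda>u. p z u * cnj (p w u)) has_sum da_kernel z w) UNIV"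
    if "z \<in> unit_ball" "w \<in> unit_ball" for z w
    unfolding pp da_kernel_def by (rule has_sum_words[OF unit_ball_abs_sum[OF that]])
  \<comment> \<open>The monomials are conjugated because the inner product is linear in its first
    argument, whereas the kernel has to depend holomorphically on the point that enters through the
    second.\<close>
  define R :: "complex ^ 'n \<Rightarrow> 'a \<Rightarrow> 'n list \<Rightarrow> 'a" where "R z \<eta> = (\<lambda>u. cnj (p z u) *\<^sub>C \<eta>)" for z \<eta>
  have mem: "R z \<eta> \<in> hcarrier ?L" if z: "z \<in> unit_ball" and \<eta>: "\<eta> \<in> hcarrier H" for z \<eta>
  proof -
    have "(\<lambda>u. Re (p z u * cnj (p z u))) summable_on UNIV"
      using psum[OF z z] by (intro summable_on_Re) (simp add: has_sum_iff)
    then have "(\<lambda>u. (cmod (p z u))\<^sup>2 * (hnorm H \<eta>)\<^sup>2) summable_on UNIV"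
      by (intro summable_on_cmult_left) (simp add: complex_norm_square[symmetric] flip: of_real_power)
    then show ?thesis
      using \<eta> by (simp add: ell2_def R_def hnorm_scaleC power_mult_distrib)
  qed
  have gram: "hinner ?L (R w \<eta>) (R z \<zeta>) = da_kernel z w * hinner H \<eta> \<zeta>"
    if "z \<in> unit_ball" "w \<in> unit_ball" "\<eta> \<in> hcarrier H" "\<zeta> \<in> hcarrier H" for z w \<eta> \<zeta>
  proof -
    have "((\<lambda>u. p z u * cnj (p w u) * hinner H \<eta> \<zeta>) has_sum da_kernel z w * hinner H \<eta> \<zeta>) UNIV"
      by (rule has_sum_cmult_left[OF psum[OF that(1,2)]])
    then show ?thesis
      unfolding hinner_ell2 using that by (intro infsumI) (simp add: R_def inner_simps mult_ac)
  qed
  show ?thesis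
  proof (rule HL.da_space_ex_of_features[OF _ gram])
    fix z :: "complex ^ 'n" assume z: "z \<in> unit_ball"
    have "hnorm ?L (R z \<eta>) \<le> sqrt (Re (da_kernel z z)) * hnorm H \<eta>" if \<eta>: "\<eta> \<in> hcarrier H" for \<eta>
      using gram[OF z z \<eta> \<eta>] \<eta> by (simp add: hnorm_def[of ?L] inner_self real_sqrt_mult flip: of_real_power)
    moreover have "R z (\<eta> + \<zeta>) = R z \<eta> + R z \<zeta>" "R z (a *\<^sub>C \<eta>) = a *\<^sub>C R z \<eta>" for \<eta> \<zeta> a
      by (simp_all add: R_def scaleC_add_right scaleC_scaleC scaleC_fun_def fun_eq_iff mult.commute)
    ultimately show "bounded_op H ?L (R z)"
      unfolding bounded_op_def using mem[OF z] by blast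
  qed auto
qed

section \<open>The Drury--Arveson module and its tensor products\<close>

text \<open>With scalar coefficients the kernel vector in direction 1 is the kernel function itself,
  so a \<open>da_space\<close> over this space is a witness for the choice in
  \<open>drury_arveson\<close>.\<close>

definition complex_hilb :: "complex hilb" where
  "complex_hilb = \<lparr>hcarrier = UNIV, hinner = (\<lambda>x y. x * cnj y)\<rparr>"

lemma complex_hilb_simps [simp]:
  "hcarrier complex_hilb = UNIV" "hinner complex_hilb x y = x * cnj y"
  "hnorm complex_hilb x = cmod x"
  by (simp_all add: complex_hilb_def hnorm_def cmod_def power2_eq_square)

lemma hilbert_space_complex: "hilbert_space complex_hilb"
proof (unfold_locales, goal_cases)
  case 1
  show ?case by (simp add: complex_vector.subspace_UNIV)
next
  case (5 x)
  then show ?case by (simp add: complex_eq_iff sum_squares_gt_zero_iff)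
next
  case (6 s)
  then have "Cauchy s" by (auto simp: Cauchy_def dist_norm)
  then obtain x where "s \<longlonglongrightarrow> x" using Cauchy_convergent convergent_def by blast
  then show ?case by (auto simp: tendsto_norm_zero_iff LIM_zero_iff)
next
  case 7
  obtain S :: "complex set" where "countable S"
    "\<And>X. open X \<Longrightarrow> X \<noteq> {} \<Longrightarrow> \<exists>d\<in>S. d \<in> X"
    using countable_dense_exists by blast
  then have "\<exists>d\<in>S. cmod (x - d) < e" if "e > 0" for x e
    using that by (metis centre_in_ball dist_norm empty_iff mem_ball open_ball)
  then show ?case using \<open>countable S\<close> by auto
qed (simp_all add: scaleC_complex_def algebra_simps)

lemma is_rkhs_drury_arveson:
  "is_rkhs unit_ball da_kernel (drury_arveson :: (complex ^ 'n::finite \<Rightarrow> complex) hilb)"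
proof -
  interpret hilbert_space complex_hilb by (rule hilbert_space_complex)
  obtain A :: "(complex ^ 'n \<Rightarrow> complex) hilb" where "da_space complex_hilb A"
    using da_space_ex by blast
  then interpret A: da_space complex_hilb A .
  have eq: "da_vec w 1 = (\<lambda>z. if z \<in> unit_ball then da_kernel z w else 0)" for w :: "complex ^ 'n"
    by (simp add: da_vec_def scaleC_complex_def fun_eq_iff)
  have "is_rkhs unit_ball da_kernel A"
    unfolding is_rkhs_def Let_def eq[symmetric]
    using A.D.hilbert_space_axioms A.app_off A.da_vec_mem[of _ 1] A.reproducing[of _ _ 1] by simp
  then show ?thesis unfolding drury_arveson_def by (rule someI)
qed

text \<open>Only tensors of kernel functions are known to lie in \<open>D\<close> at the outset. The
  map from \<open>k w\<close> to \<open>da_vec w \<eta>\<close> scales the Gram matrix by the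
  squared norm of \<open>\<eta>\<close>, so it extends to all of \<open>A\<close>; the work is to
  see that the extension is pointwise multiplication by \<open>\<eta>\<close>.\<close>

lemma (in da_space) is_function_tensor:
  assumes A: "is_rkhs unit_ball da_kernel A"
  shows "is_function_tensor unit_ball A E D"
proof -
  interpret A: hilbert_space A using A by (simp add: is_rkhs_def)
  interpret AD: hilbert_space_pair A D by unfold_locales
  define k :: "complex ^ 'n \<Rightarrow> complex ^ 'n \<Rightarrow> complex"
    where "k w = (\<lambda>z. if z \<in> unit_ball then da_kernel z w else 0)" for w
  have k: "k w \<in> hcarrier A" "f \<in> hcarrier A \<Longrightarrow> hinner A f (k w) = f w" if "w \<in> unit_ball" for f w
    using A that by (auto simp: is_rkhs_def Let_def k_def)
  have off: "f z = 0" if "f \<in> hcarrier A" "z \<notin> unit_ball" for f z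
    using A that by (auto simp: is_rkhs_def)
  have tot: "htotal A (k ` unit_ball)"
    unfolding htotal_def
  proof (intro conjI subsetI)
    fix f assume f: "f \<in> hcompl A (k ` unit_ball)"
    then have fA: "f \<in> hcarrier A" by (simp add: hcompl_def)
    have "f z = 0" for z
    proof (cases "z \<in> unit_ball")
      case True
      then have "hinner A f (k z) = 0" using f by (auto simp: hcompl_def)
      then show ?thesis using k[OF True] fA by simp
    qed (use off fA in blast)
    then show "f \<in> {0}" by auto
  qed (use k in blast)
  have elem_k: "elem_tensor (k w) \<eta> = da_vec w \<eta>" for w \<eta>
    by (auto simp: elem_tensor_def k_def da_vec_def fun_eq_iff)
  have ex: "\<exists>U. bounded_op A D U \<and> (\<forall>f\<in>hcarrier A. U f = elem_tensor f \<eta>)"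
    if \<eta>: "\<eta> \<in> hcarrier E" for \<eta>
  proof -
    obtain U where U: "bounded_op A D U" "\<And>w. w \<in> unit_ball \<Longrightarrow> U (k w) = da_vec w \<eta>"
    proof (rule AD.gram_isometry[OF tot, of "\<lambda>w. da_vec w \<eta>" "(hnorm E \<eta>)\<^sup>2"])
      fix w u :: "complex ^ 'n" assume "w \<in> unit_ball" "u \<in> unit_ball"
      then show "hinner D (da_vec w \<eta>) (da_vec u \<eta>) = complex_of_real ((hnorm E \<eta>)\<^sup>2) * hinner A (k w) (k u)"
        using \<eta> k(2)[of u "k w"] k(1)[of w] by (simp add: da_vec_gram E.inner_self) (simp add: k_def)
    qed (use da_vec_mem \<eta> in auto)
    have "U f = elem_tensor f \<eta>" if f: "f \<in> hcarrier A" for f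
    proof
      fix z show "U f z = elem_tensor f \<eta> z"
      proof (cases "z \<in> unit_ball")
        case True
        show ?thesis
        proof (rule E.inner_ext_left)
          show "U f z \<in> hcarrier E" using app_mem bounded_op_mem[OF U(1) f] True by blast
          show "elem_tensor f \<eta> z \<in> hcarrier E" using \<eta> by (simp add: elem_tensor_def)
          fix \<zeta> assume \<zeta>: "\<zeta> \<in> hcarrier E"
          note v = da_vec_mem[OF True \<zeta>]
          \<comment> \<open>Comparing with kernel functions identifies the adjoint on kernel
            vectors. Pairing it with \<open>f\<close> and reproducing on both sides then gives the
            value of \<open>U f\<close> at \<open>z\<close>, tested against
            \<open>\<zeta>\<close>.\<close>
          have "hadjoint A D U (da_vec z \<zeta>) = cnj (hinner E \<eta> \<zeta>) *\<^sub>C k z"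
          proof (rule A.htotal_ext[OF tot])
            fix s assume "s \<in> k ` unit_ball"
            then obtain w where w: "w \<in> unit_ball" "s = k w" by blast
            have "hinner D (U s) (da_vec z \<zeta>) = da_kernel z w * hinner E \<eta> \<zeta>"
              using w U(2) True \<eta> \<zeta> by (simp add: da_vec_gram)
            then have "hinner D (da_vec z \<zeta>) (U s) = cnj (da_kernel z w * hinner E \<eta> \<zeta>)"
              using D.inner_commute[of "U s" "da_vec z \<zeta>"] v bounded_op_mem[OF U(1)] w k by simp
            moreover have "hinner A (k z) s = cnj (da_kernel z w)"
            proof -
              have "hinner A s (k z) = da_kernel z w"
                using k(2)[OF True k(1)[OF w(1)]] w True by (simp add: k_def)
              then show ?thesis using A.inner_commute[of s "k z"] k(1) w True by simp
            qed
            ultimately show "hinner A (hadjoint A D U (da_vec z \<zeta>)) s = hinner A (cnj (hinner E \<eta> \<zeta>) *\<^sub>C k z) s"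
              using AD.hadjoint_left[OF U(1) v, of s] k w True
              by (simp add: A.inner_scaleC_left scaleC_fun_apply scaleC_complex_def)
          qed (use AD.hadjoint_mem[OF U(1) v] k(1)[OF True] in auto)
          then have "hinner D (U f) (da_vec z \<zeta>) = hinner E \<eta> \<zeta> * f z"
            using AD.hadjoint_right[OF U(1) v f] f k[OF True] by (simp add: A.inner_scaleC_right)
          then show "hinner E (U f z) \<zeta> = hinner E (elem_tensor f \<eta> z) \<zeta>"
            using reproducing[OF bounded_op_mem[OF U(1) f] True \<zeta>] \<eta> \<zeta>
            by (simp add: elem_tensor_def E.inner_scaleC_left)
        qed
      qed (use app_off[OF bounded_op_mem[OF U(1) f]] off[OF f] in \<open>simp add: elem_tensor_def\<close>)
    qed
    then show ?thesis using U(1) by blast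
  qed
  have mem: "elem_tensor f \<eta> \<in> hcarrier D" if "f \<in> hcarrier A" "\<eta> \<in> hcarrier E" for f \<eta>
    using ex[OF that(2)] bounded_op_mem that(1) by metis
  have inner: "hinner D (elem_tensor f \<eta>) (elem_tensor g \<zeta>) = hinner A f g * hinner E \<eta> \<zeta>"
    if f: "f \<in> hcarrier A" and g: "g \<in> hcarrier A" and \<eta>: "\<eta> \<in> hcarrier E" and \<zeta>: "\<zeta> \<in> hcarrier E"
    for f g \<eta> \<zeta>
  proof -
    obtain U where U: "bounded_op A D U" "\<And>f. f \<in> hcarrier A \<Longrightarrow> U f = elem_tensor f \<zeta>"
      using ex[OF \<zeta>] by blast
    note fm = mem[OF f \<eta>]
    \<comment> \<open>The adjoint of tensoring with \<open>\<zeta>\<close> contracts the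
      coefficient; this is the product formula for inner products, verified on kernel functions
      only.\<close>
    have "hadjoint A D U (elem_tensor f \<eta>) = hinner E \<eta> \<zeta> *\<^sub>C f"
    proof (rule A.htotal_ext[OF tot])
      fix s assume "s \<in> k ` unit_ball"
      then obtain w where w: "w \<in> unit_ball" "s = k w" by blast
      have "U s = da_vec w \<zeta>" using U(2)[OF k(1)[OF w(1)]] w(2) by (simp add: elem_k)
      moreover have "hinner D (elem_tensor f \<eta>) (da_vec w \<zeta>) = hinner E (f w *\<^sub>C \<eta>) \<zeta>"
        using reproducing[OF fm w(1) \<zeta>] by (simp add: elem_tensor_def)
      ultimately have "hinner D (elem_tensor f \<eta>) (U s) = hinner E \<eta> \<zeta> * f w"
        using \<eta> \<zeta> by (simp add: E.inner_scaleC_left)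
      then show "hinner A (hadjoint A D U (elem_tensor f \<eta>)) s = hinner A (hinner E \<eta> \<zeta> *\<^sub>C f) s"
        using AD.hadjoint_left[OF U(1) fm, of s] k w f
        by (simp add: A.inner_scaleC_left scaleC_fun_apply scaleC_complex_def)
    qed (use AD.hadjoint_mem[OF U(1) fm] f in auto)
    then show ?thesis
      using AD.hadjoint_left[OF U(1) fm g] U(2)[OF g] f g by (simp add: A.inner_scaleC_left mult.commute)
  qed
  let ?S = "{elem_tensor h \<eta> | h \<eta>. h \<in> hcarrier A \<and> \<eta> \<in> hcarrier E}"
  have "da_vec w \<eta> \<in> ?S" if "w \<in> unit_ball" "\<eta> \<in> hcarrier E" for w \<eta>
    using k(1) that unfolding elem_k[symmetric] by blast
  then have "p \<in> unit_ball \<times> hcarrier E \<Longrightarrow> (case p of (w, \<eta>) \<Rightarrow> da_vec w \<eta>) \<in> ?S" for p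
    by (cases p) (auto simp del: mem_ball_0 mem_Collect_eq)
  then have "(\<lambda>(w, \<eta>). da_vec w \<eta>) ` (unit_ball \<times> hcarrier E) \<subseteq> ?S"
    by (rule image_subsetI)
  moreover have "?S \<subseteq> hcarrier D" using mem by auto
  ultimately have dense: "htotal D ?S" by (rule htotal_mono[OF da_vec_total])
  show ?thesis
    unfolding is_function_tensor_def
    using D.hilbert_space_axioms app_mem app_off mem inner eval_bounded D.htotal_dense[OF dense]
    by (intro conjI ballI allI impI) simp_all
qed

text \<open>The reproducing identity is immediate for elementary tensors and linear, hence valid on
  their span. It survives limits because bounded point evaluations turn norm convergence in
  \<open>D\<close> into convergence of the values at \<open>w\<close>.\<close>

lemma da_space_of_function_tensor:
  fixes D :: "(complex ^ 'n::finite \<Rightarrow> 'e::complex_vector) hilb"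
  assumes A: "is_rkhs unit_ball da_kernel A" and E: "hilbert_space E"
    and D: "is_function_tensor unit_ball A E D"
  shows "da_space E D"
proof -
  interpret A: hilbert_space A using A by (simp add: is_rkhs_def)
  interpret E: hilbert_space E by fact
  interpret D: hilbert_space D using D by (simp add: is_function_tensor_def)
  have app: "f z \<in> hcarrier E" if "f \<in> hcarrier D" "z \<in> unit_ball" for f z
    using D that by (simp add: is_function_tensor_def)
  have elem: "elem_tensor f \<eta> \<in> hcarrier D" if "f \<in> hcarrier A" "\<eta> \<in> hcarrier E" for f \<eta>
    using D that by (simp add: is_function_tensor_def)
  have inner: "hinner D (elem_tensor f \<eta>) (elem_tensor g \<zeta>) = hinner A f g * hinner E \<eta> \<zeta>"
    if "f \<in> hcarrier A" "g \<in> hcarrier A" "\<eta> \<in> hcarrier E" "\<zeta> \<in> hcarrier E" for f g \<eta> \<zeta>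
    using D that by (simp add: is_function_tensor_def)
  let ?S = "{elem_tensor h \<eta> | h \<eta>. h \<in> hcarrier A \<and> \<eta> \<in> hcarrier E}"
  have SD: "?S \<subseteq> hcarrier D" using elem by auto
  define k :: "complex ^ 'n \<Rightarrow> complex ^ 'n \<Rightarrow> complex"
    where "k w = (\<lambda>z. if z \<in> unit_ball then da_kernel z w else 0)" for w
  have k: "k w \<in> hcarrier A" "f \<in> hcarrier A \<Longrightarrow> hinner A f (k w) = f w" if "w \<in> unit_ball" for f w
    using A that by (auto simp: is_rkhs_def Let_def k_def)
  have elem_k: "elem_tensor (k w) \<eta> = da_vec w \<eta>" for w \<eta>
    by (auto simp: elem_tensor_def k_def da_vec_def fun_eq_iff)
  have vec: "da_vec w \<eta> \<in> hcarrier D" if "w \<in> unit_ball" "\<eta> \<in> hcarrier E" for w \<eta>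
    using elem k(1) that unfolding elem_k[symmetric] by blast
  show ?thesis
  proof (unfold_locales, goal_cases)
    case (1 f z)
    then show ?case by (rule app)
  next
    case (2 f z)
    then show ?case using D by (simp add: is_function_tensor_def)
  next
    case (3 w \<eta>)
    then show ?case by (rule vec)
  next
    case (4 f w \<eta>)
    note v = vec[OF 4(2,3)]
    have span: "g \<in> hcarrier D \<and> hinner D g (da_vec w \<eta>) = hinner E (g w) \<eta>"
      if "g \<in> complex_vector.span ?S" for g
      using that
    proof (rule complex_vector.span_induct)
      show "complex_vector.subspace {g. g \<in> hcarrier D \<and> hinner D g (da_vec w \<eta>) = hinner E (g w) \<eta>}"
        using v 4 app
        by (intro complex_vector.subspaceI)
          (auto simp: D.inner_simps E.inner_simps scaleC_fun_apply simp del: mem_ball_0)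
    next
      fix g assume "g \<in> ?S"
      then obtain h \<zeta> where h: "h \<in> hcarrier A" "\<zeta> \<in> hcarrier E" "g = elem_tensor h \<zeta>" by blast
      have "hinner D g (da_vec w \<eta>) = h w * hinner E \<zeta> \<eta>"
        using inner[OF h(1) k(1)[OF 4(2)] h(2) 4(3)] k(2)[OF 4(2) h(1)] by (simp add: h(3) elem_k)
      then show "g \<in> hcarrier D \<and> hinner D g (da_vec w \<eta>) = hinner E (g w) \<eta>"
        using h 4 elem by (auto simp: elem_tensor_def E.inner_scaleC_left)
    qed
    have "\<forall>f\<in>hcarrier D. \<forall>e>0. \<exists>g\<in>complex_vector.span ?S. hnorm D (f - g) < e"
      using D unfolding is_function_tensor_def by (elim conjE)
    then have "\<forall>m. \<exists>g. g \<in> complex_vector.span ?S \<and> hnorm D (f - g) < inverse (real (Suc m))"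
      using 4(1) by (simp add: Bex_def)
    from choice[OF this] obtain s where s: "\<And>m. s m \<in> complex_vector.span ?S"
      "\<And>m. hnorm D (f - s m) < inverse (real (Suc m))" by blast
    have sD: "s m \<in> hcarrier D" "hinner D (s m) (da_vec w \<eta>) = hinner E (s m w) \<eta>" for m
      using span s(1) by auto
    have "hconv D s f"
      unfolding hconv_def
    proof (rule Lim_null_comparison[OF _ LIMSEQ_inverse_real_of_nat])
      show "\<forall>\<^sub>F k in sequentially. norm (hnorm D (s k - f)) \<le> inverse (real (Suc k))"
        using s(2) D.hnorm_minus_commute[OF 4(1) sD(1)] sD(1) 4(1)
        by (auto intro!: always_eventually less_imp_le)
    qed
    then have 1: "(\<lambda>m. hinner D (s m) (da_vec w \<eta>)) \<longlonglongrightarrow> hinner D f (da_vec w \<eta>)"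
      using sD(1) 4(1) v by (intro D.hconv_inner_left)
    have "\<forall>z\<in>unit_ball. \<exists>C. \<forall>f\<in>hcarrier D. hnorm E (f z) \<le> C * hnorm D f"
      using D unfolding is_function_tensor_def by (elim conjE)
    then obtain C where C: "\<And>f. f \<in> hcarrier D \<Longrightarrow> hnorm E (f w) \<le> C * hnorm D f"
      using 4(2) by blast
    have "hconv E (\<lambda>m. s m w) (f w)"
      unfolding hconv_def
    proof (rule Lim_null_comparison)
      show "\<forall>\<^sub>F m in sequentially. norm (hnorm E (s m w - f w)) \<le> C * hnorm D (s m - f)"
        using C[of "s m - f" for m] app[OF sD(1) 4(2)] app[OF 4(1,2)] sD(1) 4(1) by simp
      show "(\<lambda>m. C * hnorm D (s m - f)) \<longlonglongrightarrow> 0"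
        using \<open>hconv D s f\<close> by (simp add: hconv_def tendsto_mult_right_zero)
    qed
    then have 2: "(\<lambda>m. hinner E (s m w) \<eta>) \<longlonglongrightarrow> hinner E (f w) \<eta>"
      using app[OF sD(1) 4(2)] app[OF 4(1,2)] 4(3) by (intro E.hconv_inner_left)
    show ?case using 1 2 unfolding sD(2) by (rule LIMSEQ_unique)
  qed
qed

text \<open>Existence of a model makes the choice in \<open>da_tensor\<close> meaningful, and the
  reverse implication returns the description by kernel vectors for the chosen space, whichever it
  is.\<close>

lemma da_space_da_tensor:
  assumes "hilbert_space E"
  shows "da_space E (da_tensor E :: (complex ^ 'n::finite \<Rightarrow> 'e::complex_vector) hilb)"
proof -
  obtain D :: "(complex ^ 'n \<Rightarrow> 'e) hilb" where "da_space E D"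
    using hilbert_space.da_space_ex[OF assms] by blast
  then have "is_function_tensor unit_ball drury_arveson E D"
    by (rule da_space.is_function_tensor[OF _ is_rkhs_drury_arveson])
  then have "is_function_tensor unit_ball drury_arveson E (da_tensor E :: (complex ^ 'n \<Rightarrow> 'e) hilb)"
    unfolding da_tensor_def by (rule someI)
  then show ?thesis
    by (rule da_space_of_function_tensor[OF is_rkhs_drury_arveson assms])
qed

section \<open>The coordinate multiplications\<close>

context da_space
begin

lemma da_vec_0: "da_vec 0 \<eta> z = (if z \<in> unit_ball then \<eta> else 0)"
  by (simp add: da_vec_def scaleC_one)

lemma hnorm_da_vec_0:
  assumes "\<eta> \<in> hcarrier E"
  shows "hnorm D (da_vec 0 \<eta>) = hnorm E \<eta>"
  using da_vec_gram[OF zero_unit_ball zero_unit_ball assms assms] by (simp add: hnorm_def)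

text \<open>The kernel identity \<open>k(z,w) = 1 + \<langle>z,w\<rangle> k(z,w)\<close> says that
  \<open>k\<^sub>w \<eta> \<mapsto> (\<eta>, (cnj (w $ i) k\<^sub>w \<eta>)\<^sub>i)\<close> is isometric. Its components
  \<open>S i\<close> are the adjoints of the coordinate multiplications.\<close>

lemma backward_shift_ex:
  "\<exists>S. (\<forall>i. bounded_op D D (S i)) \<and>
    (\<forall>i. \<forall>w\<in>unit_ball. \<forall>\<eta>\<in>hcarrier E. S i (da_vec w \<eta>) = cnj (w $ i) *\<^sub>C da_vec w \<eta>) \<and>
    (\<forall>f\<in>hcarrier D. (\<Sum>i\<in>UNIV. (hnorm D (S i f))\<^sup>2) \<le> (hnorm D f)\<^sup>2) \<and>
    (\<forall>f\<in>hcarrier D. \<exists>g\<in>hcarrier D. \<forall>w\<in>unit_ball. \<forall>\<eta>\<in>hcarrier E. hinner D f (da_vec w \<eta>) =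
      hinner D g (da_vec 0 \<eta>) + (\<Sum>i\<in>UNIV. hinner D (S i f) (cnj (w $ i) *\<^sub>C da_vec w \<eta>)))"
proof -
  let ?L = "ell2 D :: ('n option \<Rightarrow> complex ^ 'n \<Rightarrow> 'e) hilb"
  interpret L: hilbert_space ?L by (rule D.hilbert_space_ell2)
  interpret DL: hilbert_space_pair D ?L by unfold_locales
  \<comment> \<open>The index \<open>None\<close> holds the constant function, which accounts for
    the summand 1 in the kernel identity; \<open>Some i\<close> holds the \<open>i\<close>-th term
    of the sum.\<close>
  define y where "y = (\<lambda>(w, \<eta>) j. case j of None \<Rightarrow> da_vec 0 \<eta>
    | Some i \<Rightarrow> cnj (w $ i) *\<^sub>C (da_vec w \<eta> :: complex ^ 'n \<Rightarrow> 'e))"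
  have L_mem: "c \<in> hcarrier ?L \<longleftrightarrow> (\<forall>j. c j \<in> hcarrier D)" for c
    by (auto simp: ell2_def)
  have L_inner: "hinner ?L c d = hinner D (c None) (d None) + (\<Sum>i\<in>UNIV. hinner D (c (Some i)) (d (Some i)))" for c d
    by (simp add: D.hinner_ell2 UNIV_option_conv sum.reindex)
  have y_mem: "y (w, \<eta>) \<in> hcarrier ?L" if "w \<in> unit_ball" "\<eta> \<in> hcarrier E" for w \<eta>
    using da_vec_mem[OF that] da_vec_mem[OF zero_unit_ball that(2)]
    by (auto simp: L_mem y_def split: option.split)
  have tot: "htotal D ((\<lambda>p. case p of (w, \<eta>) \<Rightarrow> da_vec w \<eta>) ` (unit_ball \<times> hcarrier E))"
    using da_vec_total .
  obtain V where V: "bounded_op D ?L V"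
    and V_vec: "\<And>p. p \<in> unit_ball \<times> hcarrier E \<Longrightarrow> V (case p of (w, \<eta>) \<Rightarrow> da_vec w \<eta>) = y p"
    and V_inner: "\<And>f g. f \<in> hcarrier D \<Longrightarrow> g \<in> hcarrier D \<Longrightarrow> hinner ?L (V f) (V g) = of_real 1 * hinner D f g"
  proof (rule DL.gram_isometry[OF tot, of y 1])
    show "y ` (unit_ball \<times> hcarrier E) \<subseteq> hcarrier ?L" using y_mem by (auto simp del: mem_ball_0)
    fix p q assume p: "p \<in> (unit_ball :: (complex ^ 'n) set) \<times> hcarrier E"
      and q: "q \<in> (unit_ball :: (complex ^ 'n) set) \<times> hcarrier E"
    obtain w \<eta> u \<zeta> where pq: "p = (w, \<eta>)" "q = (u, \<zeta>)"
      "w \<in> unit_ball" "u \<in> unit_ball" "\<eta> \<in> hcarrier E" "\<zeta> \<in> hcarrier E"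
      using p q by (cases p, cases q) auto
    have "hinner ?L (y p) (y q) = hinner E \<eta> \<zeta> +
        (\<Sum>i\<in>UNIV. u $ i * (cnj (w $ i) * (da_kernel u w * hinner E \<eta> \<zeta>)))"
      using pq da_vec_mem
      by (simp add: L_inner y_def da_vec_gram D.inner_scaleC_left D.inner_scaleC_right del: mem_ball_0)
    also have "\<dots> = (1 + (\<Sum>i\<in>UNIV. u $ i * cnj (w $ i)) * da_kernel u w) * hinner E \<eta> \<zeta>"
      by (simp add: distrib_right sum_distrib_right mult.assoc)
    also have "\<dots> = da_kernel u w * hinner E \<eta> \<zeta>"
      using da_kernel_eq[of u w] pq by simp
    finally show "hinner ?L (y p) (y q) = of_real 1 *
        hinner D (case p of (w, \<eta>) \<Rightarrow> da_vec w \<eta>) (case q of (w, \<eta>) \<Rightarrow> da_vec w \<eta>)"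
      using pq by (simp add: da_vec_gram del: mem_ball_0)
  qed simp_all
  have V_mem: "V f j \<in> hcarrier D" if "f \<in> hcarrier D" for f j
    using bounded_op_mem[OF V that] L_mem by blast
  have V_sum: "(hnorm D f)\<^sup>2 = (hnorm D (V f None))\<^sup>2 + (\<Sum>i\<in>UNIV. (hnorm D (V f (Some i)))\<^sup>2)"
    if f: "f \<in> hcarrier D" for f
    using V_inner[OF f f] V_mem[OF f] f by (simp add: L_inner D.hnorm_sq Re_sum) (metis plus_complex.sel(1) Re_sum)
  define S where "S i f = V f (Some i)" for i f
  have row: "(\<Sum>i\<in>UNIV. (hnorm D (S i f))\<^sup>2) \<le> (hnorm D f)\<^sup>2" if f: "f \<in> hcarrier D" for f
    using V_sum[OF f] by (simp add: S_def)
  show ?thesis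
  proof (rule exI[of _ S], intro conjI allI ballI)
    fix i
    have "hnorm D (S i f) \<le> 1 * hnorm D f" if f: "f \<in> hcarrier D" for f
    proof (rule power2_le_imp_le)
      have "(hnorm D (S i f))\<^sup>2 \<le> (\<Sum>i\<in>UNIV. (hnorm D (S i f))\<^sup>2)"
        by (rule member_le_sum) auto
      then show "(hnorm D (S i f))\<^sup>2 \<le> (1 * hnorm D f)\<^sup>2" using row[OF f] by simp
    qed (use f in simp)
    moreover have "S i f \<in> hcarrier D" if "f \<in> hcarrier D" for f
      using V_mem that by (simp add: S_def)
    moreover have "S i (f + g) = S i f + S i g" if "f \<in> hcarrier D" "g \<in> hcarrier D" for f g
      using bounded_op_add[OF V that] by (simp add: S_def)
    moreover have "S i (a *\<^sub>C f) = a *\<^sub>C S i f" if "f \<in> hcarrier D" for f a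
      using bounded_op_scaleC[OF V that] by (simp add: S_def scaleC_fun_apply)
    ultimately show "bounded_op D D (S i)" unfolding bounded_op_def by blast
  next
    fix i and w :: "complex ^ 'n" and \<eta> assume "w \<in> unit_ball" "\<eta> \<in> hcarrier E"
    then show "S i (da_vec w \<eta>) = cnj (w $ i) *\<^sub>C da_vec w \<eta>"
      using V_vec[of "(w, \<eta>)"] by (simp add: S_def y_def)
  next
    fix f assume "f \<in> hcarrier D"
    then show "(\<Sum>i\<in>UNIV. (hnorm D (S i f))\<^sup>2) \<le> (hnorm D f)\<^sup>2" by (rule row)
  next
    fix f assume f: "f \<in> hcarrier D"
    show "\<exists>g\<in>hcarrier D. \<forall>w\<in>unit_ball. \<forall>\<eta>\<in>hcarrier E. hinner D f (da_vec w \<eta>) =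
        hinner D g (da_vec 0 \<eta>) + (\<Sum>i\<in>UNIV. hinner D (S i f) (cnj (w $ i) *\<^sub>C da_vec w \<eta>))"
    proof (rule bexI[OF _ V_mem[OF f, of None]], intro ballI)
      fix w :: "complex ^ 'n" and \<eta> assume *: "w \<in> unit_ball" "\<eta> \<in> hcarrier E"
      show "hinner D f (da_vec w \<eta>) = hinner D (V f None) (da_vec 0 \<eta>) +
          (\<Sum>i\<in>UNIV. hinner D (S i f) (cnj (w $ i) *\<^sub>C da_vec w \<eta>))"
        using V_inner[OF f da_vec_mem[OF *]] V_vec[of "(w, \<eta>)"] *
        by (simp add: L_inner S_def y_def)
    qed
  qed
qed

text \<open>On the carrier the choice is unique: a bounded operator is determined by its values on
  the kernel vectors, which are total.\<close>

definition backward_shift :: "'n \<Rightarrow> (complex ^ 'n \<Rightarrow> 'e) \<Rightarrow> complex ^ 'n \<Rightarrow> 'e" where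
  "backward_shift = (SOME S. (\<forall>i. bounded_op D D (S i)) \<and>
    (\<forall>i. \<forall>w\<in>unit_ball. \<forall>\<eta>\<in>hcarrier E. S i (da_vec w \<eta>) = cnj (w $ i) *\<^sub>C da_vec w \<eta>) \<and>
    (\<forall>f\<in>hcarrier D. (\<Sum>i\<in>UNIV. (hnorm D (S i f))\<^sup>2) \<le> (hnorm D f)\<^sup>2) \<and>
    (\<forall>f\<in>hcarrier D. \<exists>g\<in>hcarrier D. \<forall>w\<in>unit_ball. \<forall>\<eta>\<in>hcarrier E. hinner D f (da_vec w \<eta>) =
      hinner D g (da_vec 0 \<eta>) + (\<Sum>i\<in>UNIV. hinner D (S i f) (cnj (w $ i) *\<^sub>C da_vec w \<eta>))))"

lemma
  shows backward_shift_bounded: "bounded_op D D (backward_shift i)"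
    and backward_shift_da_vec: "\<lbrakk>w \<in> unit_ball; \<eta> \<in> hcarrier E\<rbrakk>
      \<Longrightarrow> backward_shift i (da_vec w \<eta>) = cnj (w $ i) *\<^sub>C da_vec w \<eta>"
    and backward_shift_row: "f \<in> hcarrier D
      \<Longrightarrow> (\<Sum>i\<in>UNIV. (hnorm D (backward_shift i f))\<^sup>2) \<le> (hnorm D f)\<^sup>2"
    and backward_shift_split: "f \<in> hcarrier D
      \<Longrightarrow> \<exists>g\<in>hcarrier D. \<forall>w\<in>unit_ball. \<forall>\<eta>\<in>hcarrier E. hinner D f (da_vec w \<eta>) =
        hinner D g (da_vec 0 \<eta>) + (\<Sum>i\<in>UNIV. hinner D (backward_shift i f) (cnj (w $ i) *\<^sub>C da_vec w \<eta>))"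
  using someI_ex[OF backward_shift_ex, folded backward_shift_def] by blast+

sublocale DD: hilbert_space_pair D D by unfold_locales

text \<open>Both sides are compared pointwise, by testing against kernel vectors. The right-hand
  side belongs to \<open>D\<close> by construction, so the identity also proves that
  \<open>D\<close> is invariant under coordinate multiplication.\<close>

lemma coord_mult_eq_hadjoint:
  assumes f: "f \<in> hcarrier D"
  shows "coord_mult i f = hadjoint D D (backward_shift i) f"
proof
  note adj = DD.hadjoint_mem[OF backward_shift_bounded f]
  fix z :: "complex ^ 'n"
  show "coord_mult i f z = hadjoint D D (backward_shift i) f z"
  proof (cases "z \<in> unit_ball")
    case True
    show ?thesis
    proof (rule E.inner_ext_left)
      show "coord_mult i f z \<in> hcarrier E" "hadjoint D D (backward_shift i) f z \<in> hcarrier E"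
        using app_mem[OF f True] app_mem[OF adj True] by (simp_all add: coord_mult_def)
      fix \<eta> assume \<eta>: "\<eta> \<in> hcarrier E"
      have "hinner E (hadjoint D D (backward_shift i) f z) \<eta> = hinner D f (backward_shift i (da_vec z \<eta>))"
        using reproducing[OF adj True \<eta>] DD.hadjoint_left[OF backward_shift_bounded f da_vec_mem[OF True \<eta>]]
        by simp
      also have "\<dots> = z $ i * hinner E (f z) \<eta>"
        using f True \<eta> by (simp add: backward_shift_da_vec D.inner_scaleC_right da_vec_mem reproducing del: mem_ball_0)
      finally show "hinner E (coord_mult i f z) \<eta> = hinner E (hadjoint D D (backward_shift i) f z) \<eta>"
        using app_mem[OF f True] \<eta> by (simp add: coord_mult_def E.inner_scaleC_left)
    qed
  qed (simp add: coord_mult_def app_off[OF f] app_off[OF adj] del: mem_ball_0)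
qed

lemma coord_mult_mem: "f \<in> hcarrier D \<Longrightarrow> coord_mult i f \<in> hcarrier D"
  using DD.hadjoint_mem[OF backward_shift_bounded] by (simp add: coord_mult_eq_hadjoint)

lemma coord_mult_adjoint:
  "f \<in> hcarrier D \<Longrightarrow> g \<in> hcarrier D \<Longrightarrow> hinner D (coord_mult i f) g = hinner D f (backward_shift i g)"
  using DD.hadjoint_left[OF backward_shift_bounded] by (simp add: coord_mult_eq_hadjoint)

lemma backward_shift_mem: "f \<in> hcarrier D \<Longrightarrow> backward_shift i f \<in> hcarrier D"
  by (rule bounded_op_mem[OF backward_shift_bounded])

lemma hnorm_backward_shift_le:
  assumes "f \<in> hcarrier D"
  shows "hnorm D (backward_shift i f) \<le> hnorm D f"
proof (rule power2_le_imp_le)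
  have "(hnorm D (backward_shift i f))\<^sup>2 \<le> (\<Sum>i\<in>UNIV. (hnorm D (backward_shift i f))\<^sup>2)"
    by (rule member_le_sum) auto
  then show "(hnorm D (backward_shift i f))\<^sup>2 \<le> (hnorm D f)\<^sup>2"
    using backward_shift_row[OF assms] by simp
qed (use assms in simp)

lemma backward_shift_commute:
  assumes f: "f \<in> hcarrier D"
  shows "backward_shift i (backward_shift j f) = backward_shift j (backward_shift i f)"
proof (rule D.inner_ext)
  fix u assume u: "u \<in> hcarrier D"
  have "coord_mult j (coord_mult i u) = coord_mult i (coord_mult j u)"
    by (simp add: coord_mult_def scaleC_scaleC mult.commute)
  then show "hinner D u (backward_shift i (backward_shift j f)) = hinner D u (backward_shift j (backward_shift i f))"
    using u f by (simp add: backward_shift_mem coord_mult_mem flip: coord_mult_adjoint)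
qed (use f in \<open>simp_all add: backward_shift_mem\<close>)

text \<open>The norm bound of the adjoint is transferred by evaluating the squared norm of
  \<open>coord_mult i f\<close> as a pairing of \<open>f\<close> with a backward shift.\<close>

lemma hnorm_coord_mult_le:
  assumes f: "f \<in> hcarrier D"
  shows "hnorm D (coord_mult i f) \<le> hnorm D f"
proof -
  let ?g = "coord_mult i f"
  have g: "?g \<in> hcarrier D" using f by (rule coord_mult_mem)
  have "(hnorm D ?g)\<^sup>2 = cmod (hinner D f (backward_shift i ?g))"
    unfolding coord_mult_adjoint[OF f g, of i, symmetric] using g by (simp add: D.inner_self norm_power)
  also have "\<dots> \<le> hnorm D f * hnorm D (backward_shift i ?g)"
    using f g by (intro D.Cauchy_Schwarz) (auto intro: backward_shift_mem)
  also have "\<dots> \<le> hnorm D f * hnorm D ?g"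
    using f g by (intro mult_left_mono hnorm_backward_shift_le) auto
  finally have *: "hnorm D ?g * hnorm D ?g \<le> hnorm D f * hnorm D ?g"
    by (simp add: power2_eq_square)
  show ?thesis
  proof (cases "hnorm D ?g = 0")
    case False
    then have "0 < hnorm D ?g" using D.hnorm_nonneg[OF g] by linarith
    with * show ?thesis by (rule mult_right_le_imp_le)
  qed (use f in simp)
qed

text \<open>This is where more than one variable is needed: from \<open>S i (z\<^sub>i f) = f\<close> the row contraction
  gives \<open>S j (z\<^sub>i f) = 0\<close> for \<open>j \<noteq> i\<close>, hence \<open>S j f = S i (S j (z\<^sub>i f)) = 0\<close>.\<close>

lemma constant_if_coord_mult_isometric:
  assumes n: "CARD('n) > 1" and f: "f \<in> hcarrier D"
    and iso: "\<And>i. hnorm D (coord_mult i f) = hnorm D f"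
  shows "f = da_vec 0 (f 0)"
proof -
  let ?S = backward_shift
  \<comment> \<open>Equality in Cauchy-Schwarz: the shifted vector is no longer than
    \<open>f\<close>, while its inner product with \<open>f\<close> is the full squared norm of
    \<open>f\<close>. Expanding the squared distance gives at most 0.\<close>
  have Sg: "?S i (coord_mult i f) = f" for i
  proof -
    let ?g = "coord_mult i f"
    have g: "?g \<in> hcarrier D" "?S i ?g \<in> hcarrier D" using f by (simp_all add: coord_mult_mem backward_shift_mem)
    have fS: "hinner D f (?S i ?g) = of_real ((hnorm D f)\<^sup>2)"
      unfolding coord_mult_adjoint[OF f g(1), of i, symmetric] using g by (simp add: D.inner_self iso)
    have "(hnorm D (?S i ?g - f))\<^sup>2 = (hnorm D (?S i ?g))\<^sup>2 - 2 * Re (hinner D f (?S i ?g)) + (hnorm D f)\<^sup>2"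
      using f g D.inner_commute[of f "?S i ?g"] by (simp add: D.hnorm_sq D.inner_simps)
    also have "\<dots> = (hnorm D (?S i ?g))\<^sup>2 - (hnorm D f)\<^sup>2" using fS by simp
    also have "\<dots> \<le> 0"
      using hnorm_backward_shift_le[OF g(1), of i] iso[of i] g f by (simp add: power_mono)
    finally have "hnorm D (?S i ?g - f) = 0" by simp
    then show ?thesis using g f by simp
  qed
  \<comment> \<open>The component \<open>i\<close> already has norm equal to that of
    \<open>coord_mult i f\<close>, which exhausts the bound of the row contraction.\<close>
  have off: "?S j (coord_mult i f) = 0" if ij: "j \<noteq> i" for i j
  proof -
    let ?g = "coord_mult i f"
    have g: "?g \<in> hcarrier D" using f by (rule coord_mult_mem)
    have "(hnorm D (?S i ?g))\<^sup>2 + (hnorm D (?S j ?g))\<^sup>2 = (\<Sum>k\<in>{i, j}. (hnorm D (?S k ?g))\<^sup>2)"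
      using ij by simp
    also have "\<dots> \<le> (\<Sum>k\<in>UNIV. (hnorm D (?S k ?g))\<^sup>2)" by (intro sum_mono2) auto
    also have "\<dots> \<le> (hnorm D ?g)\<^sup>2" by (rule backward_shift_row[OF g])
    finally have "(hnorm D (?S j ?g))\<^sup>2 \<le> 0" by (simp add: Sg iso)
    then have "hnorm D (?S j ?g) = 0" by simp
    then show ?thesis using backward_shift_mem[OF g] by simp
  qed
  have Sf: "?S j f = 0" for j
  proof -
    have "\<exists>i. i \<noteq> j"
    proof (rule ccontr)
      assume "\<not> (\<exists>i. i \<noteq> j)"
      then have "UNIV = {j}" by auto
      then have "CARD('n) = card {j}" by (simp only:)
      then show False using n by simp
    qed
    then obtain i where i: "i \<noteq> j" ..
    have "?S j f = ?S j (?S i (coord_mult i f))" by (simp add: Sg)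
    also have "\<dots> = ?S i (?S j (coord_mult i f))"
      using f by (intro backward_shift_commute coord_mult_mem)
    also have "\<dots> = 0" using off i DD.bounded_op_zero[OF backward_shift_bounded] by metis
    finally show ?thesis .
  qed
  \<comment> \<open>Once all backward shifts of \<open>f\<close> vanish, only the constant part of
    this splitting is left, and it does not depend on the point.\<close>
  obtain g where g: "\<And>w \<eta>. w \<in> unit_ball \<Longrightarrow> \<eta> \<in> hcarrier E \<Longrightarrow> hinner D f (da_vec w \<eta>) =
      hinner D g (da_vec 0 \<eta>) + (\<Sum>i\<in>UNIV. hinner D (?S i f) (cnj (w $ i) *\<^sub>C da_vec w \<eta>))"
    using backward_shift_split[OF f] by blast
  have f0: "f 0 \<in> hcarrier E" using app_mem[OF f] by simp
  show ?thesis
  proof (rule da_ext[OF f])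
    show "da_vec 0 (f 0) \<in> hcarrier D" using f0 by (intro da_vec_mem) simp_all
    fix w :: "complex ^ 'n" and \<eta> assume *: "w \<in> unit_ball" "\<eta> \<in> hcarrier E"
    have "hinner D f (da_vec u \<eta>) = hinner D g (da_vec 0 \<eta>)" if "u \<in> unit_ball" for u
      using g[OF that *(2)] da_vec_mem[OF that *(2)] by (simp add: Sf)
    then have "hinner D f (da_vec w \<eta>) = hinner D f (da_vec 0 \<eta>)"
      using *(1) zero_unit_ball by metis
    then show "hinner E (f w) \<eta> = hinner E (da_vec 0 (f 0) w) \<eta>"
      using f * by (simp add: reproducing da_vec_0)
  qed
qed

text \<open>The difference quotient \<open>(k\<^sub>w - 1) / t\<close> with \<open>w = t e\<^sub>i\<close> tends to \<open>z\<^sub>i\<close>.\<close>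

lemma coord_mult_difference_quotient:
  fixes t :: real and i :: 'n
  assumes \<eta>: "\<eta> \<in> hcarrier E" and t: "0 < t" "t < 1"
  defines "w \<equiv> axis i (of_real t) :: complex ^ 'n"
  defines "u \<equiv> da_vec w \<eta> - da_vec 0 \<eta>"
  defines "z \<equiv> coord_mult i (da_vec 0 \<eta>)"
  shows "w \<in> unit_ball" "(hnorm D (u - of_real t *\<^sub>C z))\<^sup>2 =
    (hnorm E \<eta>)\<^sup>2 * (1 / (1 - t\<^sup>2) - 1 - 2 * t\<^sup>2) + t\<^sup>2 * (hnorm D z)\<^sup>2"
proof -
  show w: "w \<in> unit_ball" using t by (simp add: w_def norm_vec_def L2_set_def axis_def if_distrib[of norm] if_distrib[of "\<lambda>x. x\<^sup>2"] cong: if_cong)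
  have t2: "t\<^sup>2 < 1" using t by (simp add: power_less_one_iff)
  have "(\<Sum>j\<in>UNIV. w $ j * cnj (w $ j)) = (\<Sum>j\<in>UNIV. if j = i then of_real (t\<^sup>2) else 0)"
    by (intro sum.cong) (auto simp: w_def axis_def power2_eq_square)
  then have k: "da_kernel w w = of_real (1 / (1 - t\<^sup>2))"
    by (simp add: da_kernel_def inverse_eq_divide)
  have k0: "da_kernel 0 w = 1" by (simp add: da_kernel_def)
  note v = da_vec_mem[OF w \<eta>] da_vec_mem[OF zero_unit_ball \<eta>]
  have z: "z \<in> hcarrier D" unfolding z_def using v(2) by (rule coord_mult_mem)
  have u: "u \<in> hcarrier D" using v by (simp add: u_def)
  have uu: "Re (hinner D u u) = (hnorm E \<eta>)\<^sup>2 * (1 / (1 - t\<^sup>2) - 1)"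
    using v \<eta> w k k0 by (simp add: u_def D.inner_simps da_vec_gram E.inner_self algebra_simps
        del: mem_ball_0 of_real_divide of_real_power of_real_diff)
  \<comment> \<open>The function \<open>z\<close> takes the value \<open>t \<eta>\<close> at
    \<open>w\<close> and 0 at the origin. Its own norm is left symbolic in the final formula,
    because that formula is used to determine it.\<close>
  have zu: "hinner D z u = of_real (t * (hnorm E \<eta>)\<^sup>2)"
  proof -
    have "hinner D z (da_vec w \<eta>) = of_real t * hinner E \<eta> \<eta>"
      using reproducing[OF z w \<eta>] w \<eta> by (simp add: z_def coord_mult_def da_vec_0 E.inner_scaleC_left w_def)
    moreover have "hinner D z (da_vec 0 \<eta>) = 0"
      using reproducing[OF z zero_unit_ball \<eta>] \<eta> by (simp add: z_def coord_mult_def)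
    ultimately show ?thesis using v z \<eta> by (simp add: u_def D.inner_simps E.inner_self)
  qed
  have "(hnorm D (u - of_real t *\<^sub>C z))\<^sup>2 = Re (hinner D (u - of_real t *\<^sub>C z) (u - of_real t *\<^sub>C z))"
    using u z by (intro D.hnorm_sq) simp
  also have "\<dots> = Re (hinner D u u) - 2 * t * Re (hinner D z u) + t\<^sup>2 * Re (hinner D z z)"
    using u z D.inner_commute[OF z u] by (simp add: D.inner_simps power2_eq_square algebra_simps)
  also have "Re (hinner D z z) = (hnorm D z)\<^sup>2" using z by (rule D.hnorm_sq[symmetric])
  also have "Re (hinner D u u) - 2 * t * Re (hinner D z u) + t\<^sup>2 * (hnorm D z)\<^sup>2 =
      (hnorm E \<eta>)\<^sup>2 * (1 / (1 - t\<^sup>2) - 1 - 2 * t\<^sup>2) + t\<^sup>2 * (hnorm D z)\<^sup>2"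
    by (simp add: uu zu power2_eq_square algebra_simps)
  finally show "(hnorm D (u - of_real t *\<^sub>C z))\<^sup>2 =
      (hnorm E \<eta>)\<^sup>2 * (1 / (1 - t\<^sup>2) - 1 - 2 * t\<^sup>2) + t\<^sup>2 * (hnorm D z)\<^sup>2" .
qed

text \<open>Contractivity gives one inequality. For the other, the squared norm in
  \<open>coord_mult_difference_quotient\<close> is nonnegative; dividing by \<open>t\<^sup>2\<close>
  and letting \<open>t\<close> tend to 0 bounds the norm of the coordinate function from
  below.\<close>

lemma hnorm_coord_mult_da_vec_0:
  assumes \<eta>: "\<eta> \<in> hcarrier E"
  shows "hnorm D (coord_mult i (da_vec 0 \<eta>)) = hnorm E \<eta>"
proof (rule antisym)
  let ?z = "coord_mult i (da_vec 0 \<eta>)"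
  note v = da_vec_mem[OF zero_unit_ball \<eta>]
  have z: "?z \<in> hcarrier D" using v by (rule coord_mult_mem)
  show "hnorm D ?z \<le> hnorm E \<eta>"
    using hnorm_coord_mult_le[OF v] hnorm_da_vec_0[OF \<eta>] by simp
  have bound: "(hnorm E \<eta>)\<^sup>2 * (2 - 1 / (1 - t\<^sup>2)) \<le> (hnorm D ?z)\<^sup>2" if t: "0 < t" "t < 1" for t :: real
  proof -
    have t2: "t\<^sup>2 < 1" "0 < t\<^sup>2" using t by (simp_all add: power_less_one_iff)
    have eq: "1 / (1 - t\<^sup>2) - 1 - 2 * t\<^sup>2 = t\<^sup>2 * (1 / (1 - t\<^sup>2) - 2)"
      using t2 by (simp add: field_simps)
    have "0 \<le> (hnorm E \<eta>)\<^sup>2 * (1 / (1 - t\<^sup>2) - 1 - 2 * t\<^sup>2) + t\<^sup>2 * (hnorm D ?z)\<^sup>2"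
      unfolding coord_mult_difference_quotient(2)[OF \<eta> t, symmetric] by simp
    then have "0 \<le> t\<^sup>2 * ((hnorm E \<eta>)\<^sup>2 * (1 / (1 - t\<^sup>2) - 2) + (hnorm D ?z)\<^sup>2)"
      unfolding eq by (simp only: distrib_left mult.left_commute)
    then have "0 \<le> (hnorm E \<eta>)\<^sup>2 * (1 / (1 - t\<^sup>2) - 2) + (hnorm D ?z)\<^sup>2"
      using t2(2) by (simp add: zero_le_mult_iff)
    then show ?thesis by (simp add: algebra_simps)
  qed
  have unit_interval: "\<forall>\<^sub>F t in at_right (0::real). t \<in> {0<..<1}"
    by (rule eventually_at_right_real) simp
  have "((\<lambda>t. (hnorm E \<eta>)\<^sup>2 * (2 - 1 / (1 - t\<^sup>2))) \<longlongrightarrow> (hnorm E \<eta>)\<^sup>2 * (2 - 1 / (1 - 0\<^sup>2))) (at_right (0::real))"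
    by (intro tendsto_intros) auto
  moreover have "\<forall>\<^sub>F t in at_right (0::real). (hnorm E \<eta>)\<^sup>2 * (2 - 1 / (1 - t\<^sup>2)) \<le> (hnorm D ?z)\<^sup>2"
    using unit_interval by eventually_elim (rule bound, auto)
  ultimately have "(hnorm E \<eta>)\<^sup>2 * (2 - 1 / (1 - 0\<^sup>2)) \<le> (hnorm D ?z)\<^sup>2"
    by (rule tendsto_upperbound) simp
  then show "hnorm E \<eta> \<le> hnorm D ?z"
    by (intro power2_le_imp_le[OF _ D.hnorm_nonneg[OF z]]) simp
qed

text \<open>A function with values orthogonal to \<open>\<eta>\<close> is orthogonal to every kernel
  vector in the direction \<open>\<eta>\<close>, hence to the difference \<open>u\<close>. So its
  pairing with \<open>t\<close> times the coordinate function equals, up to sign, its pairing with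
  the remainder. The squared norm of the remainder is of order \<open>t^4\<close>, and division by
  \<open>t\<^sup>2\<close> leaves a bound tending to 0.\<close>

lemma orthogonal_coord_mult_da_vec_0:
  assumes \<eta>: "\<eta> \<in> hcarrier E" and f: "f \<in> hcarrier D"
    and orth: "\<And>w. w \<in> unit_ball \<Longrightarrow> hinner E (f w) \<eta> = 0"
  shows "hinner D f (coord_mult i (da_vec 0 \<eta>)) = 0"
proof -
  let ?z = "coord_mult i (da_vec 0 \<eta>)"
  note v = da_vec_mem[OF zero_unit_ball \<eta>]
  have z: "?z \<in> hcarrier D" using v by (rule coord_mult_mem)
  have bound: "(cmod (hinner D f ?z))\<^sup>2 \<le> (hnorm D f)\<^sup>2 * ((hnorm E \<eta>)\<^sup>2 * (1 / (1 - t\<^sup>2) - 1))"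
    if t: "0 < t" "t < 1" for t :: real
  proof -
    define w where "w = (axis i (of_real t) :: complex ^ 'n)"
    define u where "u = da_vec w \<eta> - da_vec 0 \<eta>"
    have t2: "t\<^sup>2 < 1" "0 < t\<^sup>2" using t by (simp_all add: power_less_one_iff)
    note dq = coord_mult_difference_quotient[OF \<eta> t, of i, folded w_def, folded u_def]
    have u: "u \<in> hcarrier D" using da_vec_mem[OF dq(1) \<eta>] v by (simp add: u_def)
    have "hinner D f u = 0"
      using f \<eta> dq(1) da_vec_mem v orth
      by (simp add: u_def D.inner_diff_right reproducing del: mem_ball_0)
    then have "hinner D f (u - of_real t *\<^sub>C ?z) = - (of_real t * hinner D f ?z)"
      using f u z by (simp add: D.inner_simps)
    then have "t * cmod (hinner D f ?z) = cmod (hinner D f (u - of_real t *\<^sub>C ?z))"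
      using t by (simp add: norm_mult)
    also have "\<dots> \<le> hnorm D f * hnorm D (u - of_real t *\<^sub>C ?z)"
      using f u z by (intro D.Cauchy_Schwarz) auto
    finally have "(t * cmod (hinner D f ?z))\<^sup>2 \<le> (hnorm D f * hnorm D (u - of_real t *\<^sub>C ?z))\<^sup>2"
      using t by (intro power_mono) auto
    also have "\<dots> = (hnorm D f)\<^sup>2 * ((hnorm E \<eta>)\<^sup>2 * (1 / (1 - t\<^sup>2) - 1 - 2 * t\<^sup>2) + t\<^sup>2 * (hnorm E \<eta>)\<^sup>2)"
      by (simp only: power_mult_distrib dq(2) hnorm_coord_mult_da_vec_0[OF \<eta>])
    also have "\<dots> = t\<^sup>2 * ((hnorm D f)\<^sup>2 * ((hnorm E \<eta>)\<^sup>2 * (1 / (1 - t\<^sup>2) - 1)))"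
      using t2 by (simp add: field_simps)
    finally show ?thesis using t2(2) by (simp add: power_mult_distrib)
  qed
  have unit_interval: "\<forall>\<^sub>F t in at_right (0::real). t \<in> {0<..<1}"
    by (rule eventually_at_right_real) simp
  have "((\<lambda>t. (hnorm D f)\<^sup>2 * ((hnorm E \<eta>)\<^sup>2 * (1 / (1 - t\<^sup>2) - 1)))
      \<longlongrightarrow> (hnorm D f)\<^sup>2 * ((hnorm E \<eta>)\<^sup>2 * (1 / (1 - 0\<^sup>2) - 1))) (at_right (0::real))"
    by (intro tendsto_intros) auto
  moreover have "\<forall>\<^sub>F t in at_right (0::real).
      (cmod (hinner D f ?z))\<^sup>2 \<le> (hnorm D f)\<^sup>2 * ((hnorm E \<eta>)\<^sup>2 * (1 / (1 - t\<^sup>2) - 1))"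
    using unit_interval by eventually_elim (rule bound, auto)
  ultimately have "(cmod (hinner D f ?z))\<^sup>2 \<le> (hnorm D f)\<^sup>2 * ((hnorm E \<eta>)\<^sup>2 * (1 / (1 - 0\<^sup>2) - 1))"
    by (rule tendsto_lowerbound) simp
  then show ?thesis by simp
qed

end

section \<open>Kernels of inner multipliers\<close>

text \<open>For a closed subspace \<open>V\<close> this plays the role of the tensor product with
  \<open>V\<close>, but it is cut out pointwise inside \<open>D\<close>, so that kernels and ranges
  of multipliers can be compared with it directly.\<close>

definition da_valued :: "(complex ^ 'n::finite \<Rightarrow> 'e) hilb \<Rightarrow> 'e set \<Rightarrow> (complex ^ 'n \<Rightarrow> 'e) set" where
  "da_valued D V = {f \<in> hcarrier D. \<forall>z\<in>unit_ball. f z \<in> V}"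

context da_space
begin

lemma da_vec_hcompl_da_valued:
  assumes V: "V \<subseteq> hcarrier E" and \<eta>: "\<eta> \<in> hcompl E V" and w: "w \<in> unit_ball"
  shows "da_vec w \<eta> \<in> hcompl D (da_valued D V)"
proof -
  have \<eta>E: "\<eta> \<in> hcarrier E" using \<eta> by (simp add: hcompl_def)
  note v = da_vec_mem[OF w \<eta>E]
  have "hinner D (da_vec w \<eta>) f = 0" if f: "f \<in> da_valued D V" for f
  proof -
    have fD: "f \<in> hcarrier D" and fw: "f w \<in> V" using f w by (auto simp: da_valued_def)
    then have "hinner E (f w) \<eta> = 0"
      using \<eta> V E.orthogonal_commute[of "f w" \<eta>] by (auto simp: hcompl_def)
    then show ?thesis
      using D.orthogonal_commute[OF fD v] reproducing[OF fD w \<eta>E] by simp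
  qed
  then show ?thesis using v by (simp add: hcompl_def)
qed

lemma coord_mult_hcompl_da_valued:
  assumes V: "V \<subseteq> hcarrier E" and \<eta>: "\<eta> \<in> hcompl E V"
  shows "coord_mult i (da_vec 0 \<eta>) \<in> hcompl D (da_valued D V)"
proof -
  have \<eta>E: "\<eta> \<in> hcarrier E" using \<eta> by (simp add: hcompl_def)
  have z: "coord_mult i (da_vec 0 \<eta>) \<in> hcarrier D"
    using da_vec_mem[OF zero_unit_ball \<eta>E] by (rule coord_mult_mem)
  have "hinner D (coord_mult i (da_vec 0 \<eta>)) f = 0" if f: "f \<in> da_valued D V" for f
  proof -
    have fD: "f \<in> hcarrier D" and fw: "\<And>w. w \<in> unit_ball \<Longrightarrow> f w \<in> V" using f by (auto simp: da_valued_def)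
    have "hinner E (f w) \<eta> = 0" if "w \<in> unit_ball" for w
      using \<eta> V fw[OF that] E.orthogonal_commute[of "f w" \<eta>] by (auto simp: hcompl_def)
    then show ?thesis
      using D.orthogonal_commute[OF fD z] orthogonal_coord_mult_da_vec_0[OF \<eta>E fD] by blast
  qed
  then show ?thesis using z by (simp add: hcompl_def)
qed

lemma da_vec_0_bounded: "bounded_op E D (da_vec 0)"
  unfolding bounded_op_def
proof (intro conjI ballI allI exI)
  show "da_vec 0 \<in> hcarrier E \<rightarrow> hcarrier D" using da_vec_mem[OF zero_unit_ball] by blast
  show "da_vec 0 (x + y) = da_vec 0 x + (da_vec 0 y :: complex ^ 'n \<Rightarrow> 'e)" for x y
    by (auto simp: da_vec_0 fun_eq_iff)
  show "da_vec 0 (a *\<^sub>C x) = a *\<^sub>C (da_vec 0 x :: complex ^ 'n \<Rightarrow> 'e)" for a x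
    by (auto simp: da_vec_0 fun_eq_iff scaleC_fun_apply)
  show "hnorm D (da_vec 0 x) \<le> 1 * hnorm E x" if "x \<in> hcarrier E" for x
    using hnorm_da_vec_0[OF that] by simp
qed

lemma subspace_da_valued:
  assumes "complex_vector.subspace V"
  shows "complex_vector.subspace (da_valued D V)"
  using complex_vector.subspace_0[OF assms] complex_vector.subspace_add[OF assms]
    complex_vector.subspace_scale[OF assms]
  by (intro complex_vector.subspaceI) (auto simp: da_valued_def scaleC_fun_apply)

end

text \<open>The new subspace is the image under \<open>\<phi> 0\<close> of the complement
  \<open>W\<close> of \<open>V\<close>; it is closed since \<open>\<phi> 0\<close> is isometric on
  \<open>W\<close>. Each value of the multiplier kills \<open>V\<close> and agrees with
  \<open>\<phi> 0\<close> on \<open>W\<close>, which gives one inclusion. The other follows once no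
  nonzero function with values in the new subspace is orthogonal to the closed range.\<close>

lemma inner_multiplier_range:
  fixes E :: "'a::complex_vector hilb" and F :: "'b::complex_vector hilb"
    and D :: "(complex ^ 'n::finite \<Rightarrow> 'a) hilb" and D' :: "(complex ^ 'n \<Rightarrow> 'b) hilb"
  assumes n: "CARD('n) > 1" and D: "da_space E D" and D': "da_space F D'"
    and T: "partial_isometry D D' (mult_op \<phi>)"
    and \<phi>: "\<And>z. z \<in> unit_ball \<Longrightarrow> bounded_op E F (\<phi> z)"
    and V: "hclosed E V" and kernel: "hkernel D (mult_op \<phi>) = da_valued D V"
    and closed: "hclosed D' (mult_op \<phi> ` hcarrier D)"
  shows "\<exists>V'. hclosed F V' \<and> mult_op \<phi> ` hcarrier D = da_valued D' V'"
proof -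
  interpret D: da_space E D by fact
  interpret D': da_space F D' by fact
  interpret EF: hilbert_space_pair E F by unfold_locales
  interpret DD': hilbert_space_pair D D' by unfold_locales
  let ?T = "mult_op \<phi>"
  have b: "bounded_op D D' ?T" using T by (simp add: partial_isometry_def)
  have iso: "hnorm D' (?T f) = hnorm D f" if "f \<in> hcompl D (da_valued D V)" for f
    using T that by (auto simp: partial_isometry_def kernel hcompl_def)
  have subV: "complex_vector.subspace V" and VE: "V \<subseteq> hcarrier E" using V by (auto simp: hclosed_def)
  define W where "W = hcompl E V"
  have W: "hclosed E W" unfolding W_def using VE by (rule D.E.hclosed_hcompl)
  have WE: "W \<subseteq> hcarrier E" by (auto simp: W_def hcompl_def)
  \<comment> \<open>Pointwise linearity makes the multiplier a module map. The norm of
    \<open>z_i\<close> times an image is thus the norm of the image of a vector that is again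
    orthogonal to the kernel.\<close>
  have T_coord: "?T (coord_mult i f) = coord_mult i (?T f)" if f: "f \<in> hcarrier D" for i f
  proof
    fix z :: "complex ^ 'n"
    show "?T (coord_mult i f) z = coord_mult i (?T f) z"
    proof (cases "z \<in> unit_ball")
      case True
      then show ?thesis
        using bounded_op_scaleC[OF \<phi>[OF True] D.app_mem[OF f True]] by (simp add: mult_op_def coord_mult_def)
    qed (simp add: mult_op_def coord_mult_def)
  qed
  have const: "?T (da_vec 0 \<eta>) = da_vec 0 (\<phi> 0 \<eta>)" and norm: "hnorm F (\<phi> 0 \<eta>) = hnorm E \<eta>"
    if \<eta>: "\<eta> \<in> W" for \<eta>
  proof -
    have \<eta>E: "\<eta> \<in> hcarrier E" using \<eta> WE by blast
    note v = D.da_vec_mem[OF zero_unit_ball \<eta>E]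
    note Tv = bounded_op_mem[OF b v]
    have nT: "hnorm D' (?T (da_vec 0 \<eta>)) = hnorm E \<eta>"
      using iso[OF D.da_vec_hcompl_da_valued[OF VE _ zero_unit_ball]] \<eta> D.hnorm_da_vec_0[OF \<eta>E]
      by (simp add: W_def)
    have "hnorm D' (coord_mult i (?T (da_vec 0 \<eta>))) = hnorm D' (?T (da_vec 0 \<eta>))" for i
      using iso[OF D.coord_mult_hcompl_da_valued[OF VE]] \<eta> D.hnorm_coord_mult_da_vec_0[OF \<eta>E]
      by (simp add: W_def nT flip: T_coord[OF v])
    then have "?T (da_vec 0 \<eta>) = da_vec 0 (?T (da_vec 0 \<eta>) 0)"
      by (rule D'.constant_if_coord_mult_isometric[OF n Tv])
    moreover have "?T (da_vec 0 \<eta>) 0 = \<phi> 0 \<eta>" by (simp add: mult_op_def D.da_vec_0)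
    ultimately show *: "?T (da_vec 0 \<eta>) = da_vec 0 (\<phi> 0 \<eta>)" by simp
    show "hnorm F (\<phi> 0 \<eta>) = hnorm E \<eta>"
      using nT D'.hnorm_da_vec_0[OF bounded_op_mem[OF \<phi>[OF zero_unit_ball] \<eta>E]] * by simp
  qed
  have \<phi>W: "\<phi> z \<eta> = \<phi> 0 \<eta>" if "\<eta> \<in> W" "z \<in> unit_ball" for z \<eta>
    using fun_cong[OF const[OF that(1)], of z] that(2) by (simp add: mult_op_def D.da_vec_0 D'.da_vec_0)
  \<comment> \<open>Constant functions with value in \<open>V\<close> belong to the kernel by
    assumption, so they detect the vanishing of \<open>\<phi> z\<close> on \<open>V\<close>.\<close>
  have \<phi>V: "\<phi> z v = 0" if v: "v \<in> V" and z: "z \<in> unit_ball" for z v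
  proof -
    have "da_vec 0 v \<in> da_valued D V"
      using v VE D.da_vec_mem[OF zero_unit_ball, of v] by (auto simp: da_valued_def D.da_vec_0)
    then have "?T (da_vec 0 v) z = 0" unfolding kernel[symmetric] by (simp add: hkernel_def)
    then show ?thesis using z by (simp add: mult_op_def D.da_vec_0)
  qed
  define V' where "V' = \<phi> 0 ` W"
  have V': "hclosed F V'"
    unfolding V'_def by (rule EF.isometric_image_hclosed[OF \<phi>[OF zero_unit_ball] W norm])
  have V'F: "V' \<subseteq> hcarrier F" and subV': "complex_vector.subspace V'" using V' by (auto simp: hclosed_def)
  have "?T ` hcarrier D = da_valued D' V'"
  proof (rule D'.D.hclosed_eqI[OF closed])
    show "complex_vector.subspace (da_valued D' V')" using subV' by (rule D'.subspace_da_valued)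
    show "da_valued D' V' \<subseteq> hcarrier D'" by (auto simp: da_valued_def)
    show "?T ` hcarrier D \<subseteq> da_valued D' V'"
    proof
      fix f assume "f \<in> ?T ` hcarrier D"
      then obtain g where g: "g \<in> hcarrier D" "f = ?T g" by blast
      have "f z \<in> V'" if z: "z \<in> unit_ball" for z
      proof -
        have gz: "g z \<in> hcarrier E" using D.app_mem[OF g(1) z] .
        obtain p where p: "p \<in> V" "g z - p \<in> W"
          using D.E.orthogonal_projection[OF V gz] by (auto simp: W_def)
        have "\<phi> z (g z) = \<phi> z (p + (g z - p))" by simp
        also have "\<dots> = \<phi> z p + \<phi> z (g z - p)"
          by (rule bounded_op_add[OF \<phi>[OF z]]) (use p VE WE in auto)
        also have "\<dots> = \<phi> 0 (g z - p)" using \<phi>V[OF p(1) z] \<phi>W[OF p(2) z] by simp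
        finally show ?thesis using g(2) z p(2) by (simp add: mult_op_def V'_def)
      qed
      then show "f \<in> da_valued D' V'" using bounded_op_mem[OF b g(1)] g(2) by (simp add: da_valued_def)
    qed
    show "da_valued D' V' \<inter> hcompl D' (?T ` hcarrier D) \<subseteq> {0}"
    proof
      fix f assume f: "f \<in> da_valued D' V' \<inter> hcompl D' (?T ` hcarrier D)"
      then have fD: "f \<in> hcarrier D'" by (simp add: hcompl_def)
      have "f w = 0" if w: "w \<in> unit_ball" for w
      proof -
        \<comment> \<open>The multiplier sends \<open>da_vec w \<eta>\<close> to the kernel vector
          at \<open>w\<close> in the direction \<open>f w\<close>. Orthogonality of \<open>f\<close>
          to that image is the vanishing of the squared norm of \<open>f w\<close>.\<close>
        obtain \<eta> where \<eta>: "\<eta> \<in> W" "f w = \<phi> 0 \<eta>" using f w unfolding da_valued_def V'_def by blast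
        have \<eta>E: "\<eta> \<in> hcarrier E" using \<eta> WE by blast
        have \<phi>\<eta>: "\<phi> 0 \<eta> \<in> hcarrier F" using bounded_op_mem[OF \<phi>[OF zero_unit_ball] \<eta>E] .
        have "?T (da_vec w \<eta>) = da_vec w (\<phi> 0 \<eta>)"
        proof
          fix z :: "complex ^ 'n"
          show "?T (da_vec w \<eta>) z = da_vec w (\<phi> 0 \<eta>) z"
          proof (cases "z \<in> unit_ball")
            case True
            then show ?thesis
              using bounded_op_scaleC[OF \<phi>[OF True] \<eta>E] \<phi>W[OF \<eta>(1) True] by (simp add: mult_op_def da_vec_def)
          qed (simp add: mult_op_def da_vec_def)
        qed
        moreover have "hinner D' f (?T (da_vec w \<eta>)) = 0"
          using f D.da_vec_mem[OF w \<eta>E] by (auto simp: hcompl_def)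
        ultimately have "hinner F (f w) (f w) = 0"
          using D'.reproducing[OF fD w \<phi>\<eta>] \<eta>(2) by simp
        then show ?thesis using D'.E.inner_positive[of "f w"] \<phi>\<eta> \<eta>(2) by fastforce
      qed
      then have "f z = 0" for z using D'.app_off[OF fD] by (cases "z \<in> unit_ball") auto
      then show "f \<in> {0}" by (simp add: fun_eq_iff)
    qed
  qed
  then show ?thesis using V' by blast
qed

section \<open>The module as a quotient by a space of vector-valued functions\<close>

text \<open>The complement \<open>W\<close> of \<open>V\<close> has the wrong type to serve as
  coefficient space, so it is copied into \<open>H\<close> by sending \<open>\<eta>\<close> to the
  image under \<open>X\<close> of the constant function \<open>\<eta>\<close>. The vectors
  \<open>X (da_vec w \<eta>)\<close> in \<open>H\<close> and \<open>da_vec w (B \<eta>)\<close> in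
  the target then have the same Gram matrix, because \<open>X\<close> preserves inner products with
  vectors orthogonal to its kernel.\<close>

lemma isomorphic_da_tensor_of_co_isometry:
  fixes E :: "'a::complex_vector hilb" and H :: "'h::complex_vector hilb"
    and D :: "(complex ^ 'n::finite \<Rightarrow> 'a) hilb"
  assumes H: "hilbert_space H" and D: "da_space E D"
    and co: "co_isometry D H X" and intertwine: "intertwines D coord_mult M X"
    and surj: "X ` hcarrier D = hcarrier H"
    and V: "hclosed E V" and kernel: "hkernel D X = da_valued D V"
  shows "\<exists>F :: 'h hilb. hilbert_space F \<and>
    isometrically_isomorphic H M (da_tensor F :: (complex ^ 'n \<Rightarrow> 'h) hilb) coord_mult"
proof -
  interpret H: hilbert_space H by fact
  interpret D: da_space E D by fact
  interpret DH: hilbert_space_pair D H by unfold_locales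
  interpret EH: hilbert_space_pair E H by unfold_locales
  have b: "bounded_op D H X" using co by (simp add: co_isometry_def)
  have VE: "V \<subseteq> hcarrier E" using V by (simp add: hclosed_def)
  define W where "W = hcompl E V"
  have W: "hclosed E W" unfolding W_def using VE by (rule D.E.hclosed_hcompl)
  have WE: "W \<subseteq> hcarrier E" by (auto simp: W_def hcompl_def)
  have vec: "da_vec w \<eta> \<in> hcompl D (hkernel D X)" if "w \<in> unit_ball" "\<eta> \<in> W" for w \<eta>
    unfolding kernel using D.da_vec_hcompl_da_valued[OF VE _ that(1)] that(2) by (simp add: W_def)
  have X_vec: "hinner H (X g) (X (da_vec w \<eta>)) = hinner E (g w) \<eta>"
    if "g \<in> hcarrier D" "w \<in> unit_ball" "\<eta> \<in> W" for g w \<eta>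
    using DH.co_isometry_inner[OF co that(1) vec[OF that(2,3)]] D.reproducing[OF that(1,2)] WE that(3) by auto
  have X_mem: "X (da_vec w \<eta>) \<in> hcarrier H" if "w \<in> unit_ball" "\<eta> \<in> W" for w \<eta>
    using bounded_op_mem[OF b D.da_vec_mem] WE that by blast
  have v_mem: "da_vec w \<eta> \<in> hcarrier D" if "w \<in> unit_ball" "\<eta> \<in> W" for w \<eta>
    using D.da_vec_mem WE that by blast
  define B where "B \<eta> = X (da_vec 0 \<eta>)" for \<eta>
  have B_inner: "hinner H (B \<eta>) (B \<zeta>) = hinner E \<eta> \<zeta>" if "\<eta> \<in> W" "\<zeta> \<in> W" for \<eta> \<zeta>
    using X_vec[OF v_mem[OF zero_unit_ball that(1)] zero_unit_ball that(2)] by (simp add: B_def D.da_vec_0)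
  have B: "bounded_op E H B"
  proof -
    obtain C where C: "\<forall>f\<in>hcarrier D. hnorm H (X f) \<le> C * hnorm D f" using b unfolding bounded_op_def by blast
    have "hnorm H (B \<eta>) \<le> C * hnorm E \<eta>" if "\<eta> \<in> hcarrier E" for \<eta>
      using C bounded_op_mem[OF D.da_vec_0_bounded that] D.hnorm_da_vec_0[OF that] unfolding B_def by metis
    then show ?thesis
      using D.da_vec_0_bounded b unfolding bounded_op_def B_def by (auto simp: Pi_iff)
  qed
  define F where "F = subhilb H (B ` W)"
  have BW: "hclosed H (B ` W)"
    by (rule EH.isometric_image_hclosed[OF B W]) (simp add: hnorm_def B_inner)
  have F: "hilbert_space F" unfolding F_def using BW by (rule H.hilbert_space_subhilb)
  define K where "K = (da_tensor F :: (complex ^ 'n \<Rightarrow> 'h) hilb)"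
  interpret K: da_space F K unfolding K_def using F by (rule da_space_da_tensor)
  interpret HK: hilbert_space_pair H K by unfold_locales
  have BF: "B \<eta> \<in> hcarrier F" if "\<eta> \<in> W" for \<eta> using that by (simp add: F_def)
  define I where "I = (unit_ball :: (complex ^ 'n) set) \<times> W"
  obtain U where U: "unitary_op H K U"
    and U_vec: "\<And>p. p \<in> I \<Longrightarrow> U (case p of (w, \<eta>) \<Rightarrow> X (da_vec w \<eta>)) = (case p of (w, \<eta>) \<Rightarrow> da_vec w (B \<eta>))"
  proof (rule HK.gram_unitary[of "\<lambda>(w, \<eta>). X (da_vec w \<eta>)" I "\<lambda>(w, \<eta>). da_vec w (B \<eta>)"])
    show "htotal H ((\<lambda>(w, \<eta>). X (da_vec w \<eta>)) ` I)"
      unfolding htotal_def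
    proof (intro conjI subsetI)
      fix h assume h: "h \<in> hcompl H ((\<lambda>(w, \<eta>). X (da_vec w \<eta>)) ` I)"
      then obtain g where g: "g \<in> hcarrier D" "h = X g" using surj by (auto simp: hcompl_def)
      \<comment> \<open>A vector \<open>X g\<close> orthogonal to the family has values of
        \<open>g\<close> orthogonal to \<open>W\<close>, hence in \<open>V\<close> because
        \<open>V\<close> is closed; so \<open>g\<close> lies in the kernel and \<open>X g\<close> is
        0.\<close>
      have "g w \<in> V" if w: "w \<in> unit_ball" for w
      proof -
        have "hinner E (g w) \<eta> = 0" if "\<eta> \<in> W" for \<eta>
          using h X_vec[OF g(1) w that] w that g(2) by (auto simp: hcompl_def I_def)
        then have "g w \<in> hcompl E W" using D.app_mem[OF g(1) w] by (simp add: hcompl_def)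
        then show ?thesis unfolding W_def D.E.hcompl_hcompl[OF V] .
      qed
      then have "g \<in> hkernel D X" unfolding kernel using g(1) by (simp add: da_valued_def)
      then show "h \<in> {0}" using g(2) by (simp add: hkernel_def)
    qed (use X_mem in \<open>auto simp: I_def simp del: mem_ball_0\<close>)
    have "(\<lambda>(w, \<eta>). da_vec w (B \<eta>)) ` I
        = (\<lambda>(w, \<zeta>). da_vec w \<zeta>) ` ((unit_ball :: (complex ^ 'n) set) \<times> hcarrier F)"
      by (force simp: I_def F_def simp del: mem_ball_0)
    then show "htotal K ((\<lambda>(w, \<eta>). da_vec w (B \<eta>)) ` I)"
      using K.da_vec_total by simp
    fix p q assume p: "p \<in> I" and q: "q \<in> I"
    obtain w \<eta> u \<zeta> where pq: "p = (w, \<eta>)" "q = (u, \<zeta>)"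
      "w \<in> unit_ball" "u \<in> unit_ball" "\<eta> \<in> W" "\<zeta> \<in> W"
      using p q by (cases p, cases q) (auto simp: I_def)
    have "hinner H (X (da_vec w \<eta>)) (X (da_vec u \<zeta>)) = da_kernel u w * hinner E \<eta> \<zeta>"
      using X_vec[OF v_mem[OF pq(3,5)] pq(4,6)] pq WE
      by (auto simp: da_vec_def D.E.inner_scaleC_left subset_iff)
    moreover have "hinner K (da_vec w (B \<eta>)) (da_vec u (B \<zeta>)) = da_kernel u w * hinner H (B \<eta>) (B \<zeta>)"
      using K.da_vec_gram[OF pq(3,4) BF[OF pq(5)] BF[OF pq(6)]] by (simp add: F_def)
    ultimately show "hinner K (case p of (w, \<eta>) \<Rightarrow> da_vec w (B \<eta>)) (case q of (w, \<eta>) \<Rightarrow> da_vec w (B \<eta>))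
        = hinner H (case p of (w, \<eta>) \<Rightarrow> X (da_vec w \<eta>)) (case q of (w, \<eta>) \<Rightarrow> X (da_vec w \<eta>))"
      using B_inner pq by simp
  qed blast
  have bU: "bounded_op H K U"
    and U_inner: "\<And>x y. x \<in> hcarrier H \<Longrightarrow> y \<in> hcarrier H \<Longrightarrow> hinner K (U x) (U y) = hinner H x y"
    using U by (auto simp: unitary_op_def)
  \<comment> \<open>Tested against \<open>B \<eta>\<close>, the values of \<open>U (X g)\<close> are
    those of \<open>g\<close> tested against \<open>\<eta>\<close>. The intertwining relation is
    thereby reduced to pointwise multiplication by the coordinates.\<close>
  have U_app: "hinner F (U (X g) w) (B \<eta>) = hinner E (g w) \<eta>"
    if g: "g \<in> hcarrier D" and w: "w \<in> unit_ball" and \<eta>: "\<eta> \<in> W" for g w \<eta>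
  proof -
    have Xg: "X g \<in> hcarrier H" using bounded_op_mem[OF b g] .
    have "hinner F (U (X g) w) (B \<eta>) = hinner K (U (X g)) (da_vec w (B \<eta>))"
      using K.reproducing[OF bounded_op_mem[OF bU Xg] w BF[OF \<eta>]] by simp
    also have "da_vec w (B \<eta>) = U (X (da_vec w \<eta>))" using U_vec[of "(w, \<eta>)"] w \<eta> by (simp add: I_def)
    also have "hinner K (U (X g)) (U (X (da_vec w \<eta>))) = hinner E (g w) \<eta>"
      using U_inner[OF Xg X_mem[OF w \<eta>]] X_vec[OF g w \<eta>] by simp
    finally show ?thesis .
  qed
  have "intertwines H M coord_mult U"
    unfolding intertwines_def
  proof (intro allI ballI)
    fix i h assume "h \<in> hcarrier H"
    then obtain g where g: "g \<in> hcarrier D" "h = X g" using surj by auto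
    have Mh: "M i h = X (coord_mult i g)" using intertwine g by (simp add: intertwines_def)
    have cg: "coord_mult i g \<in> hcarrier D" using g(1) by (rule D.coord_mult_mem)
    have Uh: "U h \<in> hcarrier K" using bounded_op_mem[OF bU bounded_op_mem[OF b g(1)]] g(2) by simp
    show "U (M i h) = coord_mult i (U h)"
      unfolding Mh
    proof (rule K.da_ext)
      show "U (X (coord_mult i g)) \<in> hcarrier K" using bounded_op_mem[OF bU bounded_op_mem[OF b cg]] .
      show "coord_mult i (U h) \<in> hcarrier K" using Uh by (rule K.coord_mult_mem)
      fix w :: "complex ^ 'n" and \<zeta> assume w: "w \<in> unit_ball" and "\<zeta> \<in> hcarrier F"
      then obtain \<eta> where \<eta>: "\<eta> \<in> W" "\<zeta> = B \<eta>" by (auto simp: F_def)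
      have "hinner F (U (X (coord_mult i g)) w) \<zeta> = w $ i * hinner E (g w) \<eta>"
        using U_app[OF cg w \<eta>(1)] D.app_mem[OF g(1) w] \<eta> WE
        by (auto simp: coord_mult_def D.E.inner_scaleC_left)
      also have "\<dots> = hinner F (coord_mult i (U h) w) \<zeta>"
        using U_app[OF g(1) w \<eta>(1)] K.app_mem[OF Uh w] BF[OF \<eta>(1)] \<eta>(2) g(2)
        by (simp add: coord_mult_def K.E.inner_scaleC_left)
      finally show "hinner F (U (X (coord_mult i g)) w) \<zeta> = hinner F (coord_mult i (U h) w) \<zeta>" .
    qed
  qed
  then show ?thesis
    using F U unfolding isometrically_isomorphic_def K_def by blast
qed

section \<open>Passage along the resolution to the module\<close>

theorem theorem7p2:
  fixes H :: "'h::complex_vector hilb"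
    and M :: "'n::finite \<Rightarrow> 'h \<Rightarrow> 'h"
    and N :: nat
    and E :: "nat \<Rightarrow> 'e::complex_vector hilb"
    and \<phi> :: "nat \<Rightarrow> complex ^ 'n \<Rightarrow> 'e \<Rightarrow> 'e"
    and X\<^sub>0 :: "(complex ^ 'n \<Rightarrow> 'e) \<Rightarrow> 'h"
  assumes "CARD('n) > 1"
    and "pure_module H M"
    and "finite_inner_resolution H M N E \<phi> X\<^sub>0"
  shows "\<exists>F :: 'h hilb. hilbert_space F \<and>
    isometrically_isomorphic H M (da_tensor F :: (complex ^ 'n \<Rightarrow> 'h) hilb) coord_mult"
proof -
  let ?D = "\<lambda>k. da_tensor (E k) :: (complex ^ 'n \<Rightarrow> 'e) hilb"
  let ?T = "\<lambda>k. mult_op (\<phi> k)"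
  have H: "hilbert_space H"
    using assms(2) by (simp add: pure_module_def co_spherically_contractive_def hilbert_module_def)
  have N: "1 \<le> N" and E: "\<And>k. k \<le> N \<Longrightarrow> hilbert_space (E k)"
    and inner: "\<And>k. 1 \<le> k \<Longrightarrow> k \<le> N \<Longrightarrow> inner_multiplier (E k) (E (k - 1)) (\<phi> k)"
    and co: "co_isometry (?D 0) H X\<^sub>0" and intertwine: "intertwines (?D 0) coord_mult M X\<^sub>0"
    and injective: "hkernel (?D N) (?T N) = {0}"
    and exact: "\<And>k. 1 \<le> k \<Longrightarrow> k < N \<Longrightarrow> ?T (k + 1) ` hcarrier (?D (k + 1)) = hkernel (?D k) (?T k)"
    and exact0: "?T 1 ` hcarrier (?D 1) = hkernel (?D 0) X\<^sub>0"
    and surj: "X\<^sub>0 ` hcarrier (?D 0) = hcarrier H"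
    using assms(3) by (simp_all add: finite_inner_resolution_def)
  have D: "da_space (E k) (?D k)" if "k \<le> N" for k
    using E[OF that] by (rule da_space_da_tensor)
  have iso: "partial_isometry (?D k) (?D (k - 1)) (?T k)" if "1 \<le> k" "k \<le> N" for k
    using inner[OF that] by (simp add: inner_multiplier_def)
  have \<phi>: "bounded_op (E k) (E (k - 1)) (\<phi> k z)" if "1 \<le> k" "k \<le> N" "z \<in> unit_ball" for k z
    using inner[OF that(1,2)] that(3) by (simp add: inner_multiplier_def multiplier_def holomorphic_op_def)
  have pair: "hilbert_space_pair (?D k) (?D (k - 1))" if "k \<le> N" for k
    using D[of k] D[of "k - 1"] that by (simp add: hilbert_space_pair_def da_space_def)
  have range: "\<exists>V'. hclosed (E (k - 1)) V' \<and> ?T k ` hcarrier (?D k) = da_valued (?D (k - 1)) V'"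
    if k: "1 \<le> k" "k \<le> N" and closed: "hclosed (?D (k - 1)) (?T k ` hcarrier (?D k))"
      and V: "\<exists>V. hclosed (E k) V \<and> hkernel (?D k) (?T k) = da_valued (?D k) V" for k
  proof -
    obtain V where "hclosed (E k) V" "hkernel (?D k) (?T k) = da_valued (?D k) V" using V by blast
    then show ?thesis
      by (intro inner_multiplier_range[OF assms(1) D D iso \<phi> _ _ closed]) (use k in auto)
  qed
  \<comment> \<open>The induction runs downwards from \<open>N\<close> and stops at 1, since the
    kernel at level 0 is that of \<open>X\<^sub>0\<close>, which is not a multiplier. For
    \<open>N = 1\<close> the base case is already the claim.\<close>
  have kernel: "\<exists>V. hclosed (E 1) V \<and> hkernel (?D 1) (?T 1) = da_valued (?D 1) V"
    using N
  proof (induction rule: inc_induct)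
    case base
    interpret DN: da_space "E N" "?D N" by (rule D) simp
    \<comment> \<open>Injectivity at the left end is the invariant with the zero subspace.\<close>
    have "hclosed (E N) {0}"
      unfolding hclosed_def
    proof (intro conjI allI impI)
      fix s x assume s: "\<forall>k. s k \<in> {0}" and x: "x \<in> hcarrier (E N)" "hconv (E N) s x"
      have "hconv (E N) s 0" using s by (simp add: hconv_def)
      then show "x \<in> {0}"
        using DN.E.hconv_unique[of s x 0] s x by simp
    qed (auto simp: complex_vector.subspace_single_0)
    moreover have "da_valued (?D N) {0} = {0}"
    proof
      show "da_valued (?D N) {0} \<subseteq> {0}"
      proof
        fix f assume f: "f \<in> da_valued (?D N) {0}"
        then have "f z = 0" for z
          using DN.app_off[of f z] by (cases "z \<in> unit_ball") (auto simp: da_valued_def)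
        then show "f \<in> {0}" by (simp add: fun_eq_iff)
      qed
    qed (simp add: da_valued_def)
    ultimately show ?case using injective by metis
  next
    case (step k)
    interpret P: hilbert_space_pair "?D k" "?D (k - 1)" using step by (intro pair) simp
    have b: "bounded_op (?D k) (?D (k - 1)) (?T k)"
      using iso[of k] step by (simp add: partial_isometry_def)
    \<comment> \<open>Exactness identifies this range with the kernel of the next bounded map, which
      is closed.\<close>
    have "hclosed (?D k) (?T (Suc k) ` hcarrier (?D (Suc k)))"
      using exact[of k] P.hclosed_hkernel[OF b] step by simp
    then show ?case using range[of "Suc k"] exact[of k] step by simp
  qed
  interpret D0: da_space "E 0" "?D 0" by (rule D) simp
  interpret H: hilbert_space H by (rule H)
  interpret P: hilbert_space_pair "?D 0" H by unfold_locales
  have b: "bounded_op (?D 0) H X\<^sub>0" using co by (simp add: co_isometry_def)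
  \<comment> \<open>One more use of \<open>range\<close>, now with exactness at the first free
    module: the range of the first multiplier is the kernel of the co-isometry.\<close>
  have "\<exists>V. hclosed (E 0) V \<and> hkernel (?D 0) X\<^sub>0 = da_valued (?D 0) V"
    using range[of 1] kernel exact0 P.hclosed_hkernel[OF b] N by simp
  then obtain V where "hclosed (E 0) V" "hkernel (?D 0) X\<^sub>0 = da_valued (?D 0) V" by blast
  then show ?thesis
    by (rule isomorphic_da_tensor_of_co_isometry[OF H D0.da_space_axioms co intertwine surj])
qed

end
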